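(* Let $k \ge 1$ be an integer and let $X$ be an $\mathbb{R}^k$-valued random variable with mean $0$, covariance matrix $\Sigma$, and $\|X\| \le \beta$ almost surely, where $\beta$ is a real number. Let $\sigma_{\min}^2$ denote the smallest eigenvalue of $\Sigma$, and assume $\sigma_{\min}^2 > 0$. For $t \ge 0$ let $Z_t$ denote a Gaussian random vector in $\mathbb{R}^k$ of mean $0$ and covariance $t\Sigma$, independent of $X$. Then for any positive integer $n \ge \frac{5\beta^2}{\sigma_{\min}^2}$, $$ \mathcal{W}_2(Z_n, Z_{n-1} + X) \le \frac{5\sqrt{k}\,\beta}{n}. $$
   Context: $\|\cdot\|$ is the Euclidean norm. For probability measures $\mu, \nu$ on $\mathbb{R}^k$, the quadratic transportation (Wasserstein) distance is $$\mathcal{W}_2(\mu,\nu) = \left( \inf_{\gamma \in \Gamma(\mu,\nu)} \int \|x-y\|^2 \, d\gamma(x,y) \right)^{1/2},$$ where $\Gamma(\mu,\nu)$ is the set of probability measures on $\mathbb{R}^k \times \mathbb{R}^k$ with marginals $\mu$ and $\nu$. For random vectors $U, V$ with laws $\mu, \nu$, one writes $\mathcal{W}_2(U,V) = \mathcal{W}_2(\mu,\nu)$. *)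

theory Defs
  imports "HOL-Probability.Probability"
begin

definition couplings ::
  "(real ^ 'k) measure \<Rightarrow> (real ^ 'k) measure \<Rightarrow> ((real ^ 'k) \<times> (real ^ 'k)) measure set"
  where
  "couplings \<mu> \<nu> =
     {\<gamma>. prob_space \<gamma> \<and> sets \<gamma> = sets (borel \<Otimes>\<^sub>M borel) \<and>
         distr \<gamma> borel fst = \<mu> \<and> distr \<gamma> borel snd = \<nu>}"

(* The square root on the extended half-line, needed because the infimum of the transport cost
   may be infinite in general. *)
definition ennreal_sqrt :: "ennreal \<Rightarrow> ennreal" where
  "ennreal_sqrt x = (if x = \<top> then \<top> else ennreal (sqrt (enn2real x)))"

definition wasserstein2 :: "(real ^ 'k) measure \<Rightarrow> (real ^ 'k) measure \<Rightarrow> ennreal" where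
  "wasserstein2 \<mu> \<nu> =
     ennreal_sqrt
       (INF \<gamma> \<in> couplings \<mu> \<nu>. \<integral>\<^sup>+ z. ennreal ((norm (fst z - snd z))\<^sup>2) \<partial>\<gamma>)"

definition mean :: "'a measure \<Rightarrow> ('a \<Rightarrow> real ^ 'k) \<Rightarrow> real ^ 'k" where
  "mean M X = (\<integral>\<omega>. X \<omega> \<partial>M)"

definition covariance_matrix :: "'a measure \<Rightarrow> ('a \<Rightarrow> real ^ 'k) \<Rightarrow> real ^ 'k ^ 'k" where
  "covariance_matrix M X =
     (\<chi> i j. \<integral>\<omega>. (X \<omega> $ i - mean M X $ i) * (X \<omega> $ j - mean M X $ j) \<partial>M)"

(* Normal laws on the line; point masses are the normal laws of variance zero. *)
definition gaussian_law :: "real measure \<Rightarrow> bool" where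
  "gaussian_law \<mu> \<longleftrightarrow>
     (\<exists>m. \<mu> = return borel m) \<or>
     (\<exists>m s. 0 < s \<and> \<mu> = density lborel (\<lambda>x. ennreal (normal_density m s x)))"

(* A random vector is Gaussian (possibly degenerate) if all its linear functionals are. *)
definition gaussian_vector :: "'a measure \<Rightarrow> ('a \<Rightarrow> real ^ 'k) \<Rightarrow> bool" where
  "gaussian_vector M Z \<longleftrightarrow>
     Z \<in> borel_measurable M \<and> (\<forall>u. gaussian_law (distr M borel (\<lambda>\<omega>. u \<bullet> Z \<omega>)))"

definition matrix_eigenvalue :: "real ^ 'k ^ 'k \<Rightarrow> real \<Rightarrow> bool" where
  "matrix_eigenvalue A l \<longleftrightarrow> (\<exists>v. v \<noteq> 0 \<and> A *v v = l *\<^sub>R v)"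

(* Meaningful for matrices with at least one real eigenvalue, in particular symmetric ones. *)
definition smallest_eigenvalue :: "real ^ 'k ^ 'k \<Rightarrow> real" where
  "smallest_eigenvalue A = (LEAST l. matrix_eigenvalue A l)"

end

theory Submission
  imports Defs "HOL-Complex_Analysis.Complex_Analysis"
begin

text \<open>The law of \<open>Z_n + r X\<close> is transported in \<open>r\<close> by the bounded smooth velocity field
  \<open>m_r(u) = E[X | Z_n + r X = u]\<close>, whose flow therefore maps \<open>Z_n\<close> to \<open>Z_n + r X\<close>. Rescaling by
  \<open>(1 + r\<^sup>2/n)\<^sup>-\<^sup>1\<^sup>/\<^sup>2\<close> makes the covariance constant, replaces the velocity by
  \<open>m_r(u) - r/(n + r\<^sup>2) u\<close>, and ends at \<open>Z_{n-1} + X\<close> for \<open>r\<^sup>2 = n/(n-1)\<close>. Since \<open>W_2\<close> is at most the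
  \<open>L\<^sup>2\<close>-length of this curve, it suffices to bound \<open>E|m_r(U) - r/(n + r\<^sup>2) U|\<^sup>2\<close> for
  \<open>U = Z_n + r X\<close>. By Jensen the density of \<open>U\<close> relative to \<open>Z_n\<close> is at least \<open>exp(-r\<^sup>2 k/(2n))\<close>;
  the remaining Gaussian integral is, by the Cameron-Martin formula, an expectation over two
  independent copies \<open>X, X'\<close> of an exponential of \<open>(r\<^sup>2/n) \<langle>X, \<Sigma>\<^sup>-\<^sup>1 X'\<rangle>\<close>. Its terms of order 0 and 1
  cancel, and the quadratic term is controlled by \<open>\<beta>\<^sup>2 E\<langle>X, \<Sigma>\<^sup>-\<^sup>1 X'\<rangle>\<^sup>2 = \<beta>\<^sup>2 k\<close>.\<close>

section \<open>Moment generating and characteristic functions on Euclidean spaces\<close>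

text \<open>Moving in \<open>r\<close> rather than in the variance keeps the velocity a conditional
  mean of X, regular down to r = 0. Subtracting r/(n + r^2) u removes the linear regression of X on
  U, without which the velocity is of order n^(-1/2) in L^2. That the flow reproduces the laws is
  shown on Euler steps, with smooth test functions for which replacing X by its conditional mean
  costs O(h^2) per step. The hypothesis on n acts in three ways. It makes the Lipschitz constant of
  the field times the length of the time interval at most 1/2, so that one contraction gives the
  flow on all of it. It keeps the exponent (r^2/n) <X, \<Sigma>^-1 X'> at most 1/4. And since k
  \<sigma>_min^2 <= E|X|^2 <= \<beta>^2, it gives n >= 5k, hence R^2 = n/(n - 1) <= 5/4 for the
  final time R, and a relative density of at least 1/2. The squared velocity is at most 4 (R^2/n)^2
  k \<beta>^2 in mean; the factor R^2 of the squared length, a factor 2 for the discretisation and 8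
  (5/4)^3 < 25 give the constant 5.\<close>

lemma cis_measurable [measurable]: "cis \<in> borel_measurable borel"
  by (intro borel_measurable_continuous_onI continuous_intros)

lemma exp_abs_le_add_exp:
  fixes x :: real
  shows "exp \<bar>x\<bar> \<le> exp x + exp (- x)"
  by (cases "x \<ge> 0") (auto simp: abs_if add_increasing add_increasing2)

context
  fixes M :: "'a measure" and Y :: "'a \<Rightarrow> real"
  assumes Y [measurable]: "Y \<in> borel_measurable M"
    and mgf: "\<And>s. integrable M (\<lambda>\<omega>. exp (s * Y \<omega>))"
begin

lemma integrable_exp_abs_mgf: "integrable M (\<lambda>\<omega>. exp (s * \<bar>Y \<omega>\<bar>))"
proof (rule Bochner_Integration.integrable_bound)
  show "integrable M (\<lambda>\<omega>. exp (s * Y \<omega>) + exp (- s * Y \<omega>))"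
    by (intro Bochner_Integration.integrable_add mgf)
  show "AE \<omega> in M. norm (exp (s * \<bar>Y \<omega>\<bar>)) \<le> norm (exp (s * Y \<omega>) + exp (- s * Y \<omega>))"
  proof (rule AE_I2)
    fix \<omega>
    have "exp (s * \<bar>Y \<omega>\<bar>) \<le> exp \<bar>s * Y \<omega>\<bar>"
      by (simp add: abs_mult mult_right_mono)
    also have "\<dots> \<le> exp (s * Y \<omega>) + exp (- s * Y \<omega>)"
      using exp_abs_le_add_exp[of "s * Y \<omega>"] by simp
    finally show "norm (exp (s * \<bar>Y \<omega>\<bar>)) \<le> norm (exp (s * Y \<omega>) + exp (- s * Y \<omega>))"
      by simp
  qed
qed measurable

text \<open>The exponential series may be integrated term by term: its partial sums are dominated by
  \<open>exp (norm w * \<bar>Y \<omega>\<bar>)\<close>, integrable since the moment generating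
  function is finite on both sides of 0. Hence the transform is an entire function of
  \<open>w\<close>.\<close>

lemma complex_mgf_sums:
  "(\<lambda>m. (\<integral>\<omega>. complex_of_real (Y \<omega> ^ m / fact m) \<partial>M) * w ^ m)
     sums (\<integral>\<omega>. exp (w * complex_of_real (Y \<omega>)) \<partial>M)"
proof -
  let ?t = "\<lambda>m \<omega>. (w * complex_of_real (Y \<omega>)) ^ m /\<^sub>R fact m"
  have bound: "norm (\<Sum>m<i. ?t m \<omega>) \<le> exp (norm w * \<bar>Y \<omega>\<bar>)" for i \<omega>
  proof -
    have "norm (\<Sum>m<i. ?t m \<omega>) \<le> (\<Sum>m<i. (norm w * \<bar>Y \<omega>\<bar>) ^ m /\<^sub>R fact m)"
      by (rule order.trans[OF norm_sum]) (auto simp: norm_mult norm_power divide_simps)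
    also have "\<dots> \<le> (\<Sum>m. (norm w * \<bar>Y \<omega>\<bar>) ^ m /\<^sub>R fact m)"
      by (intro sum_le_suminf summable_exp_generic) auto
    also have "\<dots> = exp (norm w * \<bar>Y \<omega>\<bar>)"
      by (simp add: exp_def)
    finally show ?thesis .
  qed
  have int: "integrable M (?t m)" for m
  proof (rule Bochner_Integration.integrable_bound[OF integrable_exp_abs_mgf[of "norm w"]])
    show "AE \<omega> in M. norm (?t m \<omega>) \<le> norm (exp (norm w * \<bar>Y \<omega>\<bar>))"
    proof (rule AE_I2)
      fix \<omega>
      have "norm (?t m \<omega>) = (\<Sum>j\<in>{m}. (norm w * \<bar>Y \<omega>\<bar>) ^ j /\<^sub>R fact j)"
        by (simp add: norm_mult norm_power divide_simps)
      also have "\<dots> \<le> (\<Sum>j. (norm w * \<bar>Y \<omega>\<bar>) ^ j /\<^sub>R fact j)"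
        by (rule sum_le_suminf[OF summable_exp_generic]) auto
      finally show "norm (?t m \<omega>) \<le> norm (exp (norm w * \<bar>Y \<omega>\<bar>))"
        by (simp add: exp_def)
    qed
  qed measurable
  have "(\<lambda>i. \<integral>\<omega>. (\<Sum>m<i. ?t m \<omega>) \<partial>M) \<longlonglongrightarrow> (\<integral>\<omega>. exp (w * complex_of_real (Y \<omega>)) \<partial>M)"
  proof (rule integral_dominated_convergence[where w = "\<lambda>\<omega>. exp (norm w * \<bar>Y \<omega>\<bar>)"])
    show "AE \<omega> in M. (\<lambda>i. \<Sum>m<i. ?t m \<omega>) \<longlonglongrightarrow> exp (w * complex_of_real (Y \<omega>))"
      using exp_converges by (auto simp: sums_def)
  qed (use bound integrable_exp_abs_mgf in auto)
  moreover have "(\<integral>\<omega>. (\<Sum>m<i. ?t m \<omega>) \<partial>M)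
      = (\<Sum>m<i. (\<integral>\<omega>. complex_of_real (Y \<omega> ^ m / fact m) \<partial>M) * w ^ m)" for i
  proof -
    have "?t m \<omega> = complex_of_real (Y \<omega> ^ m / fact m) * w ^ m" for m \<omega>
      by (simp add: power_mult_distrib scaleR_conv_of_real field_simps)
    then show ?thesis
      using int by (simp add: Bochner_Integration.integral_sum)
  qed
  ultimately show ?thesis
    by (simp add: sums_def)
qed

end

text \<open>The difference \<open>F\<close> of the two transforms is entire and vanishes on the real
  axis, so by the identity theorem it vanishes at \<open>\<i> * t\<close>, where it compares the
  characteristic functions.\<close>

lemma cis_integral_eq_if_mgf_eq:
  fixes Y :: "'a \<Rightarrow> real" and Y' :: "'b \<Rightarrow> real"
  assumes [measurable]: "Y \<in> borel_measurable M" "Y' \<in> borel_measurable M'"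
    and int: "\<And>s. integrable M (\<lambda>\<omega>. exp (s * Y \<omega>))" "\<And>s. integrable M' (\<lambda>\<omega>. exp (s * Y' \<omega>))"
    and eq: "\<And>s. (\<integral>\<omega>. exp (s * Y \<omega>) \<partial>M) = (\<integral>\<omega>. exp (s * Y' \<omega>) \<partial>M')"
  shows "(\<integral>\<omega>. cis (t * Y \<omega>) \<partial>M) = (\<integral>\<omega>. cis (t * Y' \<omega>) \<partial>M')"
proof -
  define F where "F w = (\<integral>\<omega>. exp (w * complex_of_real (Y \<omega>)) \<partial>M)
      - (\<integral>\<omega>. exp (w * complex_of_real (Y' \<omega>)) \<partial>M')" for w
  define a where "a m = (\<integral>\<omega>. complex_of_real (Y \<omega> ^ m / fact m) \<partial>M)
      - (\<integral>\<omega>. complex_of_real (Y' \<omega> ^ m / fact m) \<partial>M')" for m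
  have F: "(\<lambda>m. a m * w ^ m) sums F w" for w
    unfolding F_def a_def left_diff_distrib
    by (intro sums_diff complex_mgf_sums int) measurable
  have hol: "F holomorphic_on UNIV"
  proof -
    have "F holomorphic_on ball 0 r" for r
      by (rule power_series_holomorphic[where a = a]) (use F in simp)
    then have "F field_differentiable at z" for z
      by (meson centre_in_ball holomorphic_on_imp_differentiable_at open_ball dist_norm
          mem_ball_0 less_add_one)
    then show ?thesis
      by (simp add: holomorphic_on_def)
  qed
  have real0: "F (complex_of_real s) = 0" for s
  proof -
    show ?thesis
      by (simp only: F_def of_real_mult[symmetric] exp_of_real integral_complex_of_real eq diff_self)
  qed
  have "F (\<i> * of_real t) = 0"
  proof (rule analytic_continuation[OF hol])
    show "0 islimpt (range complex_of_real)"
    proof (rule islimpt_sequential[THEN iffD2], intro exI conjI allI)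
      show "complex_of_real (inverse (Suc n)) \<in> range complex_of_real - {0}" for n
        by (intro DiffI rangeI) (simp del: of_nat_Suc)
      show "(\<lambda>n. complex_of_real (inverse (Suc n))) \<longlonglongrightarrow> 0"
        using tendsto_of_real[OF LIMSEQ_inverse_real_of_nat, where 'a = complex] by simp
    qed
  qed (use real0 in auto)
  then show ?thesis
    by (simp add: F_def cis_conv_exp mult.assoc)
qed

section \<open>The standard Gaussian measure and its transforms\<close>

definition std_gauss :: "'v::euclidean_space measure" where
  "std_gauss = density lborel (\<lambda>z. ennreal (\<Prod>b\<in>Basis. std_normal_density (z \<bullet> b)))"

lemma sets_std_gauss [measurable_cong, simp]: "sets std_gauss = sets borel"
  and space_std_gauss [simp]: "space std_gauss = UNIV"
  by (simp_all add: std_gauss_def)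

lemma std_gauss_real: "(std_gauss :: real measure) = std_normal_distribution"
  by (simp add: std_gauss_def)

interpretation std_gauss: prob_space "std_gauss :: 'v::euclidean_space measure"
proof
  have "emeasure (std_gauss :: 'v measure) UNIV
      = (\<integral>\<^sup>+z. (\<Prod>b\<in>Basis. ennreal (std_normal_density (z \<bullet> b))) \<partial>(lborel :: 'v measure))"
    by (simp add: std_gauss_def emeasure_density prod_ennreal)
  also have "\<dots> = (\<Prod>b\<in>(Basis :: 'v set). \<integral>\<^sup>+x. ennreal (std_normal_density x) \<partial>lborel)"
    by (rule nn_integral_lborel_prod) auto
  also have "\<dots> = 1"
    using prob_space.emeasure_space_1[OF prob_space_normal_density[of 1 0]]
    by (simp add: emeasure_density)
  finally show "emeasure (std_gauss :: 'v measure) (space std_gauss) = 1"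
    by simp
qed

lemma std_gauss_density_conv_norm:
  fixes z :: "'v::euclidean_space"
  shows "(\<Prod>b\<in>Basis. std_normal_density (z \<bullet> b))
      = (1 / sqrt (2 * pi)) ^ DIM('v) * exp (- (norm z)\<^sup>2 / 2)"
proof -
  have "(norm z)\<^sup>2 = (\<Sum>b\<in>Basis. (z \<bullet> b)\<^sup>2)"
    unfolding power2_norm_eq_inner by (subst euclidean_inner) (simp add: power2_eq_square)
  moreover have "std_normal_density x = 1 / sqrt (2 * pi) * exp (- x\<^sup>2 / 2)" for x
    by (simp add: normal_density_def)
  ultimately show ?thesis
    by (simp only: prod.distrib prod_constant exp_sum[OF finite_Basis, symmetric]
        sum_divide_distrib[symmetric] sum_negf)
qed

text \<open>Completing the square: translating Lebesgue measure by \<open>a\<close> turns the tilted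
  density into \<open>exp ((norm a)\<^sup>2 / 2)\<close> times the original one. Working with the
  nonnegative integral yields integrability and value together.\<close>

lemma std_gauss_mgf:
  fixes a :: "'v::euclidean_space"
  shows "(\<integral>\<^sup>+z. ennreal (exp (a \<bullet> z)) \<partial>std_gauss) = ennreal (exp ((norm a)\<^sup>2 / 2))"
proof -
  define c where "c = (1 / sqrt (2 * pi)) ^ DIM('v)"
  have c: "c \<ge> 0"
    by (simp add: c_def)
  let ?g = "\<lambda>z::'v. ennreal (c * exp (- (norm z)\<^sup>2 / 2))"
  have g: "std_gauss = density lborel ?g"
    unfolding std_gauss_def std_gauss_density_conv_norm c_def ..
  have "(\<integral>\<^sup>+z. ennreal (exp (a \<bullet> z)) \<partial>std_gauss)
      = (\<integral>\<^sup>+z. ?g z * ennreal (exp (a \<bullet> z)) \<partial>lborel)"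
    unfolding g by (subst nn_integral_density) auto
  also have "\<dots> = (\<integral>\<^sup>+z. ?g z * ennreal (exp (a \<bullet> z)) \<partial>distr lborel borel ((+) a))"
    by (simp add: lborel_distr_plus)
  also have "\<dots> = (\<integral>\<^sup>+z. ?g (a + z) * ennreal (exp (a \<bullet> (a + z))) \<partial>lborel)"
    by (subst nn_integral_distr) auto
  also have "\<dots> = (\<integral>\<^sup>+z. ennreal (exp ((norm a)\<^sup>2 / 2)) * ?g z \<partial>lborel)"
  proof (rule nn_integral_cong)
    fix z
    have "c * exp (- (norm (a + z))\<^sup>2 / 2) * exp (a \<bullet> (a + z))
        = exp ((norm a)\<^sup>2 / 2) * (c * exp (- (norm z)\<^sup>2 / 2))"
      by (simp add: exp_add[symmetric] power2_norm_eq_inner inner_add inner_commute field_simps)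
    then show "?g (a + z) * ennreal (exp (a \<bullet> (a + z))) = ennreal (exp ((norm a)\<^sup>2 / 2)) * ?g z"
      using c by (simp add: ennreal_mult'[symmetric])
  qed
  also have "\<dots> = ennreal (exp ((norm a)\<^sup>2 / 2)) * emeasure (std_gauss :: 'v measure) (space std_gauss)"
    by (subst nn_integral_cmult) (auto simp: g emeasure_density)
  finally show ?thesis
    by (simp only: std_gauss.emeasure_space_1 mult_1_right)
qed

lemma std_gauss_mgf_integral:
  fixes a :: "'v::euclidean_space"
  shows "integrable std_gauss (\<lambda>z. exp (a \<bullet> z))"
    and "(\<integral>z. exp (a \<bullet> z) \<partial>std_gauss) = exp ((norm a)\<^sup>2 / 2)"
proof -
  have *: "has_bochner_integral std_gauss (\<lambda>z. exp (a \<bullet> z)) (exp ((norm a)\<^sup>2 / 2))"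
    by (rule has_bochner_integral_nn_integral) (auto simp: std_gauss_mgf)
  show "integrable std_gauss (\<lambda>z. exp (a \<bullet> z))"
    and "(\<integral>z. exp (a \<bullet> z) \<partial>std_gauss) = exp ((norm a)\<^sup>2 / 2)"
    using * by (auto simp: has_bochner_integral_iff)
qed

text \<open>\<open>u \<bullet> z\<close> and \<open>norm u * x\<close>, with \<open>x\<close>
  standard normal on the line, have the same moment generating function, so the one-dimensional
  characteristic function gives the general one.\<close>

lemma std_gauss_char:
  fixes u :: "'v::euclidean_space"
  shows "(\<integral>z. cis (u \<bullet> z) \<partial>std_gauss) = of_real (exp (- (norm u)\<^sup>2 / 2))"
proof -
  have 1: "(\<integral>z. cis (1 * (u \<bullet> z)) \<partial>std_gauss)
      = (\<integral>x. cis (1 * (norm u * x)) \<partial>(std_gauss :: real measure))"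
  proof (rule cis_integral_eq_if_mgf_eq)
    fix s :: real
    show "integrable std_gauss (\<lambda>z. exp (s * (u \<bullet> z)))"
      using std_gauss_mgf_integral(1)[of "s *\<^sub>R u"] by simp
    show "integrable (std_gauss :: real measure) (\<lambda>x. exp (s * (norm u * x)))"
      using std_gauss_mgf_integral(1)[of "s * norm u"] by (simp add: mult.assoc)
    show "(\<integral>z. exp (s * (u \<bullet> z)) \<partial>std_gauss) = (\<integral>x. exp (s * (norm u * x)) \<partial>(std_gauss :: real measure))"
      using std_gauss_mgf_integral(2)[of "s *\<^sub>R u"] std_gauss_mgf_integral(2)[of "s * norm u"]
      by (simp add: mult.assoc power_mult_distrib)
  qed measurable
  show ?thesis
    using 1 char_std_normal_distribution[THEN fun_cong, of "norm u"]
    by (simp add: char_def std_gauss_real cis_conv_exp)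
qed

section \<open>Uniqueness of laws from continuous test functions, characteristic functions and
  exponential moments\<close>

lemma measure_eqI_bounded_continuous:
  fixes \<mu> \<nu> :: "'v::metric_space measure"
  assumes "finite_measure \<mu>" "finite_measure \<nu>"
    and sets: "sets \<mu> = sets borel" "sets \<nu> = sets borel"
    and eq: "\<And>f :: 'v \<Rightarrow> real. continuous_on UNIV f \<Longrightarrow> (\<And>x. 0 \<le> f x) \<Longrightarrow> (\<And>x. f x \<le> 1)
      \<Longrightarrow> (\<integral>x. f x \<partial>\<mu>) = (\<integral>x. f x \<partial>\<nu>)"
  shows "\<mu> = \<nu>"
proof -
  interpret \<mu>: finite_measure \<mu> by fact
  interpret \<nu>: finite_measure \<nu> by fact
  note [measurable_cong] = sets
  have closed: "measure \<mu> F = measure \<nu> F" if F: "closed F" for F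
  \<comment> \<open>By convention \<open>infdist\<close> to the empty set is 0, so the approximation
    below would converge to 1 instead of the indicator.\<close>
  proof (cases "F = {}")
    case False
    \<comment> \<open>These functions decrease to the indicator of the closed set; closed sets are
      an intersection-stable generator of the Borel sets.\<close>
    define f where "f j x = max 0 (1 - real j * infdist x F)" for j x
    have cont: "continuous_on UNIV (f j)" for j
      unfolding f_def by (intro continuous_intros)
    have [measurable]: "f j \<in> borel_measurable borel" for j
      using cont by (rule borel_measurable_continuous_onI)
    have [measurable]: "F \<in> sets borel"
      using F by (rule borel_closed)
    have bd: "0 \<le> f j x" "f j x \<le> 1" for j x
      by (auto simp: f_def infdist_nonneg)
    have lim: "(\<lambda>j. f j x) \<longlonglongrightarrow> indicator F x" for x
    proof (cases "x \<in> F")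
      case True
      then show ?thesis by (simp add: f_def)
    next
      case False
      then have "infdist x F > 0"
        using F \<open>F \<noteq> {}\<close> by (metis in_closed_iff_infdist_zero infdist_nonneg order_less_le)
      then obtain N :: nat where N: "1 < real N * infdist x F"
        by (meson reals_Archimedean3)
      have "f j x = 0" if "j \<ge> N" for j
      proof -
        have "real N * infdist x F \<le> real j * infdist x F"
          using that by (intro mult_right_mono) (auto simp: infdist_nonneg)
        then show ?thesis using N by (simp add: f_def)
      qed
      then have "eventually (\<lambda>j. f j x = indicator F x) sequentially"
        using False by (auto simp: eventually_sequentially)
      then show ?thesis
        by (rule tendsto_eventually)
    qed
    have "(\<lambda>j. \<integral>x. f j x \<partial>\<rho>) \<longlonglongrightarrow> measure \<rho> F"
      if \<rho>: "finite_measure \<rho>" "sets \<rho> = sets borel" for \<rho>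
    proof -
      interpret \<rho>: finite_measure \<rho> by fact
      note [measurable_cong] = \<rho>(2)
      have "(\<lambda>j. \<integral>x. f j x \<partial>\<rho>) \<longlonglongrightarrow> (\<integral>x. indicator F x \<partial>\<rho>)"
        by (rule integral_dominated_convergence[where w = "\<lambda>_. 1"]) (use lim bd in auto)
      then show ?thesis
        using \<rho>.emeasure_eq_measure sets_eq_imp_space_eq[OF \<rho>(2)] by simp
    qed
    from this[OF \<open>finite_measure \<mu>\<close> sets(1)] this[OF \<open>finite_measure \<nu>\<close> sets(2)]
    show ?thesis
      using eq[OF cont bd] by (simp add: LIMSEQ_unique)
  qed simp
  show ?thesis
  proof (rule measure_eqI_generator_eq[where E = "Collect closed" and \<Omega> = UNIV and A = "\<lambda>_. UNIV"])
    show "Int_stable (Collect closed)"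
      by (auto simp: Int_stable_def)
    show "emeasure \<mu> F = emeasure \<nu> F" if "F \<in> Collect closed" for F
      using closed[of F] that by (simp add: \<mu>.emeasure_eq_measure \<nu>.emeasure_eq_measure)
    show "sets \<mu> = sigma_sets UNIV (Collect closed)" "sets \<nu> = sigma_sets UNIV (Collect closed)"
      by (simp_all add: sets borel_eq_closed)
  qed auto
qed

text \<open>Writing the Gaussian average around \<open>x\<close> as a Lebesgue integral in
  \<open>y\<close> exposes a kernel in \<open>y - x\<close>, so that the average over
  \<open>x\<close> can be taken first when the two integrations are swapped.\<close>

lemma std_gauss_affine:
  fixes x :: "'v::euclidean_space"
  assumes [measurable]: "h \<in> borel_measurable borel" and \<delta>: "\<delta> \<noteq> 0"
  shows "(\<integral>\<^sup>+z. h (x + \<delta> *\<^sub>R z) \<partial>std_gauss)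
    = (\<integral>\<^sup>+y. ennreal ((1 / sqrt (2 * pi)) ^ DIM('v) / \<bar>\<delta>\<bar> ^ DIM('v)
         * exp (- (norm ((y - x) /\<^sub>R \<delta>))\<^sup>2 / 2)) * h y \<partial>lborel)"
proof -
  define c where "c = (1 / sqrt (2 * pi)) ^ DIM('v)"
  define d where "d = \<bar>\<delta>\<bar> ^ DIM('v)"
  have cd: "c \<ge> 0" "d > 0"
    using \<delta> by (simp_all add: c_def d_def)
  let ?k = "\<lambda>y. ennreal (c / d * exp (- (norm ((y - x) /\<^sub>R \<delta>))\<^sup>2 / 2)) * h y"
  have "(\<integral>\<^sup>+y. ?k y \<partial>lborel)
      = (\<integral>\<^sup>+y. ?k y \<partial>density (distr lborel borel (\<lambda>z. x + \<delta> *\<^sub>R z)) (\<lambda>_. ennreal d))"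
    using lborel_affine[OF \<delta>, of x] by (simp add: d_def)
  also have "\<dots> = (\<integral>\<^sup>+y. ennreal d * ?k y \<partial>distr lborel borel (\<lambda>z. x + \<delta> *\<^sub>R z))"
    by (rule nn_integral_density) measurable
  also have "\<dots> = (\<integral>\<^sup>+z. ennreal d * ?k (x + \<delta> *\<^sub>R z) \<partial>lborel)"
    by (rule nn_integral_distr) measurable
  also have "\<dots> = (\<integral>\<^sup>+z. ennreal (c * exp (- (norm z)\<^sup>2 / 2)) * h (x + \<delta> *\<^sub>R z) \<partial>lborel)"
  proof (rule nn_integral_cong)
    fix z
    have "(x + \<delta> *\<^sub>R z - x) /\<^sub>R \<delta> = z"
      using \<delta> by simp
    then show "ennreal d * ?k (x + \<delta> *\<^sub>R z)
        = ennreal (c * exp (- (norm z)\<^sup>2 / 2)) * h (x + \<delta> *\<^sub>R z)"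
      using cd by (simp only: ennreal_mult'[symmetric] mult.assoc[symmetric]) simp
  qed
  also have "\<dots> = (\<integral>\<^sup>+z. h (x + \<delta> *\<^sub>R z) \<partial>std_gauss)"
    unfolding std_gauss_def std_gauss_density_conv_norm c_def[symmetric]
    by (subst nn_integral_density) auto
  finally show ?thesis
    by (simp add: c_def d_def)
qed

text \<open>Gaussian smoothing: a probability measure convolved with a small Gaussian is a Gaussian
  average of its characteristic function.\<close>

theorem measure_eqI_char:
  fixes \<mu> \<nu> :: "'v::euclidean_space measure"
  assumes "prob_space \<mu>" "prob_space \<nu>"
    and sets: "sets \<mu> = sets borel" "sets \<nu> = sets borel"
    and char: "\<And>u. (\<integral>x. cis (u \<bullet> x) \<partial>\<mu>) = (\<integral>x. cis (u \<bullet> x) \<partial>\<nu>)"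
  shows "\<mu> = \<nu>"
proof -
  interpret \<mu>: prob_space \<mu> by fact
  interpret \<nu>: prob_space \<nu> by fact
  note [measurable_cong] = sets
  have kernel: "complex_of_real (\<integral>x. exp (- (norm ((y - x) /\<^sub>R \<delta>))\<^sup>2 / 2) \<partial>\<rho>)
      = (\<integral>w. cis (w \<bullet> y / \<delta>) * (\<integral>x. cis ((- w /\<^sub>R \<delta>) \<bullet> x) \<partial>\<rho>) \<partial>std_gauss)"
    if \<rho>: "prob_space \<rho>" "sets \<rho> = sets borel" for \<rho> :: "'v measure" and y \<delta>
  proof -
    interpret \<rho>: prob_space \<rho> by fact
    note [measurable_cong] = \<rho>(2)
    interpret P: pair_prob_space std_gauss \<rho> ..
    let ?h = "\<lambda>w x. cis (w \<bullet> ((y - x) /\<^sub>R \<delta>))"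
    have int: "integrable (std_gauss \<Otimes>\<^sub>M \<rho>) (case_prod ?h)"
      by (rule P.integrable_const_bound[where B = 1]) (auto simp: case_prod_unfold)
    have "complex_of_real (\<integral>x. exp (- (norm ((y - x) /\<^sub>R \<delta>))\<^sup>2 / 2) \<partial>\<rho>)
        = (\<integral>x. \<integral>w. ?h w x \<partial>std_gauss \<partial>\<rho>)"
    proof -
      have "(\<integral>w. cis (w \<bullet> v) \<partial>std_gauss) = of_real (exp (- (norm v)\<^sup>2 / 2))" for v :: 'v
        using std_gauss_char[of v] by (simp add: inner_commute)
      then show ?thesis
        by (simp only: integral_complex_of_real)
    qed
    also have "\<dots> = (\<integral>w. \<integral>x. ?h w x \<partial>\<rho> \<partial>std_gauss)"
      using P.Fubini_integral[OF int] by simp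
    also have "\<dots> = (\<integral>w. cis (w \<bullet> y / \<delta>) * (\<integral>x. cis ((- w /\<^sub>R \<delta>) \<bullet> x) \<partial>\<rho>) \<partial>std_gauss)"
    proof (rule Bochner_Integration.integral_cong[OF refl])
      fix w
      have "?h w x = cis (w \<bullet> y / \<delta>) * cis ((- w /\<^sub>R \<delta>) \<bullet> x)" for x
        by (simp add: cis_mult inner_diff_right field_simps)
      then show "(\<integral>x. ?h w x \<partial>\<rho>) = cis (w \<bullet> y / \<delta>) * (\<integral>x. cis ((- w /\<^sub>R \<delta>) \<bullet> x) \<partial>\<rho>)"
        by simp
    qed
    finally show ?thesis .
  qed
  have kernel_eq: "(\<integral>x. exp (- (norm ((y - x) /\<^sub>R \<delta>))\<^sup>2 / 2) \<partial>\<mu>)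
      = (\<integral>x. exp (- (norm ((y - x) /\<^sub>R \<delta>))\<^sup>2 / 2) \<partial>\<nu>)" for y \<delta>
  proof -
    have "complex_of_real (\<integral>x. exp (- (norm ((y - x) /\<^sub>R \<delta>))\<^sup>2 / 2) \<partial>\<mu>)
        = complex_of_real (\<integral>x. exp (- (norm ((y - x) /\<^sub>R \<delta>))\<^sup>2 / 2) \<partial>\<nu>)"
      by (simp only: kernel[OF \<open>prob_space \<mu>\<close> sets(1)] kernel[OF \<open>prob_space \<nu>\<close> sets(2)] char)
    then show ?thesis
      by (simp only: of_real_eq_iff)
  qed
  show ?thesis
  proof (rule measure_eqI_bounded_continuous[OF \<mu>.finite_measure_axioms \<nu>.finite_measure_axioms sets])
    fix f :: "'v \<Rightarrow> real"
    assume cont: "continuous_on UNIV f" and f: "\<And>x. 0 \<le> f x" "\<And>x. f x \<le> 1"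
    have [measurable]: "f \<in> borel_measurable borel"
      using cont by (rule borel_measurable_continuous_onI)
    let ?K = "\<lambda>\<delta> x y. (1 / sqrt (2 * pi)) ^ DIM('v) / \<bar>\<delta>\<bar> ^ DIM('v)
         * exp (- (norm ((y - x) /\<^sub>R \<delta>))\<^sup>2 / 2)"
    define h where "h \<delta> x = (\<integral>z. f (x + \<delta> *\<^sub>R z) \<partial>std_gauss)" for \<delta> x
    have h_meas [measurable]: "h \<delta> \<in> borel_measurable borel" for \<delta>
      unfolding h_def by measurable
    have h_nn: "ennreal (h \<delta> x) = (\<integral>\<^sup>+z. ennreal (f (x + \<delta> *\<^sub>R z)) \<partial>std_gauss)" for \<delta> x
      unfolding h_def using f
      by (intro nn_integral_eq_integral[symmetric] std_gauss.integrable_const_bound[where B = 1]) auto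
    have h01: "0 \<le> h \<delta> x" "h \<delta> x \<le> 1" for \<delta> x
      unfolding h_def using f
      by (auto intro!: Bochner_Integration.integral_nonneg std_gauss.integral_le_const
          std_gauss.integrable_const_bound[where B = 1])
    \<comment> \<open>The measure enters the right-hand side only through its integral against the
      Gaussian kernel, which is determined by the characteristic function. Nonnegative integrals
      allow the swap with Lebesgue measure by sigma-finiteness alone.\<close>
    have nn: "(\<integral>\<^sup>+x. ennreal (h \<delta> x) \<partial>\<rho>)
        = (\<integral>\<^sup>+y. ennreal ((1 / sqrt (2 * pi)) ^ DIM('v) / \<bar>\<delta>\<bar> ^ DIM('v)
            * (\<integral>x. exp (- (norm ((y - x) /\<^sub>R \<delta>))\<^sup>2 / 2) \<partial>\<rho>)) * ennreal (f y) \<partial>lborel)"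
      if \<rho>: "prob_space \<rho>" "sets \<rho> = sets borel" and \<delta>: "\<delta> \<noteq> 0" for \<rho> :: "'v measure" and \<delta>
    proof -
      interpret \<rho>: prob_space \<rho> by fact
      note [measurable_cong] = \<rho>(2)
      interpret P: pair_sigma_finite \<rho> "lborel :: 'v measure" ..
      have "(\<integral>\<^sup>+x. ennreal (h \<delta> x) \<partial>\<rho>)
          = (\<integral>\<^sup>+x. \<integral>\<^sup>+y. ennreal (?K \<delta> x y) * ennreal (f y) \<partial>lborel \<partial>\<rho>)"
        unfolding h_nn
        by (intro nn_integral_cong std_gauss_affine[where h = "\<lambda>y. ennreal (f y)", OF _ \<delta>]) measurable
      also have "\<dots> = (\<integral>\<^sup>+y. \<integral>\<^sup>+x. ennreal (?K \<delta> x y) * ennreal (f y) \<partial>\<rho> \<partial>lborel)"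
        by (rule P.Fubini'[symmetric]) measurable
      also have "\<dots> = (\<integral>\<^sup>+y. (\<integral>\<^sup>+x. ennreal (?K \<delta> x y) \<partial>\<rho>) * ennreal (f y) \<partial>lborel)"
        by (intro nn_integral_cong nn_integral_multc) measurable
      also have "(\<lambda>y. \<integral>\<^sup>+x. ennreal (?K \<delta> x y) \<partial>\<rho>) = (\<lambda>y. ennreal (\<integral>x. ?K \<delta> x y \<partial>\<rho>))"
        by (intro ext nn_integral_eq_integral \<rho>.integrable_const_bound
            [where B = "(1 / sqrt (2 * pi)) ^ DIM('v) / \<bar>\<delta>\<bar> ^ DIM('v)"])
           (auto intro!: AE_I2 divide_right_mono mult_left_le)
      finally show ?thesis
        by simp
    qed
    have h_eq: "(\<integral>x. h \<delta> x \<partial>\<mu>) = (\<integral>x. h \<delta> x \<partial>\<nu>)" if \<delta>: "\<delta> \<noteq> 0" for \<delta>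
    proof -
      have "(\<integral>\<^sup>+x. ennreal (h \<delta> x) \<partial>\<mu>) = (\<integral>\<^sup>+x. ennreal (h \<delta> x) \<partial>\<nu>)"
        unfolding nn[OF \<open>prob_space \<mu>\<close> sets(1) \<delta>] nn[OF \<open>prob_space \<nu>\<close> sets(2) \<delta>] kernel_eq ..
      then show ?thesis
        by (subst (1 2) integral_eq_nn_integral) (auto simp: h01)
    qed
    have h_lim: "(\<lambda>j. h (inverse (Suc j)) x) \<longlonglongrightarrow> f x" for x
    proof -
      have "(\<lambda>j. h (inverse (Suc j)) x) \<longlonglongrightarrow> (\<integral>z. f (x + 0 *\<^sub>R z) \<partial>std_gauss)"
        unfolding h_def
      proof (rule integral_dominated_convergence[where w = "\<lambda>_. 1"])
        show "AE z in std_gauss. (\<lambda>j. f (x + inverse (Suc j) *\<^sub>R z)) \<longlonglongrightarrow> f (x + 0 *\<^sub>R z)"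
        proof (rule AE_I2)
          fix z :: 'v
          have "isCont f (x + 0 *\<^sub>R z)"
            using cont by (simp add: continuous_on_eq_continuous_at)
          then show "(\<lambda>j. f (x + inverse (Suc j) *\<^sub>R z)) \<longlonglongrightarrow> f (x + 0 *\<^sub>R z)"
            by (rule isCont_tendsto_compose)
               (intro tendsto_intros LIMSEQ_inverse_real_of_nat)
        qed
      qed (use f in auto)
      then show ?thesis
        by (simp add: std_gauss.prob_space[unfolded space_std_gauss])
    qed
    have conv: "(\<lambda>j. \<integral>x. h (inverse (Suc j)) x \<partial>\<rho>) \<longlonglongrightarrow> (\<integral>x. f x \<partial>\<rho>)"
      if \<rho>: "prob_space \<rho>" "sets \<rho> = sets borel" for \<rho> :: "'v measure"
    proof -
      interpret \<rho>: prob_space \<rho> by fact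
      note [measurable_cong] = \<rho>(2)
      show ?thesis
        by (rule integral_dominated_convergence[where w = "\<lambda>_. 1"]) (use h_lim h01 in auto)
    qed
    have "inverse (real (Suc j)) \<noteq> 0" for j
      by simp
    from conv[OF \<open>prob_space \<mu>\<close> sets(1)] conv[OF \<open>prob_space \<nu>\<close> sets(2)]
    show "(\<integral>x. f x \<partial>\<mu>) = (\<integral>x. f x \<partial>\<nu>)"
      unfolding h_eq[OF \<open>inverse (real (Suc _)) \<noteq> 0\<close>] by (rule LIMSEQ_unique)
  qed
qed

text \<open>Gaussian laws are handled through their exponential moments: this criterion identifies a
  translate of a Gaussian law with its exponential tilt, and the end law of the transport with that
  of Z_(n-1) + X.\<close>

lemma measure_eqI_mgf:
  fixes \<mu> \<nu> :: "'v::euclidean_space measure"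
  assumes "prob_space \<mu>" "prob_space \<nu>"
    and sets: "sets \<mu> = sets borel" "sets \<nu> = sets borel"
    and int: "\<And>b. integrable \<mu> (\<lambda>z. exp (b \<bullet> z))" "\<And>b. integrable \<nu> (\<lambda>z. exp (b \<bullet> z))"
    and eq: "\<And>b. (\<integral>z. exp (b \<bullet> z) \<partial>\<mu>) = (\<integral>z. exp (b \<bullet> z) \<partial>\<nu>)"
  shows "\<mu> = \<nu>"
proof (rule measure_eqI_char[OF assms(1,2) sets])
  fix u
  note [measurable_cong] = sets
  have "(\<integral>z. cis (1 * (u \<bullet> z)) \<partial>\<mu>) = (\<integral>z. cis (1 * (u \<bullet> z)) \<partial>\<nu>)"
  proof (rule cis_integral_eq_if_mgf_eq)
    fix s :: real
    show "integrable \<mu> (\<lambda>z. exp (s * (u \<bullet> z)))" "integrable \<nu> (\<lambda>z. exp (s * (u \<bullet> z)))"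
      "(\<integral>z. exp (s * (u \<bullet> z)) \<partial>\<mu>) = (\<integral>z. exp (s * (u \<bullet> z)) \<partial>\<nu>)"
      using int[of "s *\<^sub>R u"] eq[of "s *\<^sub>R u"] by simp_all
  qed measurable
  then show "(\<integral>z. cis (u \<bullet> z) \<partial>\<mu>) = (\<integral>z. cis (u \<bullet> z) \<partial>\<nu>)"
    by simp
qed

section \<open>Flows of bounded Lipschitz fields\<close>

text \<open>Picard iteration is a contraction in the supremum distance: since
  \<open>L * R < 1\<close>, a single fixed point covers all of \<open>{0..R}\<close> and no local
  solutions have to be glued.\<close>

lemma ode_solution_exists:
  fixes f :: "real \<Rightarrow> 'v::euclidean_space \<Rightarrow> 'v"
  assumes R: "0 \<le> R"
    and cont: "\<And>y. continuous_on {0..R} y \<Longrightarrow> continuous_on {0..R} (\<lambda>\<rho>. f \<rho> (y \<rho>))"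
    and lip: "\<And>\<rho> u v. \<rho> \<in> {0..R} \<Longrightarrow> norm (f \<rho> u - f \<rho> v) \<le> L * norm (u - v)"
    and L: "0 \<le> L" "L * R < 1"
  shows "\<exists>y. continuous_on {0..R} y \<and> (\<forall>r\<in>{0..R}. y r = x + integral {0..r} (\<lambda>\<rho>. f \<rho> (y \<rho>)))"
proof -
  \<comment> \<open>Bounded continuous functions form a type only over the whole line;
    \<open>clamp\<close> extends paths constantly outside \<open>{0..R}\<close>.\<close>
  define clamp where "clamp r = max 0 (min R r)" for r
  have clamp: "clamp r \<in> {0..R}" for r
    using R by (auto simp: clamp_def)
  have clamp_id: "clamp r = r" if "r \<in> {0..R}" for r
    using that by (auto simp: clamp_def)
  have cont_clamp: "continuous_on UNIV clamp"
    unfolding clamp_def by (intro continuous_intros)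
  define I where "I y r = x + integral {0..r} (\<lambda>\<rho>. f \<rho> (y \<rho>))" for y r
  have cont_f: "continuous_on {0..R} (\<lambda>\<rho>. f \<rho> (apply_bcontfun y \<rho>))" for y
    by (rule cont) simp
  have cont_I: "continuous_on {0..R} (I (apply_bcontfun y))" for y
    unfolding I_def
    by (intro continuous_intros indefinite_integral_continuous_1 integrable_continuous_real cont_f)
  have mem: "(\<lambda>r. I (apply_bcontfun y) (clamp r)) \<in> bcontfun" for y
  proof -
    have "continuous_on UNIV (\<lambda>r. I (apply_bcontfun y) (clamp r))"
      by (rule continuous_on_compose2[OF cont_I cont_clamp]) (use clamp in auto)
    moreover have "bounded (range (\<lambda>r. I (apply_bcontfun y) (clamp r)))"
    proof (rule bounded_subset)
      show "bounded (I (apply_bcontfun y) ` {0..R})"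
        by (intro compact_imp_bounded compact_continuous_image cont_I) simp
    qed (use clamp in auto)
    ultimately show ?thesis
      by (simp add: bcontfun_def)
  qed
  define G where "G y = Bcontfun (\<lambda>r. I (apply_bcontfun y) (clamp r))" for y
  have G: "apply_bcontfun (G y) r = I (apply_bcontfun y) (clamp r)" for y r
    unfolding G_def by (simp add: Bcontfun_inverse[OF mem])
  have "\<exists>!y. G y = y"
  proof (rule banach_fix_type)
    show "0 \<le> L * R" "L * R < 1"
      using R L by simp_all
    show "\<forall>y z. dist (G y) (G z) \<le> L * R * dist y z"
    proof (intro allI dist_bound)
      fix y z r
      let ?h = "\<lambda>\<rho>. f \<rho> (apply_bcontfun y \<rho>) - f \<rho> (apply_bcontfun z \<rho>)"
      have sub: "{0..clamp r} \<subseteq> {0..R}"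
        using clamp[of r] by auto
      have int: "(\<lambda>\<rho>. f \<rho> (apply_bcontfun w \<rho>)) integrable_on {0..clamp r}" for w
        by (intro integrable_continuous_real continuous_on_subset[OF cont_f sub])
      have "dist (apply_bcontfun (G y) r) (apply_bcontfun (G z) r) = norm (integral {0..clamp r} ?h)"
        by (simp add: G I_def dist_norm Henstock_Kurzweil_Integration.integral_diff int)
      also have "\<dots> \<le> (L * dist y z) * (clamp r - 0)"
      proof (rule integral_bound)
        show "continuous_on {0..clamp r} ?h"
          by (intro continuous_intros continuous_on_subset[OF cont_f sub])
        show "norm (?h \<rho>) \<le> L * dist y z" if "\<rho> \<in> {0..clamp r}" for \<rho>
        proof -
          have "norm (?h \<rho>) \<le> L * norm (apply_bcontfun y \<rho> - apply_bcontfun z \<rho>)"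
            using that sub by (intro lip) auto
          also have "\<dots> \<le> L * dist y z"
            using dist_bounded[of y \<rho> z] L by (intro mult_left_mono) (auto simp: dist_norm)
          finally show ?thesis .
        qed
      qed (use clamp in simp)
      also have "\<dots> \<le> (L * dist y z) * R"
        using clamp[of r] L by (intro mult_left_mono) auto
      finally show "dist (apply_bcontfun (G y) r) (apply_bcontfun (G z) r) \<le> L * R * dist y z"
        by (simp add: algebra_simps)
    qed
  qed
  then obtain y where y: "G y = y"
    by blast
  have "apply_bcontfun y r = x + integral {0..r} (\<lambda>\<rho>. f \<rho> (apply_bcontfun y \<rho>))" if "r \<in> {0..R}" for r
    using G[of y r] y clamp_id[OF that] by (simp add: I_def)
  then show ?thesis
    by (intro exI[of _ "apply_bcontfun y"]) auto
qed

text \<open>Unlike plain Lipschitz functions, these test functions see the difference between a velocity and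
  its conditional expectation only to second order in the time step.\<close>

definition quadratic_test :: "real \<Rightarrow> ('v::real_inner \<Rightarrow> real) \<Rightarrow> ('v \<Rightarrow> 'v) \<Rightarrow> bool" where
  "quadratic_test A \<phi> g \<longleftrightarrow>
     (\<forall>x. norm (g x) \<le> A) \<and> (\<forall>x z. \<bar>\<phi> (x + z) - \<phi> x - g x \<bullet> z\<bar> \<le> A * (norm z)\<^sup>2)"

text \<open>Measurability of \<open>g\<close> is not part of \<open>quadratic_test\<close>; it
  follows from this representation as a limit of difference quotients of the continuous function
  \<phi>.\<close>

lemma quadratic_test_gradient_LIMSEQ:
  fixes \<phi> :: "'v::euclidean_space \<Rightarrow> real"
  assumes \<phi>: "quadratic_test A \<phi> g"
  shows "(\<lambda>n. (\<phi> (x + inverse (Suc n) *\<^sub>R b) - \<phi> x) * Suc n) \<longlonglongrightarrow> g x \<bullet> b"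
proof (rule LIMSEQ_offset[where k = 0], rule tendsto_norm_zero_cancel[THEN LIM_zero_cancel])
  have "(\<lambda>n. A * (norm b)\<^sup>2 * inverse (real (Suc n))) \<longlonglongrightarrow> A * (norm b)\<^sup>2 * 0"
    by (intro tendsto_intros LIMSEQ_inverse_real_of_nat)
  then have lim: "(\<lambda>n. A * (norm b)\<^sup>2 * inverse (real (Suc n))) \<longlonglongrightarrow> 0"
    by simp
  show "(\<lambda>n. norm ((\<phi> (x + inverse (Suc (n + 0)) *\<^sub>R b) - \<phi> x) * Suc (n + 0) - g x \<bullet> b)) \<longlonglongrightarrow> 0"
  proof (rule tendsto_sandwich[OF _ _ tendsto_const lim]; intro always_eventually allI)
    fix n
    define t where "t = inverse (real (Suc n))"
    have t: "t > 0" "real (Suc n) = inverse t"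
      by (simp_all add: t_def)
    have "\<bar>\<phi> (x + t *\<^sub>R b) - \<phi> x - g x \<bullet> (t *\<^sub>R b)\<bar> \<le> A * (norm (t *\<^sub>R b))\<^sup>2"
      using \<phi> by (simp only: quadratic_test_def)
    then have "\<bar>\<phi> (x + t *\<^sub>R b) - \<phi> x - g x \<bullet> (t *\<^sub>R b)\<bar> * inverse t \<le> A * (norm (t *\<^sub>R b))\<^sup>2 * inverse t"
      using t(1) by (intro mult_right_mono) auto
    also have "\<dots> = A * (norm b)\<^sup>2 * t"
      using t(1) by (simp add: power2_eq_square)
    also have "\<bar>\<phi> (x + t *\<^sub>R b) - \<phi> x - g x \<bullet> (t *\<^sub>R b)\<bar> * inverse t
        = \<bar>(\<phi> (x + t *\<^sub>R b) - \<phi> x) * inverse t - g x \<bullet> b\<bar>"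
    proof -
      have "(\<phi> (x + t *\<^sub>R b) - \<phi> x - g x \<bullet> (t *\<^sub>R b)) * inverse t
          = (\<phi> (x + t *\<^sub>R b) - \<phi> x) * inverse t - g x \<bullet> b"
        using t(1) by (simp add: left_diff_distrib)
      then show ?thesis
        using t(1) by (metis abs_mult_pos inverse_nonnegative_iff_nonnegative less_imp_le)
    qed
    finally show "norm ((\<phi> (x + inverse (Suc (n + 0)) *\<^sub>R b) - \<phi> x) * Suc (n + 0) - g x \<bullet> b)
        \<le> A * (norm b)\<^sup>2 * inverse (real (Suc n))"
      unfolding add_0_right real_norm_def t(2) inverse_inverse_eq .
  qed simp
qed

lemma has_derivative_if_quadratic_error:
  fixes f :: "'v::euclidean_space \<Rightarrow> 'w::real_normed_vector"
  assumes D: "linear D" and error: "\<And>z. norm (f (x + z) - f x - D z) \<le> A * (norm z)\<^sup>2"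
  shows "(f has_derivative D) (at x)"
  unfolding has_derivative_at
proof (intro conjI)
  show "bounded_linear D"
    using D by (simp add: linear_conv_bounded_linear)
  have "((\<lambda>z::'v. A * norm z) \<longlongrightarrow> A * norm (0::'v)) (at 0)"
    by (intro tendsto_intros)
  then have lim: "((\<lambda>z::'v. A * norm z) \<longlongrightarrow> 0) (at 0)"
    by simp
  show "((\<lambda>z. norm (f (x + z) - f x - D z) / norm z) \<longlongrightarrow> 0) (at 0)"
  proof (rule tendsto_sandwich[OF _ _ tendsto_const lim]; intro always_eventually allI)
    fix z
    show "norm (f (x + z) - f x - D z) / norm z \<le> A * norm z"
      using error[of z] by (cases "z = 0") (simp_all add: divide_le_eq power2_eq_square mult.assoc)
  qed simp
qed

lemma quadratic_test_continuous:
  fixes \<phi> :: "'v::euclidean_space \<Rightarrow> real"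
  assumes \<phi>: "quadratic_test A \<phi> g"
  shows "continuous_on UNIV \<phi>"
proof -
  have "(\<phi> has_derivative (\<lambda>z. g x \<bullet> z)) (at x)" for x
  proof (rule has_derivative_if_quadratic_error)
    show "linear (\<lambda>z. g x \<bullet> z)"
      by (intro linearI) (simp_all add: inner_add_right)
    show "norm (\<phi> (x + z) - \<phi> x - g x \<bullet> z) \<le> A * (norm z)\<^sup>2" for z
      using \<phi> by (simp add: quadratic_test_def)
  qed
  then show ?thesis
    by (meson continuous_at_imp_continuous_on has_derivative_continuous)
qed

lemma quadratic_test_measurable:
  fixes \<phi> :: "'v::euclidean_space \<Rightarrow> real"
  assumes \<phi>: "quadratic_test A \<phi> g"
  shows "\<phi> \<in> borel_measurable borel" "g \<in> borel_measurable borel"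
proof -
  show [measurable]: "\<phi> \<in> borel_measurable borel"
    using quadratic_test_continuous[OF \<phi>] by (rule borel_measurable_continuous_onI)
  have "(\<lambda>x. g x \<bullet> b) \<in> borel_measurable borel" for b
    by (rule borel_measurable_LIMSEQ_real[OF quadratic_test_gradient_LIMSEQ[OF \<phi>]]) measurable
  then show "g \<in> borel_measurable borel"
    by (subst borel_measurable_euclidean_space) auto
qed

text \<open>Real and imaginary part of the second-order expansion of \<open>cis\<close>. Equal
  expectations of these functions mean equal characteristic functions. \<open>norm u\<close> bounds
  the gradient and \<open>(norm u)\<^sup>2\<close> the remainder; the sum serves for both.\<close>

lemma quadratic_test_trig:
  fixes u :: "'v::euclidean_space"
  shows "quadratic_test (norm u + (norm u)\<^sup>2) (\<lambda>x. cos (u \<bullet> x)) (\<lambda>x. - sin (u \<bullet> x) *\<^sub>R u)"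
    and "quadratic_test (norm u + (norm u)\<^sup>2) (\<lambda>x. sin (u \<bullet> x)) (\<lambda>x. cos (u \<bullet> x) *\<^sub>R u)"
proof -
  have approx: "cmod (cis (s + t) - cis s - cis s * (\<i> * t)) \<le> t\<^sup>2" for s t :: real
  proof -
    have "cis (s + t) - cis s - cis s * (\<i> * t) = cis s * (iexp t - (1 + \<i> * t))"
      by (simp add: cis_mult[symmetric] cis_conv_exp[of t] algebra_simps)
    then have "cmod (cis (s + t) - cis s - cis s * (\<i> * t)) = cmod (iexp t - (1 + \<i> * t))"
      by (simp add: norm_mult)
    also have "\<dots> \<le> t\<^sup>2 / 2"
      using iexp_approx1[of t 1] by (simp add: power2_eq_square)
    also have "\<dots> \<le> t\<^sup>2"
      by simp
    finally show ?thesis .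
  qed
  have bound: "(u \<bullet> z)\<^sup>2 \<le> (norm u + (norm u)\<^sup>2) * (norm z)\<^sup>2" for z
  proof -
    have "(u \<bullet> z)\<^sup>2 \<le> (norm u * norm z)\<^sup>2"
      using Cauchy_Schwarz_ineq2[of u z] by (rule abs_le_square_iff[THEN iffD1, OF order.trans]) auto
    also have "\<dots> \<le> (norm u + (norm u)\<^sup>2) * (norm z)\<^sup>2"
      by (simp add: power_mult_distrib mult_right_mono)
    finally show ?thesis .
  qed
  show "quadratic_test (norm u + (norm u)\<^sup>2) (\<lambda>x. cos (u \<bullet> x)) (\<lambda>x. - sin (u \<bullet> x) *\<^sub>R u)"
    unfolding quadratic_test_def
  proof (intro conjI allI)
    fix x z
    show "norm (- sin (u \<bullet> x) *\<^sub>R u) \<le> norm u + (norm u)\<^sup>2"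
      using abs_sin_le_one[of "u \<bullet> x"] by (auto intro!: add_increasing2 mult_left_le_one_le)
    have "\<bar>Re (cis (u \<bullet> x + u \<bullet> z) - cis (u \<bullet> x) - cis (u \<bullet> x) * (\<i> * (u \<bullet> z)))\<bar> \<le> (u \<bullet> z)\<^sup>2"
      by (rule order.trans[OF abs_Re_le_cmod approx])
    then show "\<bar>cos (u \<bullet> (x + z)) - cos (u \<bullet> x) - (- sin (u \<bullet> x) *\<^sub>R u) \<bullet> z\<bar>
        \<le> (norm u + (norm u)\<^sup>2) * (norm z)\<^sup>2"
      by (intro order.trans[OF _ bound]) (simp add: inner_add_right)
  qed
  show "quadratic_test (norm u + (norm u)\<^sup>2) (\<lambda>x. sin (u \<bullet> x)) (\<lambda>x. cos (u \<bullet> x) *\<^sub>R u)"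
    unfolding quadratic_test_def
  proof (intro conjI allI)
    fix x z
    show "norm (cos (u \<bullet> x) *\<^sub>R u) \<le> norm u + (norm u)\<^sup>2"
      using abs_cos_le_one[of "u \<bullet> x"] by (auto intro!: add_increasing2 mult_left_le_one_le)
    have "\<bar>Im (cis (u \<bullet> x + u \<bullet> z) - cis (u \<bullet> x) - cis (u \<bullet> x) * (\<i> * (u \<bullet> z)))\<bar> \<le> (u \<bullet> z)\<^sup>2"
      by (rule order.trans[OF abs_Im_le_cmod approx])
    then show "\<bar>sin (u \<bullet> (x + z)) - sin (u \<bullet> x) - (cos (u \<bullet> x) *\<^sub>R u) \<bullet> z\<bar>
        \<le> (norm u + (norm u)\<^sup>2) * (norm z)\<^sup>2"
      by (intro order.trans[OF _ bound]) (simp add: inner_add_right)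
  qed
qed

text \<open>The condition \<open>quadratic\<close> is differentiability in space with a uniform
  second-order remainder; it keeps the class of quadratic test functions stable under an Euler step.
  The factor \<open>1 + norm u\<close> in \<open>time_lipschitz\<close> admits a time derivative of
  linear growth in space, which is what the tilting of a Gaussian weight leads to.\<close>

locale bounded_flow =
  fixes m :: "real \<Rightarrow> 'v::euclidean_space \<Rightarrow> 'v" and R \<beta> L C H :: real
  assumes R: "0 \<le> R" and \<beta>: "0 \<le> \<beta>" and L: "0 \<le> L" "L * R < 1" and C: "0 \<le> C" and H: "0 \<le> H"
    and bounded: "\<And>r u. r \<in> {0..R} \<Longrightarrow> norm (m r u) \<le> \<beta>"
    and lipschitz: "\<And>r u v. r \<in> {0..R} \<Longrightarrow> norm (m r u - m r v) \<le> L * norm (u - v)"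
    and time_lipschitz:
      "\<And>r s u. r \<in> {0..R} \<Longrightarrow> s \<in> {0..R} \<Longrightarrow> norm (m s u - m r u) \<le> C * (1 + norm u) * \<bar>s - r\<bar>"
    and quadratic: "\<And>r u. r \<in> {0..R} \<Longrightarrow> \<exists>D. linear D \<and> (\<forall>a. norm (D a) \<le> L * norm a) \<and>
      (\<forall>a. norm (m r (u + a) - m r u - D a) \<le> H * (norm a)\<^sup>2)"
begin

lemma field_measurable:
  assumes "r \<in> {0..R}" "f \<in> borel_measurable M"
  shows "(\<lambda>\<omega>. m r (f \<omega>)) \<in> borel_measurable M"
proof -
  have "L-lipschitz_on UNIV (m r)"
    using lipschitz[OF assms(1)] L by (auto simp: lipschitz_on_def dist_norm)
  then have "m r \<in> borel_measurable borel"
    by (intro borel_measurable_continuous_onI lipschitz_on_continuous_on)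
  then show ?thesis
    using assms(2) by measurable
qed

lemma field_continuous:
  assumes y: "continuous_on {0..R} y"
  shows "continuous_on {0..R} (\<lambda>\<rho>. m \<rho> (y \<rho>))"
  unfolding continuous_on_def
proof
  fix r assume r: "r \<in> {0..R}"
  have y': "(y \<longlongrightarrow> y r) (at r within {0..R})"
    using y r by (simp add: continuous_on_def)
  have "((\<lambda>\<rho>. L * norm (y \<rho> - y r) + C * (1 + norm (y r)) * \<bar>\<rho> - r\<bar>) \<longlongrightarrow>
      L * norm (y r - y r) + C * (1 + norm (y r)) * \<bar>r - r\<bar>) (at r within {0..R})"
    by (intro tendsto_intros y')
  then have lim: "((\<lambda>\<rho>. L * norm (y \<rho> - y r) + C * (1 + norm (y r)) * \<bar>\<rho> - r\<bar>) \<longlongrightarrow> 0)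
      (at r within {0..R})"
    by simp
  have "\<forall>\<^sub>F \<rho> in at r within {0..R}. norm (m \<rho> (y \<rho>) - m r (y r))
      \<le> L * norm (y \<rho> - y r) + C * (1 + norm (y r)) * \<bar>\<rho> - r\<bar>"
    unfolding eventually_at_filter
  proof (intro always_eventually allI impI)
    fix \<rho> assume "\<rho> \<in> {0..R}"
    then show "norm (m \<rho> (y \<rho>) - m r (y r))
      \<le> L * norm (y \<rho> - y r) + C * (1 + norm (y r)) * \<bar>\<rho> - r\<bar>"
      using norm_triangle_ineq[of "m \<rho> (y \<rho>) - m \<rho> (y r)" "m \<rho> (y r) - m r (y r)"]
        lipschitz[of \<rho> "y \<rho>" "y r"] time_lipschitz[OF r, of \<rho> "y r"] by simp
  qed
  then have "((\<lambda>\<rho>. m \<rho> (y \<rho>) - m r (y r)) \<longlongrightarrow> 0) (at r within {0..R})"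
    by (rule Lim_null_comparison[OF _ lim])
  then show "((\<lambda>\<rho>. m \<rho> (y \<rho>)) \<longlongrightarrow> m r (y r)) (at r within {0..R})"
    by (rule LIM_zero_cancel)
qed

text \<open>A solution is chosen separately for each starting point; regularity in \<open>x\<close>
  is recovered by \<open>flow_lipschitz\<close>, whose argument applies to any two solutions of the
  integral equation.\<close>

definition flow :: "real \<Rightarrow> 'v \<Rightarrow> 'v" where
  "flow r x = (SOME y. continuous_on {0..R} y \<and>
     (\<forall>r\<in>{0..R}. y r = x + integral {0..r} (\<lambda>\<rho>. m \<rho> (y \<rho>)))) r"

lemma flow_props:
  shows flow_continuous: "continuous_on {0..R} (\<lambda>r. flow r x)"
    and flow_eq: "r \<in> {0..R} \<Longrightarrow> flow r x = x + integral {0..r} (\<lambda>\<rho>. m \<rho> (flow \<rho> x))"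
proof -
  let ?P = "\<lambda>y. continuous_on {0..R} y \<and> (\<forall>r\<in>{0..R}. y r = x + integral {0..r} (\<lambda>\<rho>. m \<rho> (y \<rho>)))"
  have "\<exists>y. ?P y"
    by (rule ode_solution_exists[OF R field_continuous lipschitz L])
  then have 1: "?P (SOME y. ?P y)"
    by (rule someI_ex)
  have 2: "(SOME y. ?P y) = (\<lambda>r. flow r x)"
    by (simp only: flow_def)
  have *: "?P (\<lambda>r. flow r x)"
    using 1 unfolding 2 .
  from * show "continuous_on {0..R} (\<lambda>r. flow r x)"
    by (rule conjunct1)
  from * show "flow r x = x + integral {0..r} (\<lambda>\<rho>. m \<rho> (flow \<rho> x))" if "r \<in> {0..R}"
    using that by (blast dest: conjunct2 bspec)
qed

lemma flow_0: "flow 0 x = x"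
proof -
  have "0 \<in> {0..R}"
    using R by simp
  then have "flow 0 x = x + integral {0..0} (\<lambda>\<rho>. m \<rho> (flow \<rho> x))"
    by (rule flow_eq)
  also have "\<dots> = x"
    by simp
  finally show ?thesis .
qed

lemma flow_field_continuous: "continuous_on {0..R} (\<lambda>\<rho>. m \<rho> (flow \<rho> x))"
proof (rule field_continuous)
  show "continuous_on {0..R} (\<lambda>\<rho>. flow \<rho> x)"
    by (rule flow_continuous)
qed

lemma flow_increment:
  assumes "0 \<le> r" "r \<le> s" "s \<le> R"
  shows "flow s x - flow r x = integral {r..s} (\<lambda>\<rho>. m \<rho> (flow \<rho> x))"
proof -
  have "(\<lambda>\<rho>. m \<rho> (flow \<rho> x)) integrable_on {0..s}"
    by (intro integrable_continuous_real continuous_on_subset[OF flow_field_continuous]) (use assms in auto)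
  then have "integral {0..r} (\<lambda>\<rho>. m \<rho> (flow \<rho> x)) + integral {r..s} (\<lambda>\<rho>. m \<rho> (flow \<rho> x))
      = integral {0..s} (\<lambda>\<rho>. m \<rho> (flow \<rho> x))"
    using assms by (intro Henstock_Kurzweil_Integration.integral_combine) auto
  moreover have "flow r x = x + integral {0..r} (\<lambda>\<rho>. m \<rho> (flow \<rho> x))"
    "flow s x = x + integral {0..s} (\<lambda>\<rho>. m \<rho> (flow \<rho> x))"
    using assms by (auto intro!: flow_eq)
  ultimately show ?thesis
    by (metis add_diff_cancel_left add_diff_cancel_left')
qed

lemma flow_time_lipschitz:
  assumes "0 \<le> r" "r \<le> s" "s \<le> R"
  shows "norm (flow s x - flow r x) \<le> \<beta> * (s - r)"
  unfolding flow_increment[OF assms]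
proof (rule integral_bound[OF \<open>r \<le> s\<close>])
  show "continuous_on {r..s} (\<lambda>\<rho>. m \<rho> (flow \<rho> x))"
    by (rule continuous_on_subset[OF flow_field_continuous]) (use assms in auto)
qed (use assms in \<open>auto intro!: bounded\<close>)

lemma flow_norm_le:
  assumes "r \<in> {0..R}"
  shows "norm (flow r x) \<le> norm x + R * \<beta>"
proof -
  have "norm (flow r x - x) \<le> \<beta> * r"
    using flow_time_lipschitz[of 0 r x] assms by (simp add: flow_0)
  also have "\<dots> \<le> R * \<beta>"
    using assms \<beta> mult_left_mono[of r R \<beta>] by (simp add: mult.commute)
  finally show ?thesis
    using norm_triangle_sub[of "flow r x" x] by simp
qed

text \<open>Constant of the local truncation error: \<open>L * \<beta>\<close> comes from the motion
  in space during a step, \<open>C * (1 + R * \<beta>)\<close> from the explicit time dependence at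
  a point of norm at most \<open>norm x + R * \<beta>\<close>.\<close>

definition flow_error where "flow_error = L * \<beta> + C * (1 + R * \<beta>)"

lemma flow_error_nonneg: "0 \<le> flow_error"
  using L C R \<beta> by (simp add: flow_error_def)

lemma flow_taylor:
  assumes "0 \<le> r" "r \<le> s" "s \<le> R"
  shows "norm (flow s x - flow r x - (s - r) *\<^sub>R m r (flow r x)) \<le> flow_error * (1 + norm x) * (s - r)\<^sup>2"
proof -
  let ?h = "\<lambda>\<rho>. m \<rho> (flow \<rho> x) - m r (flow r x)"
  have cont: "continuous_on {r..s} (\<lambda>\<rho>. m \<rho> (flow \<rho> x))"
    by (rule continuous_on_subset[OF flow_field_continuous]) (use assms in auto)
  have "flow s x - flow r x - (s - r) *\<^sub>R m r (flow r x) = integral {r..s} ?h"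
    unfolding flow_increment[OF assms]
    using assms by (subst Henstock_Kurzweil_Integration.integral_diff)
      (auto intro!: integrable_continuous_real cont)
  also have "norm \<dots> \<le> (flow_error * (1 + norm x) * (s - r)) * (s - r)"
  proof (rule integral_bound[OF \<open>r \<le> s\<close>])
    show "continuous_on {r..s} ?h"
      by (intro continuous_intros cont)
    fix \<rho> assume \<rho>: "\<rho> \<in> {r..s}"
    have \<rho>R: "\<rho> \<in> {0..R}" and rR: "r \<in> {0..R}"
      using \<rho> assms by auto
    have "norm (?h \<rho>) \<le> L * norm (flow \<rho> x - flow r x) + C * (1 + norm (flow r x)) * \<bar>\<rho> - r\<bar>"
      using norm_triangle_ineq[of "m \<rho> (flow \<rho> x) - m \<rho> (flow r x)" "m \<rho> (flow r x) - m r (flow r x)"]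
        lipschitz[OF \<rho>R, of "flow \<rho> x" "flow r x"] time_lipschitz[OF rR \<rho>R, of "flow r x"] by simp
    also have "\<dots> \<le> L * (\<beta> * (s - r)) + C * (1 + (norm x + R * \<beta>)) * (s - r)"
    proof (intro add_mono mult_left_mono mult_mono)
      have "norm (flow \<rho> x - flow r x) \<le> \<beta> * (\<rho> - r)"
        using \<rho> assms by (intro flow_time_lipschitz) auto
      also have "\<dots> \<le> \<beta> * (s - r)"
        using \<rho> \<beta> by (intro mult_left_mono) auto
      finally show "norm (flow \<rho> x - flow r x) \<le> \<beta> * (s - r)" .
      show "norm (flow r x) \<le> norm x + R * \<beta>"
        by (rule flow_norm_le[OF rR])
    qed (use L C R \<beta> \<rho> in auto)
    also have "\<dots> \<le> flow_error * (1 + norm x) * (s - r)"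
    proof -
      have "0 \<le> (L * \<beta> * norm x + C * R * \<beta> * norm x) * (s - r)"
        using L C R \<beta> assms by (intro mult_nonneg_nonneg add_nonneg_nonneg) auto
      then show ?thesis
        by (simp add: flow_error_def algebra_simps)
    qed
    finally show "norm (?h \<rho>) \<le> flow_error * (1 + norm x) * (s - r)" .
  qed
  finally show ?thesis
    by (simp add: power2_eq_square mult.assoc)
qed

text \<open>In place of Gronwall: the largest distance \<open>d s\<close> over the interval
  satisfies \<open>d s \<le> norm (x - y) + L * R * d s\<close>, and \<open>L * R < 1\<close>
  absorbs the last term.\<close>

lemma flow_lipschitz:
  assumes r: "r \<in> {0..R}"
  shows "norm (flow r x - flow r y) \<le> 1 / (1 - L * R) * norm (x - y)"
proof -
  define d where "d r = norm (flow r x - flow r y)" for r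
  have "continuous_on {0..R} d"
    unfolding d_def by (intro continuous_intros flow_continuous)
  then obtain s where s: "s \<in> {0..R}" and max: "\<And>t. t \<in> {0..R} \<Longrightarrow> d t \<le> d s"
    using continuous_attains_sup[of "{0..R}" d] R by auto
  have sub: "{0..s} \<subseteq> {0..R}"
    using s by auto
  note cont = continuous_on_subset[OF flow_field_continuous sub]
  have "flow s x - flow s y
      = (x - y) + integral {0..s} (\<lambda>\<rho>. m \<rho> (flow \<rho> x) - m \<rho> (flow \<rho> y))"
    by (simp add: flow_eq[OF s] Henstock_Kurzweil_Integration.integral_diff integrable_continuous_real[OF cont])
  then have "d s \<le> norm (x - y) + norm (integral {0..s} (\<lambda>\<rho>. m \<rho> (flow \<rho> x) - m \<rho> (flow \<rho> y)))"
    unfolding d_def by (simp only: norm_triangle_ineq)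
  also have "norm (integral {0..s} (\<lambda>\<rho>. m \<rho> (flow \<rho> x) - m \<rho> (flow \<rho> y))) \<le> (L * d s) * (s - 0)"
  proof (rule integral_bound)
    show "continuous_on {0..s} (\<lambda>\<rho>. m \<rho> (flow \<rho> x) - m \<rho> (flow \<rho> y))"
      by (intro continuous_intros cont)
    fix \<rho> assume "\<rho> \<in> {0..s}"
    then have \<rho>: "\<rho> \<in> {0..R}"
      using sub by auto
    have "norm (m \<rho> (flow \<rho> x) - m \<rho> (flow \<rho> y)) \<le> L * d \<rho>"
      unfolding d_def by (rule lipschitz[OF \<rho>])
    also have "\<dots> \<le> L * d s"
      using max[OF \<rho>] L by (intro mult_left_mono)
    finally show "norm (m \<rho> (flow \<rho> x) - m \<rho> (flow \<rho> y)) \<le> L * d s" .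
  qed (use s in simp)
  also have "(L * d s) * (s - 0) \<le> (L * d s) * R"
    using s L by (intro mult_left_mono) (auto simp: d_def)
  finally have "(1 - L * R) * d s \<le> norm (x - y)"
    by (simp add: algebra_simps)
  then have "d s \<le> 1 / (1 - L * R) * norm (x - y)"
    using L by (simp add: field_simps)
  then show ?thesis
    using max[OF r] by (simp add: d_def)
qed

lemma flow_measurable:
  assumes "r \<in> {0..R}" "f \<in> borel_measurable M"
  shows "(\<lambda>\<omega>. flow r (f \<omega>)) \<in> borel_measurable M"
proof -
  have "(1 / (1 - L * R))-lipschitz_on UNIV (flow r)"
    using flow_lipschitz[OF assms(1)] L by (auto simp: lipschitz_on_def dist_norm)
  then have "flow r \<in> borel_measurable borel"
    by (intro borel_measurable_continuous_onI lipschitz_on_continuous_on)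
  then show ?thesis
    using assms(2) by measurable
qed

section \<open>Euler approximation of the flow\<close>

primrec euler :: "real \<Rightarrow> nat \<Rightarrow> 'v \<Rightarrow> 'v" where
  "euler h 0 x = x"
| "euler h (Suc j) x = euler h j x + h *\<^sub>R m (j * h) (euler h j x)"

lemma euler_measurable:
  assumes "0 \<le> h" "j * h \<le> R" "f \<in> borel_measurable M"
  shows "(\<lambda>\<omega>. euler h j (f \<omega>)) \<in> borel_measurable M"
  using assms(2)
proof (induction j)
  case 0
  then show ?case using assms(3) by simp
next
  case (Suc j)
  have "j * h \<in> {0..R}"
    using Suc.prems assms(1) by (auto simp: algebra_simps)
  moreover have "(\<lambda>\<omega>. euler h j (f \<omega>)) \<in> borel_measurable M"
    using Suc.IH \<open>j * h \<in> {0..R}\<close> by simp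
  ultimately show ?case
    by (auto intro!: borel_measurable_add borel_measurable_scaleR field_measurable)
qed

text \<open>Discrete Gronwall: each step adds one truncation error and multiplies the error so far
  by at most \<open>1 + h * L\<close>. Over a fixed time interval the accumulated error is of order
  \<open>h\<close>.\<close>

lemma euler_error:
  assumes h: "0 \<le> h" and "j * h \<le> R"
  shows "norm (euler h j x - flow (j * h) x) \<le> (1 + h * L) ^ j * (j * (flow_error * (1 + norm x) * h\<^sup>2))"
  using assms(2)
proof (induction j)
  case 0
  then show ?case by (simp add: flow_0)
next
  case (Suc j)
  define E where "E = flow_error * (1 + norm x) * h\<^sup>2"
  have E: "0 \<le> E"
    using flow_error_nonneg by (simp add: E_def)
  have le: "j * h \<le> Suc j * h" and j: "j * h \<in> {0..R}"
    using Suc.prems h by (auto simp: algebra_simps)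
  let ?e = "euler h j x" and ?f = "flow (j * h) x"
  have IH: "norm (?e - ?f) \<le> (1 + h * L) ^ j * (j * E)"
    using Suc.IH j by (simp add: E_def)
  have step: "norm (flow (Suc j * h) x - ?f - h *\<^sub>R m (j * h) ?f) \<le> E"
    using flow_taylor[of "j * h" "Suc j * h" x] Suc.prems j le
    by (simp add: E_def algebra_simps)
  have "euler h (Suc j) x - flow (Suc j * h) x
      = (?e - ?f) + (h *\<^sub>R (m (j * h) ?e - m (j * h) ?f) - (flow (Suc j * h) x - ?f - h *\<^sub>R m (j * h) ?f))"
    by (simp add: algebra_simps)
  then have "norm (euler h (Suc j) x - flow (Suc j * h) x)
      \<le> norm (?e - ?f) + (norm (h *\<^sub>R (m (j * h) ?e - m (j * h) ?f))
          + norm (flow (Suc j * h) x - ?f - h *\<^sub>R m (j * h) ?f))"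
    by (simp only: order.trans[OF norm_triangle_ineq add_left_mono[OF norm_triangle_ineq4]])
  also have "norm (h *\<^sub>R (m (j * h) ?e - m (j * h) ?f)) \<le> h * (L * norm (?e - ?f))"
    using lipschitz[OF j, of ?e ?f] h by (simp add: mult_left_mono)
  also have "norm (?e - ?f) + (h * (L * norm (?e - ?f)) + norm (flow (Suc j * h) x - ?f - h *\<^sub>R m (j * h) ?f))
      \<le> (1 + h * L) * norm (?e - ?f) + E"
    using step by (simp add: algebra_simps)
  also have "\<dots> \<le> (1 + h * L) * ((1 + h * L) ^ j * (j * E)) + (1 + h * L) ^ Suc j * E"
  proof (intro add_mono mult_left_mono IH)
    have "1 \<le> (1 + h * L) ^ Suc j"
      using h L by (intro one_le_power) simp
    then show "E \<le> (1 + h * L) ^ Suc j * E"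
      using mult_right_mono[of 1 "(1 + h * L) ^ Suc j" E] E by simp
  qed (use h L in simp)
  also have "\<dots> = (1 + h * L) ^ Suc j * (Suc j * E)"
    by (simp add: algebra_simps)
  finally show ?case
    by (simp add: E_def)
qed

end

lemma power_one_plus_le_exp:
  fixes c r :: real
  assumes "0 \<le> c" "0 \<le> r"
  shows "(1 + r / Suc N * c) ^ Suc N \<le> exp (r * c)"
proof -
  have "(1 + r / Suc N * c) ^ Suc N \<le> exp (r / Suc N * c) ^ Suc N"
    using assms by (intro power_mono exp_ge_add_one_self) simp
  also have "\<dots> = exp (r * c)"
    by (subst exp_of_nat_mult[symmetric]) (simp del: of_nat_Suc)
  finally show ?thesis .
qed

lemma LIMSEQ_const_mult_inverse_Suc: "(\<lambda>N. c * inverse (real (Suc N))) \<longlonglongrightarrow> 0"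
  using tendsto_mult[OF tendsto_const LIMSEQ_inverse_real_of_nat, of c] by simp

context bounded_flow
begin

lemma euler_LIMSEQ:
  assumes r: "r \<in> {0..R}"
  shows "(\<lambda>N. euler (r / Suc N) (Suc N) x) \<longlonglongrightarrow> flow r x"
proof (rule LIM_zero_cancel, rule Lim_null_comparison)
  let ?c = "exp (r * L) * (flow_error * (1 + norm x) * r\<^sup>2)"
  show "(\<lambda>N. ?c * inverse (real (Suc N))) \<longlonglongrightarrow> 0"
    by (rule LIMSEQ_const_mult_inverse_Suc)
  show "\<forall>\<^sub>F N in sequentially. norm (euler (r / Suc N) (Suc N) x - flow r x) \<le> ?c * inverse (real (Suc N))"
  proof (intro always_eventually allI)
    fix N
    define h where "h = r / Suc N"
    have h: "0 \<le> h" "Suc N * h = r"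
      using r by (simp_all add: h_def)
    have pow: "(1 + h * L) ^ Suc N \<le> exp (r * L)"
      unfolding h_def using L r by (intro power_one_plus_le_exp) auto
    have "norm (euler h (Suc N) x - flow (Suc N * h) x)
        \<le> (1 + h * L) ^ Suc N * (Suc N * (flow_error * (1 + norm x) * h\<^sup>2))"
      by (rule euler_error[OF h(1)]) (use h(2) r in auto)
    also have "\<dots> \<le> exp (r * L) * (Suc N * (flow_error * (1 + norm x) * h\<^sup>2))"
      using flow_error_nonneg by (intro mult_right_mono pow) auto
    also have "Suc N * (flow_error * (1 + norm x) * h\<^sup>2) = flow_error * (1 + norm x) * r\<^sup>2 * inverse (real (Suc N))"
      unfolding h_def by (simp add: power2_eq_square field_simps del: of_nat_Suc)
    finally show "norm (euler (r / Suc N) (Suc N) x - flow r x) \<le> ?c * inverse (real (Suc N))"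
      unfolding h(2) by (simp only: h_def mult.assoc)
  qed
qed

section \<open>Test functions under one Euler step\<close>

definition test_growth where "test_growth = 2 * L + L\<^sup>2 + H"

lemma test_growth_nonneg: "0 \<le> test_growth"
  using L H by (simp add: test_growth_def)

text \<open>Composition with the step applies the adjoint of the identity plus \<open>h\<close>
  times the derivative of the field to the gradient. The remainder picks up
  \<open>(1 + h * L)\<^sup>2\<close> from the stretched increment and \<open>h * H\<close> from the
  curvature of the field, so the constant stays bounded over many steps of bounded total
  time.\<close>

lemma quadratic_test_step:
  assumes \<phi>: "quadratic_test A \<phi> g" and h: "0 \<le> h" "h \<le> 1" and r: "r \<in> {0..R}"
  shows "\<exists>g'. quadratic_test (A * (1 + h * test_growth)) (\<lambda>x. \<phi> (x + h *\<^sub>R m r x)) g'"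
proof -
  have A: "0 \<le> A"
    using \<phi> norm_ge_zero order.trans unfolding quadratic_test_def by blast
  obtain D where D: "\<And>x. linear (D x)" "\<And>x a. norm (D x a) \<le> L * norm a"
    "\<And>x a. norm (m r (x + a) - m r x - D x a) \<le> H * (norm a)\<^sup>2"
    using quadratic[OF r] by metis
  define S where "S x = x + h *\<^sub>R m r x" for x
  define g' where "g' x = g (S x) + h *\<^sub>R adjoint (D x) (g (S x))" for x
  have g': "g' x \<bullet> a = g (S x) \<bullet> (a + h *\<^sub>R D x a)" for x a
    using adjoint_works[OF D(1)[of x], of a "g (S x)"]
    by (simp add: g'_def inner_add inner_commute)
  have gA: "norm (g y) \<le> A" for y
    using \<phi> by (simp add: quadratic_test_def)
  \<comment> \<open>Here \<open>h \<le> 1\<close> bounds \<open>h\<^sup>2 * L\<^sup>2\<close> by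
    \<open>h * L\<^sup>2\<close>; this is the origin of \<open>test_growth\<close>.\<close>
  have growth: "(1 + h * L)\<^sup>2 + h * H \<le> 1 + h * test_growth"
  proof -
    have "h * (h * L\<^sup>2) \<le> 1 * (h * L\<^sup>2)"
      using h by (intro mult_right_mono) auto
    then show ?thesis
      by (simp add: test_growth_def power2_eq_square algebra_simps)
  qed
  have hL: "1 + h * L \<le> 1 + h * test_growth"
    using h L H by (simp add: test_growth_def mult_left_mono)
  have "quadratic_test (A * (1 + h * test_growth)) (\<lambda>x. \<phi> (x + h *\<^sub>R m r x)) g'"
    unfolding quadratic_test_def S_def[symmetric]
  proof (intro conjI allI)
    fix x
    \<comment> \<open>Pairing \<open>g' x\<close> with itself moves the adjoint back onto
      \<open>D x\<close>, whose norm is known.\<close>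
    have "norm (g' x) * norm (g' x) \<le> A * (1 + h * L) * norm (g' x)"
    proof -
      have "norm (g' x) * norm (g' x) = g (S x) \<bullet> (g' x + h *\<^sub>R D x (g' x))"
        using g'[of x "g' x"] by (simp add: power2_norm_eq_inner[symmetric] power2_eq_square)
      also have "\<dots> \<le> norm (g (S x)) * norm (g' x + h *\<^sub>R D x (g' x))"
        by (rule norm_cauchy_schwarz)
      also have "\<dots> \<le> A * (norm (g' x) + h * (L * norm (g' x)))"
      proof (intro mult_mono gA order.trans[OF norm_triangle_ineq] add_left_mono)
        show "norm (h *\<^sub>R D x (g' x)) \<le> h * (L * norm (g' x))"
          using D(2)[of x "g' x"] h by (simp add: mult_left_mono)
      qed (use A in auto)
      finally show ?thesis
        by (simp add: algebra_simps)
    qed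
    then have "norm (g' x) \<le> A * (1 + h * L)"
      using A h L by (cases "g' x = 0") auto
    also have "\<dots> \<le> A * (1 + h * test_growth)"
      using hL A by (rule mult_left_mono)
    finally show "norm (g' x) \<le> A * (1 + h * test_growth)" .
  next
    fix x a
    define b where "b = S (x + a) - S x"
    define e where "e = m r (x + a) - m r x - D x a"
    have b: "b = a + h *\<^sub>R D x a + h *\<^sub>R e"
      by (simp add: b_def S_def e_def algebra_simps)
    have "norm b \<le> norm a + h * (L * norm a)"
    proof -
      have "b = a + h *\<^sub>R (m r (x + a) - m r x)"
        by (simp add: b_def S_def algebra_simps)
      then have "norm b \<le> norm a + norm (h *\<^sub>R (m r (x + a) - m r x))"
        by (simp only: norm_triangle_ineq)
      also have "norm (h *\<^sub>R (m r (x + a) - m r x)) \<le> h * (L * norm a)"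
        using lipschitz[OF r, of "x + a" x] h by (simp add: mult_left_mono)
      finally show ?thesis by simp
    qed
    then have nb: "norm b \<le> (1 + h * L) * norm a"
      by (simp add: algebra_simps)
    have e: "\<bar>g (S x) \<bullet> (h *\<^sub>R e)\<bar> \<le> A * (h * (H * (norm a)\<^sup>2))"
    proof -
      have "\<bar>g (S x) \<bullet> (h *\<^sub>R e)\<bar> \<le> norm (g (S x)) * norm (h *\<^sub>R e)"
        by (rule Cauchy_Schwarz_ineq2)
      also have "\<dots> \<le> A * (h * (H * (norm a)\<^sup>2))"
        using gA A D(3)[of x a] h by (intro mult_mono) (auto simp: e_def intro: mult_left_mono)
      finally show ?thesis .
    qed
    have "\<bar>\<phi> (S x + b) - \<phi> (S x) - g (S x) \<bullet> b\<bar> \<le> A * (norm b)\<^sup>2"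
      using \<phi> by (simp add: quadratic_test_def)
    also have "\<dots> \<le> A * ((1 + h * L) * norm a)\<^sup>2"
      using nb A by (intro mult_left_mono power_mono) auto
    finally have "\<bar>\<phi> (S x + b) - \<phi> (S x) - g (S x) \<bullet> b\<bar> \<le> A * (1 + h * L)\<^sup>2 * (norm a)\<^sup>2"
      by (simp add: power_mult_distrib mult.assoc)
    moreover have "g (S x) \<bullet> b = g' x \<bullet> a + g (S x) \<bullet> (h *\<^sub>R e)"
      by (simp add: b g' inner_add)
    moreover have "S x + b = S (x + a)"
      by (simp add: b_def)
    ultimately have "\<bar>\<phi> (S (x + a)) - \<phi> (S x) - g' x \<bullet> a\<bar>
        \<le> A * (1 + h * L)\<^sup>2 * (norm a)\<^sup>2 + A * (h * (H * (norm a)\<^sup>2))"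
      using e by simp
    also have "\<dots> = A * ((1 + h * L)\<^sup>2 + h * H) * (norm a)\<^sup>2"
      by (simp add: algebra_simps)
    also have "\<dots> \<le> A * (1 + h * test_growth) * (norm a)\<^sup>2"
      using growth A by (intro mult_right_mono mult_left_mono) auto
    finally show "\<bar>\<phi> (S (x + a)) - \<phi> (S x) - g' x \<bullet> a\<bar> \<le> A * (1 + h * test_growth) * (norm a)\<^sup>2" .
  qed
  then show ?thesis
    by blast
qed

end

section \<open>Transport by conditional velocities\<close>

lemma norm_sum_power2_le:
  fixes a :: "nat \<Rightarrow> 'v::real_inner"
  shows "(norm (\<Sum>j<N. a j))\<^sup>2 \<le> N * (\<Sum>j<N. (norm (a j))\<^sup>2)"
proof -
  have "(norm (\<Sum>j<N. a j))\<^sup>2 \<le> (\<Sum>j<N. norm (a j))\<^sup>2"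
    by (intro power_mono norm_sum) simp
  also have "\<dots> = (\<Sum>j<N. 1 * norm (a j))\<^sup>2"
    by simp
  also have "\<dots> \<le> (\<Sum>j<N. 1\<^sup>2) * (\<Sum>j<N. (norm (a j))\<^sup>2)"
    by (rule Cauchy_Schwarz_ineq_sum)
  finally show ?thesis
    by simp
qed

lemma norm_add_power2_le: "(norm (a + b))\<^sup>2 \<le> 2 * (norm a)\<^sup>2 + 2 * (norm b)\<^sup>2"
proof -
  have "(norm (a + b))\<^sup>2 \<le> (norm a + norm b)\<^sup>2"
    by (intro power_mono norm_triangle_ineq) simp
  also have "\<dots> \<le> 2 * (norm a)\<^sup>2 + 2 * (norm b)\<^sup>2"
    using sum_squares_ge_zero[of "norm a - norm b" 0] by (simp add: power2_eq_square algebra_simps)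
  finally show ?thesis .
qed

text \<open>The hypothesis \<open>conditional\<close> expresses m_r(Z + r X) = E[X | Z + r X] by
  orthogonality of the deviation to all bounded measurable fields of Z + r X, the form in which it
  is applied to the gradient of a test function.\<close>

locale conditional_flow = bounded_flow m R \<beta> L C H + prob_space P
  for m :: "real \<Rightarrow> 'v::euclidean_space \<Rightarrow> 'v" and R \<beta> L C H :: real and P :: "'a measure" +
  fixes Z X :: "'a \<Rightarrow> 'v"
  assumes Z_measurable [measurable]: "Z \<in> borel_measurable P"
    and X_measurable [measurable]: "X \<in> borel_measurable P"
    and X_bounded: "\<And>\<omega>. norm (X \<omega>) \<le> \<beta>"
    and conditional: "\<And>r A g. r \<in> {0..R} \<Longrightarrow> g \<in> borel_measurable borel \<Longrightarrow> (\<And>x. norm (g x) \<le> A) \<Longrightarrow>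
      expectation (\<lambda>\<omega>. (X \<omega> - m r (Z \<omega> + r *\<^sub>R X \<omega>)) \<bullet> g (Z \<omega> + r *\<^sub>R X \<omega>)) = 0"
begin

lemma deviation_bound:
  assumes "r \<in> {0..R}"
  shows "norm (X \<omega> - m r u) \<le> 2 * \<beta>"
  using norm_triangle_ineq4[of "X \<omega>" "m r u"] X_bounded[of \<omega>] bounded[OF assms, of u] by simp

text \<open>The exact point is \<open>V\<close> plus \<open>h\<close> times the deviation
  \<open>D\<close>. Expanding around \<open>V\<close>, the linear term
  \<open>g (V \<omega>) \<bullet> D \<omega>\<close> has mean 0 because \<open>V\<close> is a
  function of \<open>U\<close>; what is left is quadratic, at most
  \<open>A * (h * (2 * \<beta>))\<^sup>2\<close>.\<close>

lemma conditional_step: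
  assumes \<phi>: "quadratic_test A \<phi> g" and \<phi>1: "\<And>x. \<bar>\<phi> x\<bar> \<le> 1" and r: "r \<in> {0..R}"
  shows "\<bar>expectation (\<lambda>\<omega>. \<phi> (Z \<omega> + (r + h) *\<^sub>R X \<omega>))
      - expectation (\<lambda>\<omega>. \<phi> (Z \<omega> + r *\<^sub>R X \<omega> + h *\<^sub>R m r (Z \<omega> + r *\<^sub>R X \<omega>)))\<bar> \<le> 4 * \<beta>\<^sup>2 * h\<^sup>2 * A"
proof -
  define U where "U \<omega> = Z \<omega> + r *\<^sub>R X \<omega>" for \<omega>
  define V where "V \<omega> = U \<omega> + h *\<^sub>R m r (U \<omega>)" for \<omega>
  define D where "D \<omega> = X \<omega> - m r (U \<omega>)" for \<omega>
  have U [measurable]: "U \<in> borel_measurable P"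
    unfolding U_def by measurable
  have mU [measurable]: "(\<lambda>\<omega>. m r (U \<omega>)) \<in> borel_measurable P"
    by (rule field_measurable[OF r U])
  have [measurable]: "V \<in> borel_measurable P" "D \<in> borel_measurable P"
    unfolding V_def D_def by measurable
  note [measurable] = quadratic_test_measurable[OF \<phi>]
  have A: "0 \<le> A" and gA: "norm (g x) \<le> A" for x
    using \<phi> norm_ge_zero order.trans unfolding quadratic_test_def by blast+
  have D: "norm (D \<omega>) \<le> 2 * \<beta>" for \<omega>
    unfolding D_def by (rule deviation_bound[OF r])
  have int1: "integrable P (\<lambda>\<omega>. \<phi> (Z \<omega> + (r + h) *\<^sub>R X \<omega>))" "integrable P (\<lambda>\<omega>. \<phi> (V \<omega>))"
    by (rule integrable_const_bound[where B = 1]; use \<phi>1 in simp)+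
  have gD: "\<bar>h * (g (V \<omega>) \<bullet> D \<omega>)\<bar> \<le> \<bar>h\<bar> * (A * (2 * \<beta>))" for \<omega>
  proof -
    have "\<bar>g (V \<omega>) \<bullet> D \<omega>\<bar> \<le> norm (g (V \<omega>)) * norm (D \<omega>)"
      by (rule Cauchy_Schwarz_ineq2)
    also have "\<dots> \<le> A * (2 * \<beta>)"
      using A by (intro mult_mono gA D) auto
    finally show ?thesis
      by (simp add: abs_mult mult_left_mono)
  qed
  have int2: "integrable P (\<lambda>\<omega>. h * (g (V \<omega>) \<bullet> D \<omega>))"
    by (rule integrable_const_bound[where B = "\<bar>h\<bar> * (A * (2 * \<beta>))"]) (use gD in auto)
  have [measurable]: "m r \<in> borel_measurable borel"
    using field_measurable[OF r, of "\<lambda>x. x" borel] by simp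
  have "expectation (\<lambda>\<omega>. (X \<omega> - m r (Z \<omega> + r *\<^sub>R X \<omega>)) \<bullet> g (Z \<omega> + r *\<^sub>R X \<omega>
      + h *\<^sub>R m r (Z \<omega> + r *\<^sub>R X \<omega>))) = 0"
    by (intro conditional[where g = "\<lambda>u. g (u + h *\<^sub>R m r u)", OF r _ gA]) measurable
  then have zero: "expectation (\<lambda>\<omega>. h * (g (V \<omega>) \<bullet> D \<omega>)) = 0"
    unfolding V_def D_def U_def by (simp add: inner_commute)
  have "expectation (\<lambda>\<omega>. \<phi> (Z \<omega> + (r + h) *\<^sub>R X \<omega>)) - expectation (\<lambda>\<omega>. \<phi> (V \<omega>))
      = expectation (\<lambda>\<omega>. \<phi> (Z \<omega> + (r + h) *\<^sub>R X \<omega>) - \<phi> (V \<omega>) - h * (g (V \<omega>) \<bullet> D \<omega>))"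
    using int1 int2 zero by (simp add: Bochner_Integration.integral_diff)
  also have "\<bar>\<dots>\<bar> \<le> expectation (\<lambda>\<omega>. 4 * \<beta>\<^sup>2 * h\<^sup>2 * A)"
  proof (rule order.trans[OF integral_abs_bound], rule integral_mono)
    show "integrable P (\<lambda>\<omega>. \<bar>\<phi> (Z \<omega> + (r + h) *\<^sub>R X \<omega>) - \<phi> (V \<omega>) - h * (g (V \<omega>) \<bullet> D \<omega>)\<bar>)"
      by (intro integrable_abs Bochner_Integration.integrable_diff int1 int2)
    fix \<omega>
    have "Z \<omega> + (r + h) *\<^sub>R X \<omega> = V \<omega> + h *\<^sub>R D \<omega>"
      by (simp add: V_def U_def D_def algebra_simps)
    moreover have "\<bar>\<phi> (V \<omega> + h *\<^sub>R D \<omega>) - \<phi> (V \<omega>) - g (V \<omega>) \<bullet> (h *\<^sub>R D \<omega>)\<bar> \<le> A * (norm (h *\<^sub>R D \<omega>))\<^sup>2"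
      using \<phi> by (simp only: quadratic_test_def)
    ultimately have "\<bar>\<phi> (Z \<omega> + (r + h) *\<^sub>R X \<omega>) - \<phi> (V \<omega>) - h * (g (V \<omega>) \<bullet> D \<omega>)\<bar>
        \<le> A * (h\<^sup>2 * (norm (D \<omega>))\<^sup>2)"
      by (simp add: power_mult_distrib)
    also have "\<dots> \<le> A * (h\<^sup>2 * (2 * \<beta>)\<^sup>2)"
      using A D by (intro mult_left_mono power_mono) auto
    finally show "\<bar>\<phi> (Z \<omega> + (r + h) *\<^sub>R X \<omega>) - \<phi> (V \<omega>) - h * (g (V \<omega>) \<bullet> D \<omega>)\<bar> \<le> 4 * \<beta>\<^sup>2 * h\<^sup>2 * A"
      by (simp add: power_mult_distrib algebra_simps)
  qed simp
  also have "\<dots> = 4 * \<beta>\<^sup>2 * h\<^sup>2 * A"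
    by (simp add: prob_space)
  finally show ?thesis
    by (simp only: V_def U_def)
qed

text \<open>The induction peels off the last Euler step and transfers it to the test function, hence
  the generalisation over \<phi>. Each of the \<open>j\<close> local errors is of order
  \<open>h\<^sup>2\<close>, so the total is of order \<open>h\<close> on a fixed time
  interval.\<close>

lemma euler_expectation:
  assumes h: "0 \<le> h" "h \<le> 1"
  shows "quadratic_test A \<phi> g \<Longrightarrow> (\<And>x. \<bar>\<phi> x\<bar> \<le> 1) \<Longrightarrow> j * h \<le> R \<Longrightarrow>
    \<bar>expectation (\<lambda>\<omega>. \<phi> (Z \<omega> + (j * h) *\<^sub>R X \<omega>)) - expectation (\<lambda>\<omega>. \<phi> (euler h j (Z \<omega>)))\<bar>
      \<le> 4 * \<beta>\<^sup>2 * h\<^sup>2 * (j * A * (1 + h * test_growth) ^ j)"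
proof (induction j arbitrary: A \<phi> g)
  case 0
  then show ?case by simp
next
  case (Suc j)
  have A: "0 \<le> A"
    using Suc.prems(1) norm_ge_zero order.trans unfolding quadratic_test_def by blast
  have r: "j * h \<in> {0..R}"
    using Suc.prems(3) h by (auto simp: algebra_simps)
  define \<psi> where "\<psi> x = \<phi> (x + h *\<^sub>R m (j * h) x)" for x
  define B where "B = 1 + h * test_growth"
  have B: "1 \<le> B"
    using h test_growth_nonneg by (simp add: B_def)
  obtain g' where "quadratic_test (A * B) \<psi> g'"
    using quadratic_test_step[OF Suc.prems(1) h r] unfolding \<psi>_def B_def by blast
  then have "\<bar>expectation (\<lambda>\<omega>. \<psi> (Z \<omega> + (j * h) *\<^sub>R X \<omega>)) - expectation (\<lambda>\<omega>. \<psi> (euler h j (Z \<omega>)))\<bar>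
      \<le> 4 * \<beta>\<^sup>2 * h\<^sup>2 * (j * (A * B) * B ^ j)"
    unfolding B_def by (rule Suc.IH) (use Suc.prems r in \<open>auto simp: \<psi>_def\<close>)
  moreover have "\<bar>expectation (\<lambda>\<omega>. \<phi> (Z \<omega> + (j * h + h) *\<^sub>R X \<omega>)) - expectation (\<lambda>\<omega>. \<psi> (Z \<omega> + (j * h) *\<^sub>R X \<omega>))\<bar>
      \<le> 4 * \<beta>\<^sup>2 * h\<^sup>2 * A"
    unfolding \<psi>_def by (rule conditional_step[OF Suc.prems(1,2) r])
  moreover have "j * h + h = Suc j * h"
    by (simp add: algebra_simps)
  moreover have "(\<lambda>\<omega>. \<psi> (euler h j (Z \<omega>))) = (\<lambda>\<omega>. \<phi> (euler h (Suc j) (Z \<omega>)))"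
    by (simp add: \<psi>_def)
  ultimately have "\<bar>expectation (\<lambda>\<omega>. \<phi> (Z \<omega> + (Suc j * h) *\<^sub>R X \<omega>)) - expectation (\<lambda>\<omega>. \<phi> (euler h (Suc j) (Z \<omega>)))\<bar>
      \<le> 4 * \<beta>\<^sup>2 * h\<^sup>2 * (j * (A * B) * B ^ j) + 4 * \<beta>\<^sup>2 * h\<^sup>2 * A"
    by (simp only:)
  also have "\<dots> \<le> 4 * \<beta>\<^sup>2 * h\<^sup>2 * (j * (A * B) * B ^ j) + 4 * \<beta>\<^sup>2 * h\<^sup>2 * (A * B ^ Suc j)"
    using one_le_power[OF B, of "Suc j"] A mult_left_mono[of 1 "B ^ Suc j" A]
    by (intro add_left_mono mult_left_mono) (auto simp del: power_Suc)
  also have "\<dots> = 4 * \<beta>\<^sup>2 * h\<^sup>2 * (Suc j * A * B ^ Suc j)"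
    by (simp add: algebra_simps)
  finally show ?case
    by (simp only: B_def)
qed

text \<open>The expectations along the Euler scheme converge to the left-hand side by convergence of
  the scheme, and to the right-hand side by \<open>euler_expectation\<close>.\<close>

lemma flow_expectation:
  assumes \<phi>: "quadratic_test A \<phi> g" and \<phi>1: "\<And>x. \<bar>\<phi> x\<bar> \<le> 1" and r: "r \<in> {0..R}"
  shows "expectation (\<lambda>\<omega>. \<phi> (flow r (Z \<omega>))) = expectation (\<lambda>\<omega>. \<phi> (Z \<omega> + r *\<^sub>R X \<omega>))"
proof (rule LIMSEQ_unique)
  note [measurable] = quadratic_test_measurable[OF \<phi>]
  have step: "0 \<le> r / Suc N" "Suc N * (r / Suc N) = r" for N
    using r by (auto simp del: of_nat_Suc)
  have emeas: "(\<lambda>\<omega>. euler (r / Suc N) (Suc N) (Z \<omega>)) \<in> borel_measurable P" for N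
    using r by (intro euler_measurable step Z_measurable) (simp only: step, simp)
  show "(\<lambda>N. expectation (\<lambda>\<omega>. \<phi> (euler (r / Suc N) (Suc N) (Z \<omega>)))) \<longlonglongrightarrow> expectation (\<lambda>\<omega>. \<phi> (flow r (Z \<omega>)))"
  proof (rule integral_dominated_convergence[where w = "\<lambda>_. 1"])
    show "(\<lambda>\<omega>. \<phi> (flow r (Z \<omega>))) \<in> borel_measurable P"
      by (rule measurable_compose[OF flow_measurable[OF r Z_measurable]]) measurable
    show "(\<lambda>\<omega>. \<phi> (euler (r / Suc N) (Suc N) (Z \<omega>))) \<in> borel_measurable P" for N
      by (rule measurable_compose[OF emeas]) measurable
    show "AE \<omega> in P. (\<lambda>N. \<phi> (euler (r / Suc N) (Suc N) (Z \<omega>))) \<longlonglongrightarrow> \<phi> (flow r (Z \<omega>))"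
      using quadratic_test_continuous[OF \<phi>]
      by (intro AE_I2 isCont_tendsto_compose[OF _ euler_LIMSEQ[OF r]])
         (simp add: continuous_on_eq_continuous_at)
  qed (use \<phi>1 in auto)
  let ?c = "4 * \<beta>\<^sup>2 * r\<^sup>2 * (A * exp (r * test_growth))"
  have A: "0 \<le> A"
    using \<phi> norm_ge_zero order.trans unfolding quadratic_test_def by blast
  show "(\<lambda>N. expectation (\<lambda>\<omega>. \<phi> (euler (r / Suc N) (Suc N) (Z \<omega>)))) \<longlonglongrightarrow> expectation (\<lambda>\<omega>. \<phi> (Z \<omega> + r *\<^sub>R X \<omega>))"
  proof (rule LIM_zero_cancel, rule Lim_null_comparison)
    show "(\<lambda>N. ?c * inverse (real (Suc N))) \<longlonglongrightarrow> 0"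
      by (rule LIMSEQ_const_mult_inverse_Suc)
    \<comment> \<open>From \<open>N0\<close> on the step size is at most 1, as
      \<open>euler_expectation\<close> requires.\<close>
    obtain N0 :: nat where N0: "r \<le> N0"
      using real_arch_simple by blast
    show "\<forall>\<^sub>F N in sequentially. norm (expectation (\<lambda>\<omega>. \<phi> (euler (r / Suc N) (Suc N) (Z \<omega>)))
        - expectation (\<lambda>\<omega>. \<phi> (Z \<omega> + r *\<^sub>R X \<omega>))) \<le> ?c * inverse (real (Suc N))"
    proof (rule eventually_sequentiallyI[of N0])
      fix N assume "N \<ge> N0"
      define h where "h = r / Suc N"
      have h: "0 \<le> h" "h \<le> 1" "Suc N * h = r"
        using \<open>N \<ge> N0\<close> N0 r by (auto simp: h_def field_simps)
      have "norm (expectation (\<lambda>\<omega>. \<phi> (euler h (Suc N) (Z \<omega>))) - expectation (\<lambda>\<omega>. \<phi> (Z \<omega> + (Suc N * h) *\<^sub>R X \<omega>)))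
          \<le> 4 * \<beta>\<^sup>2 * h\<^sup>2 * (Suc N * A * (1 + h * test_growth) ^ Suc N)"
        unfolding real_norm_def using r h
        by (subst abs_minus_commute) (intro euler_expectation[OF _ _ \<phi> \<phi>1]; simp only: atLeastAtMost_iff)
      also have "\<dots> \<le> 4 * \<beta>\<^sup>2 * h\<^sup>2 * (Suc N * A * exp (r * test_growth))"
        unfolding h_def using A r test_growth_nonneg
        by (intro mult_left_mono power_one_plus_le_exp) auto
      also have "\<dots> = ?c * inverse (real (Suc N))"
        unfolding h_def by (simp add: power2_eq_square field_simps del: of_nat_Suc)
      finally show "norm (expectation (\<lambda>\<omega>. \<phi> (euler (r / Suc N) (Suc N) (Z \<omega>)))
        - expectation (\<lambda>\<omega>. \<phi> (Z \<omega> + r *\<^sub>R X \<omega>))) \<le> ?c * inverse (real (Suc N))"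
        unfolding h(3) by (simp only: h_def)
    qed
  qed
qed

text \<open>This takes the place of a uniqueness theorem for the continuity equation: cosine and
  sine are quadratic tests, so the characteristic functions agree.\<close>

theorem flow_distr:
  assumes r: "r \<in> {0..R}"
  shows "distr P borel (\<lambda>\<omega>. flow r (Z \<omega>)) = distr P borel (\<lambda>\<omega>. Z \<omega> + r *\<^sub>R X \<omega>)"
proof (rule measure_eqI_char)
  have [measurable]: "(\<lambda>\<omega>. flow r (Z \<omega>)) \<in> borel_measurable P"
    by (rule flow_measurable[OF r Z_measurable])
  show "prob_space (distr P borel (\<lambda>\<omega>. flow r (Z \<omega>)))" "prob_space (distr P borel (\<lambda>\<omega>. Z \<omega> + r *\<^sub>R X \<omega>))"
    by (auto intro!: prob_space_distr)
  fix u :: 'v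
  have parts: "expectation (\<lambda>\<omega>. cis (u \<bullet> f \<omega>))
      = Complex (expectation (\<lambda>\<omega>. cos (u \<bullet> f \<omega>))) (expectation (\<lambda>\<omega>. sin (u \<bullet> f \<omega>)))"
    if [measurable]: "f \<in> borel_measurable P" for f
  proof -
    have "integrable P (\<lambda>\<omega>. cis (u \<bullet> f \<omega>))"
      by (rule integrable_const_bound[where B = 1]) auto
    then show ?thesis
      by (simp add: complex_eq_iff integral_Re[symmetric] integral_Im[symmetric] del: integral_Re integral_Im)
  qed
  have "expectation (\<lambda>\<omega>. cos (u \<bullet> flow r (Z \<omega>))) = expectation (\<lambda>\<omega>. cos (u \<bullet> (Z \<omega> + r *\<^sub>R X \<omega>)))"
    by (rule flow_expectation[OF quadratic_test_trig(1) _ r]) simp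
  moreover have "expectation (\<lambda>\<omega>. sin (u \<bullet> flow r (Z \<omega>))) = expectation (\<lambda>\<omega>. sin (u \<bullet> (Z \<omega> + r *\<^sub>R X \<omega>)))"
    by (rule flow_expectation[OF quadratic_test_trig(2) _ r]) simp
  ultimately show "(\<integral>x. cis (u \<bullet> x) \<partial>distr P borel (\<lambda>\<omega>. flow r (Z \<omega>)))
      = (\<integral>x. cis (u \<bullet> x) \<partial>distr P borel (\<lambda>\<omega>. Z \<omega> + r *\<^sub>R X \<omega>))"
    by (simp add: integral_distr parts)
qed simp_all

text \<open>The rescaled trajectory \<open>l r *\<^sub>R flow r x\<close> has velocity \<open>l r *\<^sub>R (m r u - k r *\<^sub>R u)\<close>
  at \<open>u = flow r x\<close>; the cost is Cauchy-Schwarz in time on a grid, with the factor 2 absorbing the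
  discretisation error.\<close>

lemma scaled_flow_cost:
  fixes l k :: "real \<Rightarrow> real"
  assumes l0: "l 0 = 1" and l1: "\<And>r. r \<in> {0..R} \<Longrightarrow> 0 \<le> l r \<and> l r \<le> 1" and K: "0 \<le> K"
    and lip: "\<And>r s. 0 \<le> r \<Longrightarrow> r \<le> s \<Longrightarrow> s \<le> R \<Longrightarrow> \<bar>l s - l r\<bar> \<le> K * (s - r)"
    and taylor: "\<And>r s. 0 \<le> r \<Longrightarrow> r \<le> s \<Longrightarrow> s \<le> R \<Longrightarrow> \<bar>l s - l r + (s - r) * (l r * k r)\<bar> \<le> K * (s - r)\<^sup>2"
    and S: "\<And>r. r \<in> {0..R} \<Longrightarrow> (\<integral>\<^sup>+\<omega>. ennreal ((norm (m r (Z \<omega> + r *\<^sub>R X \<omega>) - k r *\<^sub>R (Z \<omega> + r *\<^sub>R X \<omega>)))\<^sup>2) \<partial>P) \<le> ennreal S"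
    and S0: "0 \<le> S"
    and moment: "(\<integral>\<^sup>+\<omega>. ennreal ((1 + norm (Z \<omega>))\<^sup>2) \<partial>P) < \<infinity>"
  shows "(\<integral>\<^sup>+\<omega>. ennreal ((norm (Z \<omega> - l R *\<^sub>R flow R (Z \<omega>)))\<^sup>2) \<partial>P) \<le> ennreal (2 * R\<^sup>2 * S)"
proof -
  define w where "w r u = m r u - k r *\<^sub>R u" for r u
  define E where "E = flow_error + K * \<beta> + K * (1 + R * \<beta>)"
  have E: "0 \<le> E"
    using flow_error_nonneg K \<beta> R by (simp add: E_def)
  have step: "norm (l s *\<^sub>R flow s x - l r *\<^sub>R flow r x - ((s - r) * l r) *\<^sub>R w r (flow r x)) \<le> E * (1 + norm x) * (s - r)\<^sup>2"
    if rs: "0 \<le> r" "r \<le> s" "s \<le> R" for r s x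
  proof -
    have rR: "r \<in> {0..R}"
      using rs by auto
    \<comment> \<open>Discrete product rule for \<open>l r *\<^sub>R flow r x\<close>:
      \<open>a\<close> contains the truncation error of the flow, \<open>c\<close> that of
      \<open>l\<close>, and \<open>b\<close> the product of the two increments; each is of second
      order in \<open>s - r\<close>.\<close>
    define a where "a = l r *\<^sub>R (flow s x - flow r x - (s - r) *\<^sub>R m r (flow r x))"
    define b where "b = (l s - l r) *\<^sub>R (flow s x - flow r x)"
    define c where "c = (l s - l r + (s - r) * (l r * k r)) *\<^sub>R flow r x"
    have "l s *\<^sub>R flow s x - l r *\<^sub>R flow r x - ((s - r) * l r) *\<^sub>R w r (flow r x) = a + b + c"
      by (simp add: a_def b_def c_def w_def algebra_simps)
    also have "norm \<dots> \<le> norm a + norm b + norm c"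
      by (intro order.trans[OF norm_triangle_ineq] add_mono norm_triangle_ineq order.refl)
    also have "norm a \<le> flow_error * (1 + norm x) * (s - r)\<^sup>2"
    proof -
      have "norm a \<le> 1 * norm (flow s x - flow r x - (s - r) *\<^sub>R m r (flow r x))"
        unfolding a_def norm_scaleR using l1[OF rR] by (intro mult_right_mono) auto
      then show ?thesis
        using flow_taylor[OF rs, of x] by simp
    qed
    also have "norm b \<le> K * \<beta> * (1 + norm x) * (s - r)\<^sup>2"
    proof -
      have "norm b \<le> (K * (s - r)) * (\<beta> * (s - r))"
        unfolding b_def norm_scaleR using K rs
        by (intro mult_mono lip flow_time_lipschitz) auto
      also have "\<dots> = K * \<beta> * 1 * (s - r)\<^sup>2"
        by (simp add: power2_eq_square)
      also have "\<dots> \<le> K * \<beta> * (1 + norm x) * (s - r)\<^sup>2"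
        using K \<beta> by (intro mult_right_mono mult_left_mono) auto
      finally show ?thesis .
    qed
    also have "norm c \<le> K * (1 + R * \<beta>) * (1 + norm x) * (s - r)\<^sup>2"
    proof -
      have "norm c \<le> (K * (s - r)\<^sup>2) * (norm x + R * \<beta>)"
        unfolding c_def norm_scaleR real_norm_def using K
        by (intro mult_mono taylor[OF rs] flow_norm_le[OF rR]) auto
      also have "\<dots> \<le> (K * (s - r)\<^sup>2) * ((1 + R * \<beta>) * (1 + norm x))"
        using K R \<beta> by (intro mult_left_mono) (auto simp: algebra_simps)
      finally show ?thesis
        by (simp add: algebra_simps)
    qed
    finally show ?thesis
      by (simp add: E_def algebra_simps)
  qed
  define B where "B = enn2real (\<integral>\<^sup>+\<omega>. ennreal ((1 + norm (Z \<omega>))\<^sup>2) \<partial>P)"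
  have B: "(\<integral>\<^sup>+\<omega>. ennreal ((1 + norm (Z \<omega>))\<^sup>2) \<partial>P) = ennreal B" "0 \<le> B"
    using moment by (simp_all add: B_def)
  let ?I = "\<integral>\<^sup>+\<omega>. ennreal ((norm (Z \<omega> - l R *\<^sub>R flow R (Z \<omega>)))\<^sup>2) \<partial>P"
  let ?c = "2 * R\<^sup>2 * E\<^sup>2 * B * R\<^sup>2"
  have grid: "?I \<le> ennreal (2 * R\<^sup>2 * S + ?c * inverse (real (Suc N)))" for N
  proof -
    define n where "n = real (Suc N)"
    define h where "h = R / n"
    have n: "1 \<le> n"
      by (simp add: n_def)
    have h: "0 \<le> h" "n * h = R"
      using R n by (simp_all add: h_def)
    have grid: "j * h \<in> {0..R}" "Suc j * h \<le> R" if "j < Suc N" for j :: nat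
    proof -
      have "Suc j * h \<le> n * h"
        using that h unfolding n_def by (intro mult_right_mono) auto
      then show "Suc j * h \<le> R"
        by (simp add: h)
      then show "j * h \<in> {0..R}"
        using h by (auto simp: algebra_simps)
    qed
    \<comment> \<open>Telescoping over the grid: Cauchy-Schwarz costs a factor \<open>n\<close> for
      the main terms, while the errors of size \<open>E * (1 + norm x) * h\<^sup>2\<close> are added
      by the triangle inequality.\<close>
    have pointwise: "(norm (x - l R *\<^sub>R flow R x))\<^sup>2
        \<le> 2 * n * h\<^sup>2 * (\<Sum>j<Suc N. (norm (w (j * h) (flow (j * h) x)))\<^sup>2) + 2 * n\<^sup>2 * E\<^sup>2 * h ^ 4 * (1 + norm x)\<^sup>2" for x
    proof -
      define d where "d j = (h * l (j * h)) *\<^sub>R w (j * h) (flow (j * h) x)" for j :: nat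
      define y where "y j = l (j * h) *\<^sub>R flow (j * h) x" for j :: nat
      have "l R *\<^sub>R flow R x - x = y (Suc N) - y 0"
        using h by (simp add: y_def n_def l0 flow_0)
      also have "\<dots> = (\<Sum>j<Suc N. y (Suc j) - y j)"
        by (rule sum_lessThan_telescope[symmetric])
      also have "\<dots> = (\<Sum>j<Suc N. d j) + (\<Sum>j<Suc N. y (Suc j) - y j - d j)"
        by (simp add: sum_subtractf)
      finally have "(norm (x - l R *\<^sub>R flow R x))\<^sup>2
          = (norm ((\<Sum>j<Suc N. d j) + (\<Sum>j<Suc N. y (Suc j) - y j - d j)))\<^sup>2"
        by (subst norm_minus_commute) (simp only:)
      also have "\<dots> \<le> 2 * (norm (\<Sum>j<Suc N. d j))\<^sup>2 + 2 * (norm (\<Sum>j<Suc N. y (Suc j) - y j - d j))\<^sup>2"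
        by (rule norm_add_power2_le)
      also have "(norm (\<Sum>j<Suc N. y (Suc j) - y j - d j))\<^sup>2 \<le> (n * (E * (1 + norm x) * h\<^sup>2))\<^sup>2"
      proof (intro power_mono)
        have "norm (\<Sum>j<Suc N. y (Suc j) - y j - d j) \<le> (\<Sum>j<Suc N. E * (1 + norm x) * h\<^sup>2)"
        proof (rule sum_norm_le)
          fix j assume "j \<in> {..<Suc N}"
          then have j: "j < Suc N"
            by simp
          have "Suc j * h - j * h = h"
            by (simp add: algebra_simps)
          then show "norm (y (Suc j) - y j - d j) \<le> E * (1 + norm x) * h\<^sup>2"
            using step[of "j * h" "Suc j * h" x] grid[OF j] h
            unfolding y_def d_def by (simp add: mult_right_mono del: of_nat_Suc)
        qed
        also have "\<dots> = n * (E * (1 + norm x) * h\<^sup>2)"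
          by (simp add: n_def)
        finally show "norm (\<Sum>j<Suc N. y (Suc j) - y j - d j) \<le> n * (E * (1 + norm x) * h\<^sup>2)" .
      qed simp
      also have "(norm (\<Sum>j<Suc N. d j))\<^sup>2 \<le> n * (\<Sum>j<Suc N. (norm (d j))\<^sup>2)"
        unfolding n_def by (rule norm_sum_power2_le)
      also have "(\<Sum>j<Suc N. (norm (d j))\<^sup>2) \<le> (\<Sum>j<Suc N. h\<^sup>2 * (norm (w (j * h) (flow (j * h) x)))\<^sup>2)"
      proof (rule sum_mono)
        fix j assume "j \<in> {..<Suc N}"
        then have "0 \<le> l (j * h)" "l (j * h) \<le> 1"
          using l1[OF grid(1)[of j]] by auto
        then have "norm (d j) \<le> h * norm (w (j * h) (flow (j * h) x))"
          unfolding d_def norm_scaleR using h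
          by (intro mult_right_mono) (auto simp: abs_mult mult_left_le)
        then have "(norm (d j))\<^sup>2 \<le> (h * norm (w (j * h) (flow (j * h) x)))\<^sup>2"
          by (rule power_mono) simp
        then show "(norm (d j))\<^sup>2 \<le> h\<^sup>2 * (norm (w (j * h) (flow (j * h) x)))\<^sup>2"
          by (simp add: power_mult_distrib)
      qed
      finally show ?thesis
        using n by (simp add: sum_distrib_left[symmetric] power_mult_distrib ac_simps
            power_mult[symmetric] del: sum.lessThan_Suc)
    qed
    \<comment> \<open>Here \<open>flow_distr\<close> enters: the velocity along the flow started at
      Z is distributed as the velocity at Z + r X, whose second moment is bounded by
      hypothesis.\<close>
    have wflow: "(\<integral>\<^sup>+\<omega>. ennreal ((norm (w r (flow r (Z \<omega>))))\<^sup>2) \<partial>P) \<le> ennreal S"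
      "(\<lambda>\<omega>. w r (flow r (Z \<omega>))) \<in> borel_measurable P" if r: "r \<in> {0..R}" for r
    proof -
      have fm [measurable]: "(\<lambda>\<omega>. flow r (Z \<omega>)) \<in> borel_measurable P"
        by (rule flow_measurable[OF r Z_measurable])
      have [measurable]: "w r \<in> borel_measurable borel"
        unfolding w_def by (intro borel_measurable_diff field_measurable[OF r]) measurable
      show "(\<lambda>\<omega>. w r (flow r (Z \<omega>))) \<in> borel_measurable P"
        by measurable
      have "(\<integral>\<^sup>+\<omega>. ennreal ((norm (w r (flow r (Z \<omega>))))\<^sup>2) \<partial>P)
          = (\<integral>\<^sup>+u. ennreal ((norm (w r u))\<^sup>2) \<partial>distr P borel (\<lambda>\<omega>. flow r (Z \<omega>)))"
        by (rule nn_integral_distr[symmetric]) measurable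
      also have "\<dots> = (\<integral>\<^sup>+\<omega>. ennreal ((norm (w r (Z \<omega> + r *\<^sub>R X \<omega>)))\<^sup>2) \<partial>P)"
        unfolding flow_distr[OF r] by (rule nn_integral_distr) measurable
      also have "\<dots> \<le> ennreal S"
        unfolding w_def by (rule S[OF r])
      finally show "(\<integral>\<^sup>+\<omega>. ennreal ((norm (w r (flow r (Z \<omega>))))\<^sup>2) \<partial>P) \<le> ennreal S" .
    qed
    have meas: "(\<lambda>\<omega>. ennreal ((norm (w (j * h) (flow (j * h) (Z \<omega>))))\<^sup>2)) \<in> borel_measurable P"
      if "j \<in> {..<Suc N}" for j :: nat
      using wflow(2)[OF grid(1), of j] that by simp
    have "?I \<le> (\<integral>\<^sup>+\<omega>. ennreal (2 * n * h\<^sup>2) * (\<Sum>j<Suc N. ennreal ((norm (w (j * h) (flow (j * h) (Z \<omega>))))\<^sup>2))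
        + ennreal (2 * n\<^sup>2 * E\<^sup>2 * h ^ 4) * ennreal ((1 + norm (Z \<omega>))\<^sup>2) \<partial>P)"
    proof (rule nn_integral_mono)
      fix \<omega>
      show "ennreal ((norm (Z \<omega> - l R *\<^sub>R flow R (Z \<omega>)))\<^sup>2)
        \<le> ennreal (2 * n * h\<^sup>2) * (\<Sum>j<Suc N. ennreal ((norm (w (j * h) (flow (j * h) (Z \<omega>))))\<^sup>2))
        + ennreal (2 * n\<^sup>2 * E\<^sup>2 * h ^ 4) * ennreal ((1 + norm (Z \<omega>))\<^sup>2)"
        using ennreal_leI[OF pointwise[of "Z \<omega>"]] n h
        by (subst (asm) ennreal_plus)
           (auto simp: ennreal_mult sum_nonneg simp del: sum.lessThan_Suc sum_ennreal simp flip: sum_ennreal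
             intro!: mult_nonneg_nonneg)
    qed
    also have "\<dots> = ennreal (2 * n * h\<^sup>2) * (\<Sum>j<Suc N. \<integral>\<^sup>+\<omega>. ennreal ((norm (w (j * h) (flow (j * h) (Z \<omega>))))\<^sup>2) \<partial>P)
        + ennreal (2 * n\<^sup>2 * E\<^sup>2 * h ^ 4) * ennreal B"
    proof -
      have "(\<lambda>\<omega>. \<Sum>j<Suc N. ennreal ((norm (w (j * h) (flow (j * h) (Z \<omega>))))\<^sup>2)) \<in> borel_measurable P"
        by (rule borel_measurable_sum[OF meas])
      moreover have "(\<integral>\<^sup>+\<omega>. (\<Sum>j<Suc N. ennreal ((norm (w (j * h) (flow (j * h) (Z \<omega>))))\<^sup>2)) \<partial>P)
          = (\<Sum>j<Suc N. \<integral>\<^sup>+\<omega>. ennreal ((norm (w (j * h) (flow (j * h) (Z \<omega>))))\<^sup>2) \<partial>P)"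
        by (rule nn_integral_sum[OF meas])
      ultimately show ?thesis
        by (subst nn_integral_add) (auto simp: nn_integral_cmult B(1)
            simp del: sum.lessThan_Suc sum_ennreal)
    qed
    also have "\<dots> \<le> ennreal (2 * n * h\<^sup>2) * (\<Sum>j<Suc N. ennreal S) + ennreal (2 * n\<^sup>2 * E\<^sup>2 * h ^ 4) * ennreal B"
      by (intro add_right_mono mult_left_mono sum_mono wflow(1) grid(1)) auto
    also have "\<dots> = ennreal (2 * n * h\<^sup>2 * (n * S) + 2 * n\<^sup>2 * E\<^sup>2 * h ^ 4 * B)"
      using S0 B(2) n h
      by (subst ennreal_plus) (auto simp: ennreal_mult n_def ennreal_of_nat_eq_real_of_nat simp del: of_nat_Suc)
    also have "\<dots> \<le> ennreal (2 * R\<^sup>2 * S + ?c * inverse (real (Suc N)))"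
    proof (rule ennreal_leI)
      \<comment> \<open>With \<open>n * h = R\<close> the main term is exactly
        \<open>2 * R\<^sup>2 * S\<close>; the error is of order \<open>1 / n\<^sup>2\<close> and is
        weakened to order \<open>1 / n\<close>.\<close>
      have "2 * n * h\<^sup>2 * (n * S) + 2 * n\<^sup>2 * E\<^sup>2 * h ^ 4 * B = 2 * (n * h)\<^sup>2 * S + 2 * (n * h)\<^sup>2 * E\<^sup>2 * B * h\<^sup>2"
        by (simp add: power2_eq_square power4_eq_xxxx)
      also have "\<dots> = 2 * R\<^sup>2 * S + 2 * R\<^sup>2 * E\<^sup>2 * B * (R\<^sup>2 * (inverse n)\<^sup>2)"
        unfolding h(2) by (simp add: h_def power_mult_distrib power_inverse divide_inverse)
      also have "\<dots> \<le> 2 * R\<^sup>2 * S + 2 * R\<^sup>2 * E\<^sup>2 * B * (R\<^sup>2 * inverse n)"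
      proof (intro add_left_mono mult_left_mono)
        have "inverse n \<le> 1" "0 \<le> inverse n"
          using n by (auto simp: inverse_le_1_iff)
        then show "(inverse n)\<^sup>2 \<le> inverse n"
          by (simp add: power2_eq_square mult_left_le)
      qed (use B(2) in auto)
      finally show "2 * n * h\<^sup>2 * (n * S) + 2 * n\<^sup>2 * E\<^sup>2 * h ^ 4 * B \<le> 2 * R\<^sup>2 * S + ?c * inverse (real (Suc N))"
        by (simp add: n_def mult.assoc)
    qed
    finally show ?thesis .
  qed
  have "(\<lambda>N. 2 * R\<^sup>2 * S + ?c * inverse (real (Suc N))) \<longlonglongrightarrow> 2 * R\<^sup>2 * S + 0"
    by (intro tendsto_add tendsto_const LIMSEQ_const_mult_inverse_Suc)
  then have "(\<lambda>N. ennreal (2 * R\<^sup>2 * S + ?c * inverse (real (Suc N)))) \<longlonglongrightarrow> ennreal (2 * R\<^sup>2 * S)"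
    by (intro tendsto_ennrealI) simp
  then show ?thesis
    by (rule LIMSEQ_le_const) (use grid in auto)
qed

end

section \<open>Exponential tilting\<close>

lemma exp_quadratic_error:
  fixes x :: real
  assumes "\<bar>x\<bar> \<le> 1"
  shows "\<bar>exp x - 1 - x\<bar> \<le> x\<^sup>2"
proof -
  have lower: "1 + x \<le> exp x"
    by (rule exp_ge_add_one_self)
  have "exp x \<le> 1 + x + x\<^sup>2"
  proof (cases "0 \<le> x")
    case True
    then show ?thesis using assms exp_bound[of x] by simp
  next
    case False
    define y where "y = - x"
    have y: "0 < y" "y \<le> 1"
      using False assms by (auto simp: y_def)
    \<comment> \<open>The product is at least 1; replacing the factor \<open>1 + y\<close> by the
      larger \<open>exp y\<close> gives the bound on \<open>exp (- y)\<close>.\<close>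
    have "(1 - y + y\<^sup>2) * (1 + y) = 1 + y ^ 3"
      by (simp add: power2_eq_square power3_eq_cube algebra_simps)
    then have "1 \<le> (1 - y + y\<^sup>2) * (1 + y)"
      using y by simp
    also have "\<dots> \<le> (1 - y + y\<^sup>2) * exp y"
      using y by (intro mult_left_mono exp_ge_add_one_self) simp
    finally have "exp (- y) \<le> 1 - y + y\<^sup>2"
      by (simp add: exp_minus field_simps)
    then show ?thesis
      by (simp add: y_def)
  qed
  then show ?thesis
    using lower zero_le_power2[of x] unfolding abs_le_iff by linarith
qed

lemma (in prob_space) integral_norm_le_const:
  fixes f :: "'a \<Rightarrow> 'b::{banach, second_countable_topology}"
  assumes "f \<in> borel_measurable M" "\<And>\<omega>. norm (f \<omega>) \<le> c"
  shows "norm (expectation f) \<le> c"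
proof -
  have "norm (expectation f) \<le> expectation (\<lambda>\<omega>. norm (f \<omega>))"
    by (rule integral_norm_bound)
  also have "\<dots> \<le> c"
    using assms by (intro integral_le_const integrable_const_bound[where B = c]) auto
  finally show ?thesis .
qed

text \<open>First-order perturbation of a mean under an exponential tilt, \<Delta> being the
  covariance of \<xi> and \<open>X\<close>. The regularity of the conditional mean in space and time
  rests on it. The bounds hold for every \<epsilon>: for \<epsilon> > 1 they follow from both means
  lying in the ball of radius \<beta>.\<close>

lemma (in prob_space) exponential_tilt:
  fixes X :: "'a \<Rightarrow> 'b::euclidean_space" and \<xi> :: "'a \<Rightarrow> real"
  assumes [measurable]: "X \<in> borel_measurable M" "\<xi> \<in> borel_measurable M"
    and X: "\<And>\<omega>. norm (X \<omega>) \<le> \<beta>" and \<xi>: "\<And>\<omega>. \<bar>\<xi> \<omega>\<bar> \<le> \<epsilon>" and nonneg: "0 \<le> \<beta>" "0 \<le> \<epsilon>"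
  defines "\<mu> \<equiv> expectation X"
    and "\<mu>' \<equiv> expectation (\<lambda>\<omega>. exp (\<xi> \<omega>) *\<^sub>R X \<omega>) /\<^sub>R expectation (\<lambda>\<omega>. exp (\<xi> \<omega>))"
  defines "\<Delta> \<equiv> expectation (\<lambda>\<omega>. \<xi> \<omega> *\<^sub>R (X \<omega> - \<mu>))"
  shows "norm \<Delta> \<le> 2 * \<beta> * \<epsilon>" and "norm (\<mu>' - \<mu> - \<Delta>) \<le> 18 * \<beta> * \<epsilon>\<^sup>2" and "norm (\<mu>' - \<mu>) \<le> 20 * \<beta> * \<epsilon>"
    and "norm \<mu>' \<le> \<beta>"
proof -
  define I where "I = expectation (\<lambda>\<omega>. exp (\<xi> \<omega>))"
  have exp_bds: "exp (\<xi> \<omega>) \<le> exp \<epsilon>" "exp (- \<epsilon>) \<le> exp (\<xi> \<omega>)" for \<omega>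
    using \<xi>[of \<omega>] by auto
  have int_exp: "integrable M (\<lambda>\<omega>. exp (\<xi> \<omega>))"
    by (rule integrable_const_bound[where B = "exp \<epsilon>"]) (use exp_bds in auto)
  have int_eX: "integrable M (\<lambda>\<omega>. exp (\<xi> \<omega>) *\<^sub>R X \<omega>)"
    by (rule integrable_const_bound[where B = "exp \<epsilon> * \<beta>"])
       (use exp_bds X nonneg in \<open>auto intro!: mult_mono\<close>)
  have I: "exp (- \<epsilon>) \<le> I"
    unfolding I_def by (intro integral_ge_const int_exp) (use exp_bds in auto)
  have I0: "0 < I"
    using I by (rule less_le_trans[rotated]) simp
  have \<mu>: "norm \<mu> \<le> \<beta>"
    unfolding \<mu>_def by (rule integral_norm_le_const) (use X in auto)
  have dev: "norm (X \<omega> - \<mu>) \<le> 2 * \<beta>" for \<omega>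
    using norm_triangle_ineq4[of "X \<omega>" \<mu>] X[of \<omega>] \<mu> by simp
  show \<Delta>: "norm \<Delta> \<le> 2 * \<beta> * \<epsilon>"
    unfolding \<Delta>_def
  proof (rule integral_norm_le_const)
    show "norm (\<xi> \<omega> *\<^sub>R (X \<omega> - \<mu>)) \<le> 2 * \<beta> * \<epsilon>" for \<omega>
      unfolding norm_scaleR real_norm_def
      using mult_mono[OF \<xi>[of \<omega>] dev[of \<omega>]] nonneg by (simp add: ac_simps)
  qed measurable
  have "norm (expectation (\<lambda>\<omega>. exp (\<xi> \<omega>) *\<^sub>R X \<omega>)) \<le> expectation (\<lambda>\<omega>. exp (\<xi> \<omega>) * \<beta>)"
  proof (rule order.trans[OF integral_norm_bound], rule integral_mono)
    show "norm (exp (\<xi> \<omega>) *\<^sub>R X \<omega>) \<le> exp (\<xi> \<omega>) * \<beta>" for \<omega>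
      using X by simp
  qed (use int_exp integrable_norm[OF int_eX] in auto)
  then have "norm (expectation (\<lambda>\<omega>. exp (\<xi> \<omega>) *\<^sub>R X \<omega>)) \<le> I * \<beta>"
    by (simp add: I_def)
  then show \<mu>': "norm \<mu>' \<le> \<beta>"
    unfolding \<mu>'_def I_def[symmetric] using I0 by (simp add: field_simps)
  have diff: "norm (\<mu>' - \<mu>) \<le> 2 * \<beta>"
    using norm_triangle_ineq4[of \<mu>' \<mu>] \<mu> \<mu>' by simp
  show main: "norm (\<mu>' - \<mu> - \<Delta>) \<le> 18 * \<beta> * \<epsilon>\<^sup>2"
  proof (cases "\<epsilon> \<le> 1")
    case False
    have "norm (\<mu>' - \<mu> - \<Delta>) \<le> 2 * \<beta> + 2 * \<beta> * \<epsilon>"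
      using norm_triangle_ineq4[of "\<mu>' - \<mu>" \<Delta>] diff \<Delta> by simp
    also have "\<dots> = 2 * \<beta> * (1 + \<epsilon>)"
      by (simp add: algebra_simps)
    also have "\<dots> \<le> 2 * \<beta> * (9 * \<epsilon>\<^sup>2)"
    proof (rule mult_left_mono)
      have "\<epsilon> \<le> \<epsilon>\<^sup>2"
        using False by (simp add: power2_eq_square)
      moreover have "1 \<le> \<epsilon>\<^sup>2"
        using False by (intro one_le_power) simp
      ultimately show "1 + \<epsilon> \<le> 9 * \<epsilon>\<^sup>2"
        by linarith
    qed (use nonneg in simp)
    finally show ?thesis
      by simp
  next
    case True
    have small: "\<bar>\<xi> \<omega>\<bar> \<le> 1" for \<omega>
      using \<xi>[of \<omega>] True by simp
    have sq: "(\<xi> \<omega>)\<^sup>2 \<le> \<epsilon>\<^sup>2" for \<omega>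
      using \<xi>[of \<omega>] nonneg by (metis abs_ge_zero power2_abs power_mono)
    define rem where "rem = expectation (\<lambda>\<omega>. (exp (\<xi> \<omega>) - 1 - \<xi> \<omega>) *\<^sub>R (X \<omega> - \<mu>))"
    have rem_pt: "norm ((exp (\<xi> \<omega>) - 1 - \<xi> \<omega>) *\<^sub>R (X \<omega> - \<mu>)) \<le> \<epsilon>\<^sup>2 * (2 * \<beta>)" for \<omega>
      unfolding norm_scaleR real_norm_def
      by (intro mult_mono dev order.trans[OF exp_quadratic_error[OF small] sq]) auto
    have rem: "norm rem \<le> \<epsilon>\<^sup>2 * (2 * \<beta>)"
      unfolding rem_def by (rule integral_norm_le_const[OF _ rem_pt]) measurable
    have int_rem: "integrable M (\<lambda>\<omega>. (exp (\<xi> \<omega>) - 1 - \<xi> \<omega>) *\<^sub>R (X \<omega> - \<mu>))"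
      by (rule integrable_const_bound[where B = "\<epsilon>\<^sup>2 * (2 * \<beta>)"]) (use rem_pt in auto)
    have int_X: "integrable M X"
      by (rule integrable_const_bound[where B = \<beta>]) (use X in auto)
    have int_\<Delta>: "integrable M (\<lambda>\<omega>. \<xi> \<omega> *\<^sub>R (X \<omega> - \<mu>))"
      by (rule integrable_const_bound[where B = "\<epsilon> * (2 * \<beta>)"])
         (use \<xi> dev nonneg in \<open>auto intro!: mult_mono\<close>)
    have "I *\<^sub>R (\<mu>' - \<mu>) = expectation (\<lambda>\<omega>. exp (\<xi> \<omega>) *\<^sub>R (X \<omega> - \<mu>))"
    proof -
      have "I *\<^sub>R \<mu>' = expectation (\<lambda>\<omega>. exp (\<xi> \<omega>) *\<^sub>R X \<omega>)"
        using I0 by (simp add: \<mu>'_def I_def[symmetric])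
      then show ?thesis
        using int_eX int_exp by (simp add: scaleR_diff_right I_def)
    qed
    also have "\<dots> = expectation (\<lambda>\<omega>. (X \<omega> - \<mu>) + (\<xi> \<omega> *\<^sub>R (X \<omega> - \<mu>) + (exp (\<xi> \<omega>) - 1 - \<xi> \<omega>) *\<^sub>R (X \<omega> - \<mu>)))"
      by (intro Bochner_Integration.integral_cong refl) (simp add: algebra_simps)
    also have "\<dots> = expectation (\<lambda>\<omega>. X \<omega> - \<mu>) + (\<Delta> + rem)"
      unfolding \<Delta>_def rem_def using int_X int_\<Delta> int_rem
      by (subst Bochner_Integration.integral_add) (auto simp del: Bochner_Integration.integral_diff)
    also have "expectation (\<lambda>\<omega>. X \<omega> - \<mu>) = 0"
      using int_X by (simp add: \<mu>_def prob_space)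
    \<comment> \<open>Multiplying by the normaliser \<open>I\<close> leaves two second-order terms,
      of norm at most \<open>4 * \<beta> * \<epsilon>\<^sup>2\<close> and
      \<open>2 * \<beta> * \<epsilon>\<^sup>2\<close>.\<close>
    finally have "I *\<^sub>R (\<mu>' - \<mu> - \<Delta>) = (1 - I) *\<^sub>R \<Delta> + rem"
      by (simp add: algebra_simps)
    then have "I * norm (\<mu>' - \<mu> - \<Delta>) = norm ((1 - I) *\<^sub>R \<Delta> + rem)"
      using I0 by (metis abs_of_pos norm_scaleR)
    also have "\<dots> \<le> \<bar>1 - I\<bar> * norm \<Delta> + norm rem"
      by (rule order.trans[OF norm_triangle_ineq]) simp
    also have "\<bar>1 - I\<bar> \<le> 2 * \<epsilon>"
    proof -
      have "\<bar>expectation (\<lambda>\<omega>. exp (\<xi> \<omega>) - 1)\<bar> \<le> 2 * \<epsilon>"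
      proof (rule integral_norm_le_const[of "\<lambda>\<omega>. exp (\<xi> \<omega>) - 1", unfolded real_norm_def])
        fix \<omega>
        have "\<bar>exp (\<xi> \<omega>) - 1\<bar> \<le> \<bar>\<xi> \<omega>\<bar> + (\<xi> \<omega>)\<^sup>2"
          using exp_quadratic_error[OF small[of \<omega>]] by linarith
        also have "(\<xi> \<omega>)\<^sup>2 \<le> \<bar>\<xi> \<omega>\<bar>"
          using small[of \<omega>] by (metis abs_ge_zero mult_left_le power2_abs power2_eq_square)
        finally show "\<bar>exp (\<xi> \<omega>) - 1\<bar> \<le> 2 * \<epsilon>"
          using \<xi>[of \<omega>] by simp
      qed measurable
      then show ?thesis
        using int_exp by (simp add: I_def prob_space abs_minus_commute)
    qed
    finally have "I * norm (\<mu>' - \<mu> - \<Delta>) \<le> 2 * \<epsilon> * (2 * \<beta> * \<epsilon>) + \<epsilon>\<^sup>2 * (2 * \<beta>)"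
      using \<Delta> rem nonneg by (smt (verit) mult_mono norm_ge_zero abs_ge_zero mult_right_mono mult_left_mono)
    \<comment> \<open>Dividing by \<open>I \<ge> exp (- 1) \<ge> 1 / 3\<close> turns the factor 6
      into 18.\<close>
    moreover have "1 / 3 \<le> I"
    proof -
      have "exp (- \<epsilon>) \<ge> exp (- 1)"
        using True by simp
      moreover have "exp (- 1 :: real) \<ge> 1 / 3"
        using exp_le by (simp add: exp_minus field_simps)
      ultimately show ?thesis
        using I by linarith
    qed
    ultimately have "1 / 3 * norm (\<mu>' - \<mu> - \<Delta>) \<le> 2 * \<epsilon> * (2 * \<beta> * \<epsilon>) + \<epsilon>\<^sup>2 * (2 * \<beta>)"
      by (meson mult_right_mono norm_ge_zero order.trans)
    then show ?thesis
      by (simp add: power2_eq_square algebra_simps)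
  qed
  show "norm (\<mu>' - \<mu>) \<le> 20 * \<beta> * \<epsilon>"
  proof (cases "\<epsilon> \<le> 1")
    case True
    have "norm (\<mu>' - \<mu>) \<le> 18 * \<beta> * \<epsilon>\<^sup>2 + 2 * \<beta> * \<epsilon>"
      using norm_triangle_ineq[of "\<mu>' - \<mu> - \<Delta>" \<Delta>] main \<Delta> by simp
    also have "18 * \<beta> * \<epsilon>\<^sup>2 \<le> 18 * \<beta> * \<epsilon>"
      using True nonneg by (intro mult_left_mono) (auto simp: power2_eq_square mult_left_le)
    finally show ?thesis
      by simp
  next
    case False
    then have "2 * \<beta> * 1 \<le> 20 * \<beta> * \<epsilon>"
      using nonneg by (intro mult_mono) auto
    then show ?thesis
      using diff by simp
  qed
qed

text \<open>Reduction to the unweighted case: \<open>W / f\<close> is a probability density, and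
  under the measure with this density the weighted expectations become plain ones.\<close>

lemma (in prob_space) weighted_exponential_tilt:
  fixes X :: "'a \<Rightarrow> 'b::euclidean_space" and \<xi> W :: "'a \<Rightarrow> real"
  assumes [measurable]: "X \<in> borel_measurable M" "\<xi> \<in> borel_measurable M" "W \<in> borel_measurable M"
    and W: "integrable M W" "\<And>\<omega>. 0 < W \<omega>"
    and X: "\<And>\<omega>. norm (X \<omega>) \<le> \<beta>" and \<xi>: "\<And>\<omega>. \<bar>\<xi> \<omega>\<bar> \<le> \<epsilon>" and nonneg: "0 \<le> \<beta>" "0 \<le> \<epsilon>"
  defines "f \<equiv> expectation W"
  defines "\<mu> \<equiv> expectation (\<lambda>\<omega>. W \<omega> *\<^sub>R X \<omega>) /\<^sub>R f"
    and "\<mu>' \<equiv> expectation (\<lambda>\<omega>. (W \<omega> * exp (\<xi> \<omega>)) *\<^sub>R X \<omega>) /\<^sub>R expectation (\<lambda>\<omega>. W \<omega> * exp (\<xi> \<omega>))"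
  defines "\<Delta> \<equiv> expectation (\<lambda>\<omega>. (W \<omega> * \<xi> \<omega>) *\<^sub>R (X \<omega> - \<mu>)) /\<^sub>R f"
  shows "0 < f" and "norm \<mu> \<le> \<beta>"
    and "norm \<Delta> \<le> 2 * \<beta> * \<epsilon>" and "norm (\<mu>' - \<mu> - \<Delta>) \<le> 18 * \<beta> * \<epsilon>\<^sup>2" and "norm (\<mu>' - \<mu>) \<le> 20 * \<beta> * \<epsilon>"
proof -
  show f: "0 < f"
  proof -
    have "W \<omega> \<noteq> 0" for \<omega>
      using W(2)[of \<omega>] by simp
    then have "f \<noteq> 0"
      unfolding f_def using W(1) by (subst integral_nonneg_eq_0_iff_AE) (auto simp: less_imp_le[OF W(2)])
    moreover have "0 \<le> f"
      unfolding f_def using W by (intro Bochner_Integration.integral_nonneg) (simp add: less_imp_le)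
    ultimately show ?thesis
      by simp
  qed
  define \<pi> where "\<pi> = density M (\<lambda>\<omega>. ennreal (W \<omega> / f))"
  have integral: "(\<integral>\<omega>. h \<omega> \<partial>\<pi>) = expectation (\<lambda>\<omega>. W \<omega> *\<^sub>R h \<omega>) /\<^sub>R f"
    if [measurable]: "h \<in> borel_measurable M" for h :: "'a \<Rightarrow> 'c::euclidean_space"
  proof -
    have "(\<integral>\<omega>. h \<omega> \<partial>\<pi>) = expectation (\<lambda>\<omega>. (W \<omega> / f) *\<^sub>R h \<omega>)"
      unfolding \<pi>_def using f W by (intro integral_density) (auto simp: less_imp_le)
    also have "\<dots> = expectation (\<lambda>\<omega>. inverse f *\<^sub>R (W \<omega> *\<^sub>R h \<omega>))"
      by (simp add: divide_inverse mult.commute)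
    finally show ?thesis
      by (simp only: integral_scaleR_right)
  qed
  interpret \<pi>: prob_space \<pi>
  proof
    have "emeasure \<pi> (space \<pi>) = (\<integral>\<^sup>+\<omega>. ennreal (W \<omega> / f) \<partial>M)"
      by (simp add: \<pi>_def emeasure_density)
    also have "\<dots> = ennreal (expectation (\<lambda>\<omega>. W \<omega> / f))"
      using W f by (intro nn_integral_eq_integral) (auto simp: less_imp_le)
    also have "\<dots> = 1"
      using f by (simp add: f_def)
    finally show "emeasure \<pi> (space \<pi>) = 1" .
  qed
  have \<pi>_meas: "h \<in> borel_measurable M \<Longrightarrow> h \<in> borel_measurable \<pi>" for h :: "'a \<Rightarrow> 'c::euclidean_space"
    by (simp add: \<pi>_def)
  have \<pi>_meas': "h \<in> borel_measurable M \<Longrightarrow> h \<in> borel_measurable \<pi>" for h :: "'a \<Rightarrow> real"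
    by (simp add: \<pi>_def)
  have Xm: "X \<in> borel_measurable \<pi>"
    by (simp add: \<pi>_def)
  have 1: "\<pi>.expectation X = \<mu>"
    unfolding \<mu>_def by (rule integral) measurable
  have 2: "\<pi>.expectation (\<lambda>\<omega>. exp (\<xi> \<omega>) *\<^sub>R X \<omega>) /\<^sub>R \<pi>.expectation (\<lambda>\<omega>. exp (\<xi> \<omega>)) = \<mu>'"
    unfolding \<mu>'_def using f by (subst (1 2) integral) (auto simp: field_simps)
  have 3: "\<pi>.expectation (\<lambda>\<omega>. \<xi> \<omega> *\<^sub>R (X \<omega> - \<mu>)) = \<Delta>"
    unfolding \<Delta>_def by (subst integral) auto
  note tilt = \<pi>.exponential_tilt[OF Xm \<pi>_meas'[OF assms(2)] X \<xi> nonneg, unfolded 1, unfolded 2 3]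
  show "norm \<mu> \<le> \<beta>"
    unfolding 1[symmetric] by (rule \<pi>.integral_norm_le_const[OF Xm X])
  show "norm \<Delta> \<le> 2 * \<beta> * \<epsilon>" "norm (\<mu>' - \<mu> - \<Delta>) \<le> 18 * \<beta> * \<epsilon>\<^sup>2" "norm (\<mu>' - \<mu>) \<le> 20 * \<beta> * \<epsilon>"
    by (rule tilt)+
qed

section \<open>The conditional mean under Gaussian smoothing\<close>

text \<open>\<open>S\<close> is the covariance operator of \<open>X\<close> and \<open>A\<close> its inverse. Of the centred Gaussian law \<open>\<gamma>\<close> with
  covariance \<open>n\<close> times \<open>S\<close> only the Cameron-Martin formula and its moments enter.\<close>

locale gaussian_smoothing = prob_space M + \<gamma>: prob_space \<gamma>
  for M :: "'a measure" and \<gamma> :: "'v::euclidean_space measure" +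
  fixes S A :: "'v \<Rightarrow> 'v" and X :: "'a \<Rightarrow> 'v" and \<beta> s n R :: real
  assumes linear_S: "linear S" and linear_A: "linear A"
    and SA: "\<And>x. S (A x) = x" and S_sym: "\<And>x y. S x \<bullet> y = x \<bullet> S y"
    and coercive: "\<And>x. s * (norm x)\<^sup>2 \<le> x \<bullet> S x" and s: "0 < s"
    and X_measurable [measurable]: "X \<in> borel_measurable M"
    and X_bound: "\<And>\<omega>. norm (X \<omega>) \<le> \<beta>"
    and X_mean: "\<And>a. expectation (\<lambda>\<omega>. a \<bullet> X \<omega>) = 0"
    and X_cov: "\<And>a b. expectation (\<lambda>\<omega>. (a \<bullet> X \<omega>) * (b \<bullet> X \<omega>)) = a \<bullet> S b"
    and n: "5 * \<beta>\<^sup>2 / s \<le> n" "0 < n"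
    and R: "0 \<le> R" "R\<^sup>2 \<le> 5 / 4"
    and sets_\<gamma> [measurable_cong, simp]: "sets \<gamma> = sets borel"
    and shift: "\<And>a. distr \<gamma> borel (\<lambda>z. z + a) = density \<gamma> (\<lambda>z. ennreal (exp (A a \<bullet> z / n - a \<bullet> A a / (2 * n))))"
    and \<gamma>_mean: "\<And>a. (\<integral>z. a \<bullet> z \<partial>\<gamma>) = 0"
    and \<gamma>_trace: "(\<integral>z. (norm z)\<^sup>2 \<partial>\<gamma>) = n * (\<Sum>b\<in>Basis. b \<bullet> S b)"
    and \<gamma>_exp: "\<And>b. integrable \<gamma> (\<lambda>z. exp (b \<bullet> z))"
begin

lemma \<beta>_nonneg: "0 \<le> \<beta>"
  using X_bound[of undefined] norm_ge_zero order.trans by blast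

lemma A_sym: "A x \<bullet> y = x \<bullet> A y"
  using S_sym[of "A x" "A y"] by (simp add: SA)

lemma norm_A: "norm (A x) \<le> norm x / s"
proof -
  have "s * (norm (A x))\<^sup>2 \<le> A x \<bullet> x"
    using coercive[of "A x"] by (simp add: SA)
  also have "\<dots> \<le> norm (A x) * norm x"
    by (rule norm_cauchy_schwarz)
  finally have "norm (A x) * (s * norm (A x)) \<le> norm (A x) * norm x"
    by (simp add: power2_eq_square algebra_simps)
  then have "s * norm (A x) \<le> norm x"
    by (cases "A x = 0") simp_all
  then show ?thesis
    using s by (simp add: field_simps)
qed

lemma A_nonneg: "0 \<le> x \<bullet> A x"
proof -
  have "0 \<le> s * (norm (A x))\<^sup>2"
    using s by simp
  also have "\<dots> \<le> A x \<bullet> S (A x)"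
    by (rule coercive)
  finally show ?thesis
    by (simp add: SA inner_commute)
qed

definition c where "c = \<beta> / s"

lemma c_nonneg: "0 \<le> c"
  using \<beta>_nonneg s by (simp add: c_def)

text \<open>The lower bound on \<open>n\<close> in the form needed for the contraction constant of
  the flow and for the exponent in \<open>exponential_pair_bound\<close>.\<close>

lemma \<beta>c: "\<beta> * c \<le> n / 5"
  using n s by (simp add: c_def power2_eq_square field_simps)

lemma AX_bound: "norm (A (X \<omega>)) \<le> c"
  using norm_A[of "X \<omega>"] X_bound[of \<omega>] s by (simp add: c_def divide_right_mono order.trans)

lemma AX_inner_bound: "\<bar>A (X \<omega>) \<bullet> u\<bar> \<le> c * norm u"
  using Cauchy_Schwarz_ineq2[of "A (X \<omega>)" u] AX_bound[of \<omega>] by (meson mult_right_mono norm_ge_zero order.trans)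

lemma XAX_bound: "X \<omega> \<bullet> A (X \<omega>) \<le> \<beta> * c"
proof -
  have "X \<omega> \<bullet> A (X \<omega>) \<le> norm (X \<omega>) * norm (A (X \<omega>))"
    by (rule norm_cauchy_schwarz)
  also have "\<dots> \<le> \<beta> * c"
    using \<beta>_nonneg by (intro mult_mono X_bound AX_bound) auto
  finally show ?thesis .
qed

lemma A_measurable [measurable]: "A \<in> borel_measurable borel"
  using linear_A by (intro borel_measurable_continuous_onI linear_continuous_on)
    (simp add: linear_conv_bounded_linear)

text \<open>The Cameron-Martin density at \<open>u\<close> of \<gamma> translated by
  \<open>r *\<^sub>R x\<close>, with the powers of \<open>r\<close> pulled out.\<close>

definition weight :: "real \<Rightarrow> 'v \<Rightarrow> 'v \<Rightarrow> real" where
  "weight r x u = exp (r * (A x \<bullet> u) / n - r\<^sup>2 * (x \<bullet> A x) / (2 * n))"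

lemma weight_pos: "0 < weight r x u"
  by (simp add: weight_def)

lemma weight_measurable [measurable (raw)]:
  assumes [measurable]: "f \<in> borel_measurable N" "g \<in> borel_measurable N"
  shows "(\<lambda>\<omega>. weight r (f \<omega>) (g \<omega>)) \<in> borel_measurable N"
  unfolding weight_def by measurable

lemma weight_bound: "weight r (X \<omega>) u \<le> exp (\<bar>r\<bar> * c / n * norm u)"
proof -
  have "r * (A (X \<omega>) \<bullet> u) \<le> \<bar>r\<bar> * (c * norm u)"
    by (rule order.trans[OF abs_ge_self], unfold abs_mult, intro mult_left_mono AX_inner_bound) simp
  then have "r * (A (X \<omega>) \<bullet> u) / n \<le> \<bar>r\<bar> * (c * norm u) / n"
    using n by (intro divide_right_mono) auto
  moreover have "0 \<le> r\<^sup>2 * (X \<omega> \<bullet> A (X \<omega>)) / (2 * n)"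
    using n A_nonneg by simp
  ultimately show ?thesis
    by (simp add: weight_def)
qed

lemma integrable_weight: "integrable M (\<lambda>\<omega>. weight r (X \<omega>) u)"
  by (rule integrable_const_bound[where B = "exp (\<bar>r\<bar> * c / n * norm u)"])
     (use weight_bound weight_pos in \<open>auto simp: less_imp_le\<close>)

lemma integrable_weight_scaleR:
  fixes h :: "'a \<Rightarrow> 'b::euclidean_space"
  assumes [measurable]: "h \<in> borel_measurable M" and h: "\<And>\<omega>. norm (h \<omega>) \<le> B"
  shows "integrable M (\<lambda>\<omega>. weight r (X \<omega>) u *\<^sub>R h \<omega>)"
proof (rule Bochner_Integration.integrable_bound)
  show "integrable M (\<lambda>\<omega>. weight r (X \<omega>) u * B)"
    by (intro integrable_mult_left integrable_weight)
  have "0 \<le> B"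
    using h[of undefined] norm_ge_zero order.trans by blast
  then show "AE \<omega> in M. norm (weight r (X \<omega>) u *\<^sub>R h \<omega>) \<le> norm (weight r (X \<omega>) u * B)"
    using h by (intro AE_I2) (simp add: abs_mult mult_left_mono)
qed measurable

text \<open>By the Cameron-Martin formula, \<open>mass r\<close> is the density of the law of \<open>Z + r *\<^sub>R X\<close> with respect to
  the law \<open>\<gamma>\<close> of \<open>Z\<close>, and \<open>drift r\<close> is the conditional mean of \<open>X\<close> given \<open>Z + r *\<^sub>R X\<close>.\<close>

definition mass where "mass r u = expectation (\<lambda>\<omega>. weight r (X \<omega>) u)"
definition drift where "drift r u = expectation (\<lambda>\<omega>. weight r (X \<omega>) u *\<^sub>R X \<omega>) /\<^sub>R mass r u"
text \<open>Derivative of \<open>drift r\<close> at \<open>u\<close> in direction \<open>a\<close>: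
  the covariance, under the weighted law, of \<open>X\<close> with the change of the exponent of the
  weight.\<close>

definition drift_deriv where "drift_deriv r u a =
  expectation (\<lambda>\<omega>. (weight r (X \<omega>) u * (r * (A (X \<omega>) \<bullet> a) / n)) *\<^sub>R (X \<omega> - drift r u)) /\<^sub>R mass r u"

text \<open>A change of \<open>r\<close> or \<open>u\<close> multiplies the weight by an exponential
  \<open>exp (\<xi> \<omega>)\<close>, so regularity in space and regularity in time are instances
  of one tilting estimate.\<close>

lemma drift_tilt:
  assumes [measurable]: "\<xi> \<in> borel_measurable M" and \<xi>: "\<And>\<omega>. \<bar>\<xi> \<omega>\<bar> \<le> \<epsilon>"
    and eq: "\<And>\<omega>. weight r' (X \<omega>) u' = weight r (X \<omega>) u * exp (\<xi> \<omega>)"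
  defines "\<Delta> \<equiv> expectation (\<lambda>\<omega>. (weight r (X \<omega>) u * \<xi> \<omega>) *\<^sub>R (X \<omega> - drift r u)) /\<^sub>R mass r u"
  shows "0 < mass r u" and "norm (drift r u) \<le> \<beta>"
    and "norm \<Delta> \<le> 2 * \<beta> * \<epsilon>" and "norm (drift r' u' - drift r u - \<Delta>) \<le> 18 * \<beta> * \<epsilon>\<^sup>2"
    and "norm (drift r' u' - drift r u) \<le> 20 * \<beta> * \<epsilon>"
proof -
  have "0 \<le> \<epsilon>"
    using \<xi>[of undefined] abs_ge_zero order.trans by blast
  note tilt = weighted_exponential_tilt[of X \<xi> "\<lambda>\<omega>. weight r (X \<omega>) u" \<beta> \<epsilon>, OF _ _ _ integrable_weight
      weight_pos X_bound \<xi> \<beta>_nonneg \<open>0 \<le> \<epsilon>\<close>, folded eq, folded mass_def, folded drift_def]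
  show "0 < mass r u" "norm (drift r u) \<le> \<beta>" "norm \<Delta> \<le> 2 * \<beta> * \<epsilon>"
    "norm (drift r' u' - drift r u - \<Delta>) \<le> 18 * \<beta> * \<epsilon>\<^sup>2"
    "norm (drift r' u' - drift r u) \<le> 20 * \<beta> * \<epsilon>"
    unfolding \<Delta>_def by (rule tilt; measurable)+
qed

lemma mass_pos: "0 < mass r u" and norm_drift: "norm (drift r u) \<le> \<beta>"
proof -
  note tilt = drift_tilt[where \<xi> = "\<lambda>_. 0" and \<epsilon> = 0 and r = r and u = u and r' = r and u' = u]
  show "0 < mass r u"
    by (rule tilt(1)) simp_all
  show "norm (drift r u) \<le> \<beta>"
    by (rule tilt(2)) simp_all
qed

text \<open>\<open>K\<close> bounds the tilting exponent per unit of displacement in space;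
  \<open>C\<close> is \<open>20 * \<beta>\<close> times the corresponding constant for a
  displacement in time.\<close>

definition K where "K = R * c / n"
definition C where "C = 20 * \<beta> * ((c + R * \<beta> * c) / n)"

lemma K_nonneg: "0 \<le> K"
  using R c_nonneg n by (simp add: K_def)

lemma drift_expansion:
  assumes r: "r \<in> {0..R}"
  shows "norm (drift_deriv r u a) \<le> 2 * \<beta> * K * norm a"
    and "norm (drift r (u + a) - drift r u - drift_deriv r u a) \<le> 18 * \<beta> * K\<^sup>2 * (norm a)\<^sup>2"
proof -
  have bound: "\<bar>r * (A (X \<omega>) \<bullet> a) / n\<bar> \<le> K * norm a" for \<omega>
  proof -
    have "\<bar>r * (A (X \<omega>) \<bullet> a)\<bar> \<le> R * (c * norm a)"
      unfolding abs_mult using r R by (intro mult_mono AX_inner_bound) auto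
    then show ?thesis
      using n by (simp add: K_def abs_divide divide_right_mono mult.assoc)
  qed
  have eq: "weight r (X \<omega>) (u + a) = weight r (X \<omega>) u * exp (r * (A (X \<omega>) \<bullet> a) / n)" for \<omega>
    by (simp add: weight_def exp_add[symmetric] inner_add_right add_divide_distrib algebra_simps)
  note tilt = drift_tilt[OF _ bound eq, folded drift_deriv_def]
  show "norm (drift_deriv r u a) \<le> 2 * \<beta> * K * norm a"
    using tilt(3) by (simp add: mult.assoc)
  show "norm (drift r (u + a) - drift r u - drift_deriv r u a) \<le> 18 * \<beta> * K\<^sup>2 * (norm a)\<^sup>2"
    using tilt(4) by (simp add: mult.assoc power_mult_distrib)
qed

lemma linear_drift_deriv: "linear (drift_deriv r u)"
proof -
  have int: "integrable M (\<lambda>\<omega>. (weight r (X \<omega>) u * (r * (A (X \<omega>) \<bullet> a) / n)) *\<^sub>R (X \<omega> - drift r u))" for a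
  proof -
    have "integrable M (\<lambda>\<omega>. weight r (X \<omega>) u *\<^sub>R ((r * (A (X \<omega>) \<bullet> a) / n) *\<^sub>R (X \<omega> - drift r u)))"
    proof (rule integrable_weight_scaleR)
      fix \<omega>
      have "norm (X \<omega> - drift r u) \<le> 2 * \<beta>"
        using norm_triangle_ineq4[of "X \<omega>" "drift r u"] X_bound[of \<omega>] norm_drift[of r u] by simp
      moreover have "\<bar>r * (A (X \<omega>) \<bullet> a) / n\<bar> \<le> \<bar>r\<bar> * (c * norm a) / n"
        using AX_inner_bound[of \<omega> a] n by (simp add: abs_mult abs_divide divide_right_mono mult_left_mono)
      ultimately show "norm ((r * (A (X \<omega>) \<bullet> a) / n) *\<^sub>R (X \<omega> - drift r u)) \<le> \<bar>r\<bar> * (c * norm a) / n * (2 * \<beta>)"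
        unfolding norm_scaleR real_norm_def using c_nonneg n by (intro mult_mono) auto
    qed measurable
    then show ?thesis
      by simp
  qed
  have add: "(weight r (X \<omega>) u * (r * (A (X \<omega>) \<bullet> (a + b)) / n)) *\<^sub>R (X \<omega> - drift r u)
      = (weight r (X \<omega>) u * (r * (A (X \<omega>) \<bullet> a) / n)) *\<^sub>R (X \<omega> - drift r u)
      + (weight r (X \<omega>) u * (r * (A (X \<omega>) \<bullet> b) / n)) *\<^sub>R (X \<omega> - drift r u)" for a b \<omega>
  proof -
    have "w * (r * (q + q') / n) = w * (r * q / n) + w * (r * q' / n)" for w q q'
      by (simp add: distrib_left add_divide_distrib)
    then show ?thesis
      by (simp only: inner_add_right scaleR_add_left)
  qed
  have scale: "(weight r (X \<omega>) u * (r * (A (X \<omega>) \<bullet> (t *\<^sub>R a)) / n)) *\<^sub>R (X \<omega> - drift r u)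
      = t *\<^sub>R ((weight r (X \<omega>) u * (r * (A (X \<omega>) \<bullet> a) / n)) *\<^sub>R (X \<omega> - drift r u))" for a t \<omega>
  proof -
    have "w * (r * (t * q) / n) = t * (w * (r * q / n))" for w q
      by simp
    then show ?thesis
      by (simp only: scaleR_scaleR inner_scaleR_right)
  qed
  show ?thesis
  proof (rule linearI)
    show "drift_deriv r u (a + b) = drift_deriv r u a + drift_deriv r u b" for a b
      unfolding drift_deriv_def add by (simp only: Bochner_Integration.integral_add[OF int int] scaleR_add_right)
    show "drift_deriv r u (t *\<^sub>R a) = t *\<^sub>R drift_deriv r u a" for t a
      unfolding drift_deriv_def scale by (simp only: integral_scaleR_right scaleR_left_commute)
  qed
qed

lemma drift_time_lipschitz:
  assumes "r \<in> {0..R}" "r' \<in> {0..R}"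
  shows "norm (drift r' u - drift r u) \<le> C * (1 + norm u) * \<bar>r' - r\<bar>"
proof -
  \<comment> \<open>The first term is linear in \<open>u\<close>, which causes the growth factor
    \<open>1 + norm u\<close>; the term quadratic in time is Lipschitz since
    \<open>r' + r \<le> 2 * R\<close>.\<close>
  define \<xi> where "\<xi> \<omega> = (r' - r) * (A (X \<omega>) \<bullet> u) / n - (r'\<^sup>2 - r\<^sup>2) * (X \<omega> \<bullet> A (X \<omega>)) / (2 * n)" for \<omega>
  have bound: "\<bar>\<xi> \<omega>\<bar> \<le> (c + R * \<beta> * c) / n * (1 + norm u) * \<bar>r' - r\<bar>" for \<omega>
  proof -
    have 1: "\<bar>(r' - r) * (A (X \<omega>) \<bullet> u)\<bar> \<le> \<bar>r' - r\<bar> * (c * norm u)"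
      unfolding abs_mult by (intro mult_left_mono AX_inner_bound) simp
    have "\<bar>r'\<^sup>2 - r\<^sup>2\<bar> = \<bar>r' - r\<bar> * (r' + r)"
      using assms by (simp add: power2_eq_square square_diff_square_factored abs_mult mult.commute)
    then have "\<bar>(r'\<^sup>2 - r\<^sup>2) * (X \<omega> \<bullet> A (X \<omega>))\<bar> \<le> (\<bar>r' - r\<bar> * (2 * R)) * (\<beta> * c)"
      unfolding abs_mult using assms A_nonneg[of "X \<omega>"] XAX_bound[of \<omega>] R
      by (intro mult_mono) (auto intro!: mult_left_mono)
    then have 2: "\<bar>(r'\<^sup>2 - r\<^sup>2) * (X \<omega> \<bullet> A (X \<omega>)) / 2\<bar> \<le> \<bar>r' - r\<bar> * (R * \<beta> * c)"
      by (simp add: algebra_simps)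
    have "\<xi> \<omega> = ((r' - r) * (A (X \<omega>) \<bullet> u) - (r'\<^sup>2 - r\<^sup>2) * (X \<omega> \<bullet> A (X \<omega>)) / 2) / n"
      by (simp add: \<xi>_def diff_divide_distrib)
    then have "\<bar>\<xi> \<omega>\<bar> = \<bar>(r' - r) * (A (X \<omega>) \<bullet> u) - (r'\<^sup>2 - r\<^sup>2) * (X \<omega> \<bullet> A (X \<omega>)) / 2\<bar> / n"
      using n by (simp add: abs_divide)
    also have "\<dots> \<le> (\<bar>r' - r\<bar> * (c * norm u) + \<bar>r' - r\<bar> * (R * \<beta> * c)) / n"
      using 1 2 n by (intro divide_right_mono order.trans[OF abs_triangle_ineq4] add_mono) auto
    also have "\<dots> \<le> (\<bar>r' - r\<bar> * (c + R * \<beta> * c) * (1 + norm u)) / n"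
    proof (rule divide_right_mono)
      have "0 \<le> \<bar>r' - r\<bar> * (c + R * \<beta> * c * norm u)"
        using c_nonneg R \<beta>_nonneg by simp
      then show "\<bar>r' - r\<bar> * (c * norm u) + \<bar>r' - r\<bar> * (R * \<beta> * c) \<le> \<bar>r' - r\<bar> * (c + R * \<beta> * c) * (1 + norm u)"
        by (simp add: algebra_simps)
    qed (use n in simp)
    finally show ?thesis
      by (simp add: mult.commute mult.left_commute)
  qed
  have eq: "weight r' (X \<omega>) u = weight r (X \<omega>) u * exp (\<xi> \<omega>)" for \<omega>
    by (simp add: weight_def \<xi>_def exp_add[symmetric] diff_divide_distrib add_divide_distrib algebra_simps)
  have "\<xi> \<in> borel_measurable M"
    unfolding \<xi>_def by measurable
  from drift_tilt(5)[OF this bound eq] show ?thesis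
    by (simp add: C_def mult.assoc)
qed

text \<open>The detour through the derivative gives the factor 2 where \<open>drift_tilt\<close>
  gives 20. With 20, the product of the Lipschitz constant and \<open>R\<close> would only be
  bounded by 5, while it has to stay below 1.\<close>

lemma drift_lipschitz:
  assumes r: "r \<in> {0..R}"
  shows "norm (drift r u - drift r v) \<le> 2 * \<beta> * K * norm (u - v)"
proof (rule differentiable_bound)
  show "(drift r has_derivative drift_deriv r x) (at x within UNIV)" for x
    using drift_expansion(2)[OF r] by (intro has_derivative_if_quadratic_error linear_drift_deriv) auto
  show "onorm (drift_deriv r x) \<le> 2 * \<beta> * K" for x
    by (rule onorm_le) (rule drift_expansion(1)[OF r])
qed auto

sublocale bounded_flow drift R \<beta> "2 * \<beta> * K" C "18 * \<beta> * K\<^sup>2"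
proof
  show "2 * \<beta> * K * R < 1"
  proof -
    have "2 * \<beta> * K * R = 2 * R\<^sup>2 * (\<beta> * c) / n"
      by (simp add: K_def power2_eq_square)
    \<comment> \<open>By \<open>R\<^sup>2 \<le> 5 / 4\<close> and
      \<open>\<beta> * c \<le> n / 5\<close> the product is at most 1/2.\<close>
    also have "\<dots> \<le> 2 * (5 / 4) * (n / 5) / n"
      using R \<beta>c \<beta>_nonneg c_nonneg n by (intro divide_right_mono mult_mono) auto
    also have "\<dots> < 1"
      using n by simp
    finally show ?thesis .
  qed
  show "0 \<le> C"
    using \<beta>_nonneg c_nonneg R n by (simp add: C_def)
  show "\<exists>D. linear D \<and> (\<forall>a. norm (D a) \<le> 2 * \<beta> * K * norm a) \<and>
      (\<forall>a. norm (drift r (u + a) - drift r u - D a) \<le> 18 * \<beta> * K\<^sup>2 * (norm a)\<^sup>2)" if "r \<in> {0..R}" for r u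
    using drift_expansion[OF that] linear_drift_deriv by blast
qed (use R \<beta>_nonneg K_nonneg norm_drift drift_lipschitz drift_time_lipschitz in auto)

end

context gaussian_smoothing
begin

section \<open>The joint law of Z + r X and X on the product space\<close>

sublocale pair: pair_prob_space \<gamma> M ..

lemma sets_pair [measurable_cong]: "sets (\<gamma> \<Otimes>\<^sub>M M) = sets (borel \<Otimes>\<^sub>M M)"
  by (intro sets_pair_measure_cong) simp_all

lemma space_\<gamma> [simp]: "space \<gamma> = UNIV"
  using sets_eq_imp_space_eq[OF sets_\<gamma>] by simp

lemma weight_conv_shift: "weight r x z = exp (A (r *\<^sub>R x) \<bullet> z / n - (r *\<^sub>R x) \<bullet> A (r *\<^sub>R x) / (2 * n))"
  by (simp add: weight_def linear_scale[OF linear_A] power2_eq_square mult.assoc)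

text \<open>For fixed \<omega> this is the Cameron-Martin formula with shift
  \<open>r *\<^sub>R X \<omega>\<close>. Keeping \<omega> as second coordinate makes
  \<open>weight\<close> the density of the joint law with respect to the product measure, after
  which conditioning on Z + r X is a matter of Fubini.\<close>

lemma nn_integral_joint_shift:
  assumes [measurable]: "F \<in> borel_measurable (borel \<Otimes>\<^sub>M M)"
  shows "(\<integral>\<^sup>+p. F (fst p + r *\<^sub>R X (snd p), snd p) \<partial>(\<gamma> \<Otimes>\<^sub>M M))
    = (\<integral>\<^sup>+p. ennreal (weight r (X (snd p)) (fst p)) * F p \<partial>(\<gamma> \<Otimes>\<^sub>M M))"
proof -
  have "(\<integral>\<^sup>+p. F (fst p + r *\<^sub>R X (snd p), snd p) \<partial>(\<gamma> \<Otimes>\<^sub>M M))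
      = (\<integral>\<^sup>+\<omega>. \<integral>\<^sup>+z. F (z + r *\<^sub>R X \<omega>, \<omega>) \<partial>\<gamma> \<partial>M)"
    by (subst pair.nn_integral_snd[symmetric]) simp_all
  also have "\<dots> = (\<integral>\<^sup>+\<omega>. \<integral>\<^sup>+z. ennreal (weight r (X \<omega>) z) * F (z, \<omega>) \<partial>\<gamma> \<partial>M)"
  proof (rule nn_integral_cong)
    fix \<omega> assume \<omega>: "\<omega> \<in> space M"
    then have [measurable]: "(\<lambda>z. F (z, \<omega>)) \<in> borel_measurable borel"
      by measurable
    have "(\<integral>\<^sup>+z. F (z + r *\<^sub>R X \<omega>, \<omega>) \<partial>\<gamma>) = (\<integral>\<^sup>+z. F (z, \<omega>) \<partial>distr \<gamma> borel (\<lambda>z. z + r *\<^sub>R X \<omega>))"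
      by (rule nn_integral_distr[symmetric]) measurable
    also have "\<dots> = (\<integral>\<^sup>+z. ennreal (weight r (X \<omega>) z) * F (z, \<omega>) \<partial>\<gamma>)"
      unfolding shift weight_conv_shift by (rule nn_integral_density) measurable
    finally show "(\<integral>\<^sup>+z. F (z + r *\<^sub>R X \<omega>, \<omega>) \<partial>\<gamma>) = (\<integral>\<^sup>+z. ennreal (weight r (X \<omega>) z) * F (z, \<omega>) \<partial>\<gamma>)" .
  qed
  also have "\<dots> = (\<integral>\<^sup>+p. ennreal (weight r (X (snd p)) (fst p)) * F p \<partial>(\<gamma> \<Otimes>\<^sub>M M))"
    by (subst pair.nn_integral_snd[symmetric]) simp_all
  finally show ?thesis .
qed

lemma distr_joint_shift:
  "distr (\<gamma> \<Otimes>\<^sub>M M) (borel \<Otimes>\<^sub>M M) (\<lambda>p. (fst p + r *\<^sub>R X (snd p), snd p))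
    = density (\<gamma> \<Otimes>\<^sub>M M) (\<lambda>p. ennreal (weight r (X (snd p)) (fst p)))"
proof (rule measure_eqI)
  fix B assume "B \<in> sets (distr (\<gamma> \<Otimes>\<^sub>M M) (borel \<Otimes>\<^sub>M M) (\<lambda>p. (fst p + r *\<^sub>R X (snd p), snd p)))"
  then have B [measurable]: "B \<in> sets (borel \<Otimes>\<^sub>M M)"
    by simp
  then have "emeasure (distr (\<gamma> \<Otimes>\<^sub>M M) (borel \<Otimes>\<^sub>M M) (\<lambda>p. (fst p + r *\<^sub>R X (snd p), snd p))) B
      = (\<integral>\<^sup>+p. indicator B p \<partial>distr (\<gamma> \<Otimes>\<^sub>M M) (borel \<Otimes>\<^sub>M M) (\<lambda>p. (fst p + r *\<^sub>R X (snd p), snd p)))"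
    by simp
  also have "\<dots> = (\<integral>\<^sup>+p. indicator B (fst p + r *\<^sub>R X (snd p), snd p) \<partial>(\<gamma> \<Otimes>\<^sub>M M))"
    by (rule nn_integral_distr) measurable
  also have "\<dots> = (\<integral>\<^sup>+p. ennreal (weight r (X (snd p)) (fst p)) * indicator B p \<partial>(\<gamma> \<Otimes>\<^sub>M M))"
    by (rule nn_integral_joint_shift) measurable
  also have "\<dots> = emeasure (density (\<gamma> \<Otimes>\<^sub>M M) (\<lambda>p. ennreal (weight r (X (snd p)) (fst p)))) B"
    using B by (simp add: emeasure_density sets_pair)
  finally show "emeasure (distr (\<gamma> \<Otimes>\<^sub>M M) (borel \<Otimes>\<^sub>M M) (\<lambda>p. (fst p + r *\<^sub>R X (snd p), snd p))) B
      = emeasure (density (\<gamma> \<Otimes>\<^sub>M M) (\<lambda>p. ennreal (weight r (X (snd p)) (fst p)))) B" .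
qed (simp add: sets_pair)

text \<open>Used with \<open>v = drift r z\<close>, where it vanishes and gives the conditional mean
  property, and with \<open>v = \<kappa> *\<^sub>R z\<close>, where it writes \<open>mass\<close>
  times the velocity as an expectation without a quotient.\<close>

lemma drift_residual:
  "expectation (\<lambda>\<omega>. weight r (X \<omega>) z *\<^sub>R (X \<omega> - v)) = mass r z *\<^sub>R (drift r z - v)"
proof -
  have "expectation (\<lambda>\<omega>. weight r (X \<omega>) z *\<^sub>R (X \<omega> - v))
      = expectation (\<lambda>\<omega>. weight r (X \<omega>) z *\<^sub>R X \<omega>) - mass r z *\<^sub>R v"
    using integrable_weight_scaleR[OF X_measurable X_bound] integrable_weight
    by (simp add: scaleR_diff_right mass_def)
  then show ?thesis
    using mass_pos[of r z] by (simp add: drift_def scaleR_diff_right)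
qed

lemma drift_conditional:
  assumes r: "r \<in> {0..R}" and [measurable]: "g \<in> borel_measurable borel" and g: "\<And>x. norm (g x) \<le> B"
  shows "(\<integral>p. (X (snd p) - drift r (fst p + r *\<^sub>R X (snd p))) \<bullet> g (fst p + r *\<^sub>R X (snd p)) \<partial>(\<gamma> \<Otimes>\<^sub>M M)) = 0"
proof -
  have [measurable]: "drift r \<in> borel_measurable borel"
    using field_measurable[OF r, of "\<lambda>x. x" borel] by simp
  define F where "F p = (X (snd p) - drift r (fst p)) \<bullet> g (fst p)" for p
  have [measurable]: "F \<in> borel_measurable (borel \<Otimes>\<^sub>M M)"
    unfolding F_def by measurable
  have F: "norm (F p) \<le> 2 * \<beta> * B" for p
  proof -
    have "norm (X (snd p) - drift r (fst p)) \<le> 2 * \<beta>"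
      using norm_triangle_ineq4[of "X (snd p)" "drift r (fst p)"] X_bound[of "snd p"] norm_drift[of r "fst p"] by simp
    then have "norm (X (snd p) - drift r (fst p)) * norm (g (fst p)) \<le> 2 * \<beta> * B"
      using \<beta>_nonneg by (intro mult_mono g) auto
    then show ?thesis
      unfolding F_def using Cauchy_Schwarz_ineq2 order.trans by (metis real_norm_def)
  qed
  have int: "integrable (density (\<gamma> \<Otimes>\<^sub>M M) (\<lambda>p. ennreal (weight r (X (snd p)) (fst p)))) F"
    unfolding distr_joint_shift[symmetric]
    by (subst integrable_distr_eq)
       (auto intro!: pair.integrable_const_bound[where B = "2 * \<beta> * B"] F[unfolded real_norm_def])
  have "(\<integral>p. F (fst p + r *\<^sub>R X (snd p), snd p) \<partial>(\<gamma> \<Otimes>\<^sub>M M))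
      = (\<integral>p. F p \<partial>distr (\<gamma> \<Otimes>\<^sub>M M) (borel \<Otimes>\<^sub>M M) (\<lambda>p. (fst p + r *\<^sub>R X (snd p), snd p)))"
    by (rule integral_distr[symmetric]) measurable
  also have "\<dots> = (\<integral>p. weight r (X (snd p)) (fst p) *\<^sub>R F p \<partial>(\<gamma> \<Otimes>\<^sub>M M))"
    unfolding distr_joint_shift by (rule integral_density) (auto simp: less_imp_le[OF weight_pos])
  also have "\<dots> = (\<integral>z. \<integral>\<omega>. weight r (X \<omega>) z *\<^sub>R F (z, \<omega>) \<partial>M \<partial>\<gamma>)"
  proof -
    have "integrable (\<gamma> \<Otimes>\<^sub>M M) (\<lambda>p. weight r (X (snd p)) (fst p) *\<^sub>R F p)"
      using int by (subst (asm) integrable_density) (auto simp: less_imp_le[OF weight_pos])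
    from pair.integral_fst'[OF this] show ?thesis
      by simp
  qed
  also have "\<dots> = (\<integral>z. 0 \<partial>\<gamma>)"
  proof (rule Bochner_Integration.integral_cong[OF refl])
    fix z
    have "integrable M (\<lambda>\<omega>. weight r (X \<omega>) z *\<^sub>R (X \<omega> - drift r z))"
    proof (rule integrable_weight_scaleR)
      show "norm (X \<omega> - drift r z) \<le> 2 * \<beta>" for \<omega>
        using norm_triangle_ineq4[of "X \<omega>" "drift r z"] X_bound[of \<omega>] norm_drift[of r z] by simp
    qed measurable
    then have "(\<integral>\<omega>. (weight r (X \<omega>) z *\<^sub>R (X \<omega> - drift r z)) \<bullet> g z \<partial>M) = 0"
      by (subst integral_inner_left) (auto simp: drift_residual)
    then show "(\<integral>\<omega>. weight r (X \<omega>) z *\<^sub>R F (z, \<omega>) \<partial>M) = 0"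
      by (simp add: F_def)
  qed
  finally show ?thesis
    by (simp add: F_def)
qed

sublocale conditional_flow drift R \<beta> "2 * \<beta> * K" C "18 * \<beta> * K\<^sup>2" "\<gamma> \<Otimes>\<^sub>M M" fst "\<lambda>p. X (snd p)"
proof
  show "fst \<in> borel_measurable (\<gamma> \<Otimes>\<^sub>M M)" "(\<lambda>p. X (snd p)) \<in> borel_measurable (\<gamma> \<Otimes>\<^sub>M M)"
    by measurable
  show "norm (X (snd p)) \<le> \<beta>" for p :: "'v \<times> 'a"
    by (rule X_bound)
  show "(\<integral>p. (X (snd p) - drift r (fst p + r *\<^sub>R X (snd p))) \<bullet> g (fst p + r *\<^sub>R X (snd p)) \<partial>(\<gamma> \<Otimes>\<^sub>M M)) = 0"
    if "r \<in> {0..R}" "g \<in> borel_measurable borel" "\<And>x. norm (g x) \<le> B" for r B and g :: "'v \<Rightarrow> 'v"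
    using that by (rule drift_conditional)
qed

section \<open>Moments of X, the dimension bound and the lower bound on the density\<close>

abbreviation \<tau> where "\<tau> \<equiv> \<Sum>b\<in>Basis. b \<bullet> S b"

lemma integrable_bounded_on_M:
  fixes h :: "'a \<Rightarrow> 'b::euclidean_space"
  assumes "h \<in> borel_measurable M" "\<And>\<omega>. norm (h \<omega>) \<le> B"
  shows "integrable M h"
  using assms by (intro integrable_const_bound[where B = B]) auto

lemma integrable_inner_X: "integrable M (\<lambda>\<omega>. a \<bullet> X \<omega>)"
proof (rule integrable_bounded_on_M)
  show "norm (a \<bullet> X \<omega>) \<le> norm a * \<beta>" for \<omega>
    using Cauchy_Schwarz_ineq2[of a "X \<omega>"] X_bound[of \<omega>] by (simp add: mult_left_mono order.trans)
qed measurable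

lemma integrable_inner_X_mult: "integrable M (\<lambda>\<omega>. (a \<bullet> X \<omega>) * (b \<bullet> X \<omega>))"
proof (rule integrable_bounded_on_M)
  have "\<bar>a \<bullet> X \<omega>\<bar> \<le> norm a * \<beta>" for a \<omega>
    using Cauchy_Schwarz_ineq2[of a "X \<omega>"] X_bound[of \<omega>] by (simp add: mult_left_mono order.trans)
  then show "norm ((a \<bullet> X \<omega>) * (b \<bullet> X \<omega>)) \<le> (norm a * \<beta>) * (norm b * \<beta>)" for \<omega>
    unfolding real_norm_def abs_mult using \<beta>_nonneg by (intro mult_mono) auto
qed measurable

lemma expectation_norm_X: "expectation (\<lambda>\<omega>. X \<omega> \<bullet> X \<omega>) = \<tau>"
proof -
  have "expectation (\<lambda>\<omega>. X \<omega> \<bullet> X \<omega>) = expectation (\<lambda>\<omega>. \<Sum>b\<in>Basis. (b \<bullet> X \<omega>) * (b \<bullet> X \<omega>))"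
    by (intro Bochner_Integration.integral_cong refl, subst euclidean_inner) (simp add: inner_commute)
  also have "\<dots> = \<tau>"
    by (subst Bochner_Integration.integral_sum) (auto simp: X_cov integrable_inner_X_mult)
  finally show ?thesis .
qed

text \<open>The expectation is the trace of \<open>S\<close> composed with \<open>A\<close>, that
  is, of the identity.\<close>

lemma expectation_XAX: "expectation (\<lambda>\<omega>. X \<omega> \<bullet> A (X \<omega>)) = DIM('v)"
proof -
  have "expectation (\<lambda>\<omega>. X \<omega> \<bullet> A (X \<omega>)) = expectation (\<lambda>\<omega>. \<Sum>b\<in>Basis. (b \<bullet> X \<omega>) * (A b \<bullet> X \<omega>))"
    by (intro Bochner_Integration.integral_cong refl, subst euclidean_inner) (simp add: inner_commute A_sym)
  also have "\<dots> = (\<Sum>b\<in>(Basis :: 'v set). b \<bullet> S (A b))"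
    by (subst Bochner_Integration.integral_sum) (auto simp: X_cov integrable_inner_X_mult)
  also have "\<dots> = DIM('v)"
    by (simp add: SA inner_same_Basis)
  finally show ?thesis .
qed

lemma \<tau>_le: "\<tau> \<le> \<beta>\<^sup>2"
proof -
  have "expectation (\<lambda>\<omega>. X \<omega> \<bullet> X \<omega>) \<le> \<beta>\<^sup>2"
  proof (rule integral_le_const)
    have "X \<omega> \<bullet> X \<omega> \<le> \<beta>\<^sup>2" for \<omega>
      unfolding power2_norm_eq_inner[symmetric] by (intro power_mono X_bound) simp
    then show "AE \<omega> in M. X \<omega> \<bullet> X \<omega> \<le> \<beta>\<^sup>2"
      by simp
    then show "integrable M (\<lambda>\<omega>. X \<omega> \<bullet> X \<omega>)"
      by (intro integrable_const_bound[where B = "\<beta>\<^sup>2"]) auto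
  qed
  then show ?thesis
    by (simp add: expectation_norm_X)
qed

lemma \<tau>_nonneg: "0 \<le> \<tau>"
  unfolding expectation_norm_X[symmetric] by (intro Bochner_Integration.integral_nonneg) simp

text \<open>The trace of \<open>S\<close> lies between \<open>DIM('v) * s\<close> and
  \<open>\<beta>\<^sup>2\<close>, so the lower bound on \<open>n\<close> also dominates the
  dimension.\<close>

lemma dim_le: "5 * real DIM('v) \<le> n"
proof -
  have "real DIM('v) * s \<le> \<tau>"
  proof -
    have "(\<Sum>b\<in>(Basis :: 'v set). s) \<le> \<tau>"
    proof (rule sum_mono)
      show "s \<le> b \<bullet> S b" if "b \<in> Basis" for b :: 'v
        using coercive[of b] that by simp
    qed
    then show ?thesis by simp
  qed
  then have "5 * (real DIM('v) * s) \<le> 5 * \<beta>\<^sup>2"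
    using \<tau>_le by simp
  also have "\<dots> \<le> n * s"
    using n s by (simp add: field_simps)
  finally show ?thesis
    using s by simp
qed

lemma mass_lower_bound: "exp (- (r\<^sup>2 / n) * DIM('v) / 2) \<le> mass r z"
proof -
  define Y where "Y \<omega> = r * (A (X \<omega>) \<bullet> z) / n - r\<^sup>2 * (X \<omega> \<bullet> A (X \<omega>)) / (2 * n)" for \<omega>
  define y where "y = - (r\<^sup>2 / n) * DIM('v) / 2"
  have int1: "integrable M (\<lambda>\<omega>. A (X \<omega>) \<bullet> z)"
    using integrable_inner_X[of "A z"] by (simp add: A_sym inner_commute)
  have int2: "integrable M (\<lambda>\<omega>. X \<omega> \<bullet> A (X \<omega>))"
    by (rule integrable_bounded_on_M[where B = "\<beta> * c"]) (use XAX_bound A_nonneg in auto)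
  have intY: "integrable M Y"
    unfolding Y_def by (intro Bochner_Integration.integrable_diff integrable_divide integrable_mult_right int1 int2)
  have "expectation (\<lambda>\<omega>. A (X \<omega>) \<bullet> z) = 0"
    using X_mean[of "A z"] by (simp add: A_sym inner_commute)
  then have EY: "expectation Y = y"
    unfolding Y_def y_def using int1 int2 by (simp add: expectation_XAX)
  \<comment> \<open>Jensen through the tangent of \<open>exp\<close> at \<open>y\<close>, the mean
    of the exponent; since \<open>X\<close> is centred this mean does not depend on
    \<open>z\<close>, whence a bound uniform in \<open>z\<close>.\<close>
  have "exp y = expectation (\<lambda>\<omega>. exp y * (1 + (Y \<omega> - y)))"
    using intY EY by (simp add: prob_space)
  also have "\<dots> \<le> mass r z"
    unfolding mass_def
  proof (rule integral_mono)
    show "exp y * (1 + (Y \<omega> - y)) \<le> weight r (X \<omega>) z" for \<omega>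
    proof -
      have "exp y * (1 + (Y \<omega> - y)) \<le> exp y * exp (Y \<omega> - y)"
        by (intro mult_left_mono exp_ge_add_one_self) simp
      also have "\<dots> = weight r (X \<omega>) z"
        by (simp add: exp_add[symmetric] weight_def Y_def)
      finally show ?thesis .
    qed
  qed (use intY integrable_weight in auto)
  finally show ?thesis
    by (simp add: y_def)
qed

text \<open>Some coordinate carries at least the fraction \<open>1 / DIM('v)\<close> of the norm, so
  the integrand is dominated by finitely many exponentials of linear functionals. It dominates in
  turn the Gaussian integrands below.\<close>

lemma integrable_exp_norm: "integrable \<gamma> (\<lambda>z. exp (t * norm z))"
proof (rule Bochner_Integration.integrable_bound)
  let ?k = "\<bar>t\<bar> * real DIM('v)"
  show "integrable \<gamma> (\<lambda>z. \<Sum>b\<in>Basis. exp ((?k *\<^sub>R b) \<bullet> z) + exp ((- ?k *\<^sub>R b) \<bullet> z))"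
    by (intro Bochner_Integration.integrable_sum Bochner_Integration.integrable_add \<gamma>_exp)
  show "AE z in \<gamma>. norm (exp (t * norm z)) \<le> norm (\<Sum>b\<in>Basis. exp ((?k *\<^sub>R b) \<bullet> z) + exp ((- ?k *\<^sub>R b) \<bullet> z))"
  proof (rule AE_I2)
    fix z :: 'v
    obtain b :: 'v where b: "b \<in> Basis" "norm z \<le> real DIM('v) * \<bar>z \<bullet> b\<bar>"
    proof -
      have "\<exists>b\<in>Basis. norm z \<le> real DIM('v) * \<bar>z \<bullet> b\<bar>"
      proof (rule ccontr)
        assume "\<not> ?thesis"
        then have "(\<Sum>b\<in>(Basis :: 'v set). \<bar>z \<bullet> b\<bar>) < (\<Sum>b\<in>(Basis :: 'v set). norm z / real DIM('v))"
          by (intro sum_strict_mono) (auto simp: field_simps)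
        then show False
          using norm_le_l1[of z] by simp
      qed
      then show ?thesis
        using that by blast
    qed
    have "t * norm z \<le> \<bar>t\<bar> * norm z"
      by (intro mult_right_mono) auto
    also have "\<dots> \<le> \<bar>?k * (b \<bullet> z)\<bar>"
      using mult_left_mono[OF b(2), of "\<bar>t\<bar>"] by (simp add: abs_mult inner_commute mult.assoc)
    finally have "exp (t * norm z) \<le> exp \<bar>?k * (b \<bullet> z)\<bar>"
      by simp
    also have "\<dots> \<le> exp ((?k *\<^sub>R b) \<bullet> z) + exp ((- ?k *\<^sub>R b) \<bullet> z)"
      using exp_abs_le_add_exp[of "?k * (b \<bullet> z)"] by simp
    also have "\<dots> \<le> (\<Sum>b\<in>Basis. exp ((?k *\<^sub>R b) \<bullet> z) + exp ((- ?k *\<^sub>R b) \<bullet> z))"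
      by (rule member_le_sum[OF b(1)]) (auto intro: add_nonneg_nonneg)
    finally show "norm (exp (t * norm z)) \<le> norm (\<Sum>b\<in>Basis. exp ((?k *\<^sub>R b) \<bullet> z) + exp ((- ?k *\<^sub>R b) \<bullet> z))"
      by (simp add: sum_nonneg add_nonneg_nonneg)
  qed
qed measurable

end

section \<open>Second moment of the velocity\<close>

lemma abs_mult_le:
  fixes x y :: real
  shows "\<bar>x\<bar> \<le> u \<Longrightarrow> \<bar>y\<bar> \<le> v \<Longrightarrow> \<bar>x * y\<bar> \<le> u * v"
  unfolding abs_mult by (intro mult_mono) auto

context gaussian_smoothing
begin

sublocale iid: pair_prob_space M M ..

lemma X_inner_bounds:
  shows "\<bar>X \<omega> \<bullet> X \<omega>'\<bar> \<le> \<beta>\<^sup>2" and "\<bar>X \<omega> \<bullet> A (X \<omega>')\<bar> \<le> \<beta> * c"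
proof -
  have "norm (X \<omega>) * norm (X \<omega>') \<le> \<beta> * \<beta>" "norm (X \<omega>) * norm (A (X \<omega>')) \<le> \<beta> * c"
    using \<beta>_nonneg c_nonneg by (auto intro!: mult_mono X_bound AX_bound)
  then show "\<bar>X \<omega> \<bullet> X \<omega>'\<bar> \<le> \<beta>\<^sup>2" "\<bar>X \<omega> \<bullet> A (X \<omega>')\<bar> \<le> \<beta> * c"
    using Cauchy_Schwarz_ineq2[of "X \<omega>" "X \<omega>'"] Cauchy_Schwarz_ineq2[of "X \<omega>" "A (X \<omega>')"]
    by (simp_all add: power2_eq_square)
qed

lemma iid_integral:
  fixes h :: "'a \<times> 'a \<Rightarrow> real"
  assumes "h \<in> borel_measurable (M \<Otimes>\<^sub>M M)" "\<And>p. \<bar>h p\<bar> \<le> B"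
  shows iid_integrable: "integrable (M \<Otimes>\<^sub>M M) h"
    and iid_integral_fst: "(\<integral>p. h p \<partial>(M \<Otimes>\<^sub>M M)) = (\<integral>\<omega>. \<integral>\<omega>'. h (\<omega>, \<omega>') \<partial>M \<partial>M)"
    and iid_integral_snd: "(\<integral>p. h p \<partial>(M \<Otimes>\<^sub>M M)) = (\<integral>\<omega>'. \<integral>\<omega>. h (\<omega>, \<omega>') \<partial>M \<partial>M)"
proof -
  show int: "integrable (M \<Otimes>\<^sub>M M) h"
    using assms by (intro iid.integrable_const_bound[where B = B]) auto
  show "(\<integral>p. h p \<partial>(M \<Otimes>\<^sub>M M)) = (\<integral>\<omega>. \<integral>\<omega>'. h (\<omega>, \<omega>') \<partial>M \<partial>M)"
    using iid.integral_fst'[OF int] by simp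
  show "(\<integral>p. h p \<partial>(M \<Otimes>\<^sub>M M)) = (\<integral>\<omega>'. \<integral>\<omega>. h (\<omega>, \<omega>') \<partial>M \<partial>M)"
    using iid.integral_snd[of "\<lambda>x y. h (x, y)"] int by simp
qed

text \<open>The pair \<open>p\<close> carries two independent copies of \<open>X\<close>; the result
  of \<open>gaussian_pair_integral\<close> depends on them through these three quantities
  only.\<close>

definition b where "b p = X (fst p) \<bullet> X (snd p)"
definition q where "q p = X (fst p) \<bullet> A (X (snd p))"
definition sq where "sq p = X (fst p) \<bullet> X (fst p) + X (snd p) \<bullet> X (snd p)"

lemma bq_measurable [measurable]:
  "b \<in> borel_measurable (M \<Otimes>\<^sub>M M)" "q \<in> borel_measurable (M \<Otimes>\<^sub>M M)" "sq \<in> borel_measurable (M \<Otimes>\<^sub>M M)"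
  unfolding b_def q_def sq_def by measurable

lemma bq_bounds: "\<bar>b p\<bar> \<le> \<beta>\<^sup>2" "\<bar>q p\<bar> \<le> \<beta> * c" "\<bar>sq p\<bar> \<le> 2 * \<beta>\<^sup>2"
  using X_inner_bounds(1)[of "fst p" "snd p"] X_inner_bounds(2)[of "fst p" "snd p"]
    X_inner_bounds(1)[of "fst p" "fst p"] X_inner_bounds(1)[of "snd p" "snd p"]
  unfolding b_def q_def sq_def by linarith+

text \<open>Integrating over one copy with the other fixed reduces everything to
  \<open>X_mean\<close> and \<open>X_cov\<close>; in the products \<open>q * b\<close> and
  \<open>q * q\<close> the inverse \<open>A\<close> cancels against \<open>S\<close>. For
  \<open>q * sq\<close> the copy whose square does not occur is integrated first, separately for the
  two squares.\<close>

lemma bq_moments: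
  shows "iid.expectation b = 0" "iid.expectation q = 0" "iid.expectation sq = 2 * \<tau>"
    and "iid.expectation (\<lambda>p. q p * b p) = \<tau>" "iid.expectation (\<lambda>p. q p * q p) = DIM('v)"
    and "iid.expectation (\<lambda>p. q p * sq p) = 0"
proof -
  have q: "q (\<omega>, \<omega>') = A (X \<omega>) \<bullet> X \<omega>'" for \<omega> \<omega>'
    by (simp add: q_def A_sym)
  show "iid.expectation b = 0"
    using X_mean by (subst iid_integral_fst[OF _ bq_bounds(1)]) (auto simp: b_def)
  show "iid.expectation q = 0"
    using X_mean by (subst iid_integral_fst[OF _ bq_bounds(2)]) (auto simp: q)
  show "iid.expectation (\<lambda>p. q p * b p) = \<tau>"
  proof -
    have "iid.expectation (\<lambda>p. q p * b p) = (\<integral>\<omega>. \<integral>\<omega>'. q (\<omega>, \<omega>') * b (\<omega>, \<omega>') \<partial>M \<partial>M)"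
      by (rule iid_integral_fst[OF _ abs_mult_le[OF bq_bounds(2,1)]]) measurable
    also have "\<dots> = (\<integral>\<omega>. X \<omega> \<bullet> X \<omega> \<partial>M)"
      by (intro Bochner_Integration.integral_cong refl)
         (simp add: q b_def X_cov S_sym[symmetric] SA)
    finally show ?thesis
      by (simp add: expectation_norm_X)
  qed
  show "iid.expectation (\<lambda>p. q p * q p) = DIM('v)"
  proof -
    have "iid.expectation (\<lambda>p. q p * q p) = (\<integral>\<omega>. \<integral>\<omega>'. q (\<omega>, \<omega>') * q (\<omega>, \<omega>') \<partial>M \<partial>M)"
      by (rule iid_integral_fst[OF _ abs_mult_le[OF bq_bounds(2,2)]]) measurable
    also have "\<dots> = (\<integral>\<omega>. X \<omega> \<bullet> A (X \<omega>) \<partial>M)"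
      by (intro Bochner_Integration.integral_cong refl)
         (simp add: q X_cov S_sym[symmetric] SA, simp add: A_sym)
    finally show ?thesis
      by (simp add: expectation_XAX)
  qed
  have sq_split: "iid.expectation (\<lambda>p. h p * sq p)
      = iid.expectation (\<lambda>p. h p * (X (fst p) \<bullet> X (fst p))) + iid.expectation (\<lambda>p. h p * (X (snd p) \<bullet> X (snd p)))"
    if [measurable]: "h \<in> borel_measurable (M \<Otimes>\<^sub>M M)" and h: "\<And>p. \<bar>h p\<bar> \<le> B" for h B
    unfolding sq_def distrib_left
    by (intro Bochner_Integration.integral_add iid_integrable[OF _ abs_mult_le[OF h X_inner_bounds(1)]]) measurable
  have one: "\<bar>1 :: real\<bar> \<le> 1"
    by simp
  have "iid.expectation (\<lambda>p. 1 * (X (fst p) \<bullet> X (fst p))) = (\<integral>\<omega>. \<integral>\<omega>'. 1 * (X \<omega> \<bullet> X \<omega>) \<partial>M \<partial>M)"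
    by (subst iid_integral_fst[OF _ abs_mult_le[OF one X_inner_bounds(1)]]) simp_all
  moreover have "iid.expectation (\<lambda>p. 1 * (X (snd p) \<bullet> X (snd p))) = (\<integral>\<omega>. \<integral>\<omega>'. 1 * (X \<omega>' \<bullet> X \<omega>') \<partial>M \<partial>M)"
    by (subst iid_integral_fst[OF _ abs_mult_le[OF one X_inner_bounds(1)]]) simp_all
  ultimately show "iid.expectation sq = 2 * \<tau>"
    using sq_split[of "\<lambda>_. 1" 1] by (simp add: prob_space expectation_norm_X)
  have "iid.expectation (\<lambda>p. q p * (X (fst p) \<bullet> X (fst p))) = (\<integral>\<omega>. \<integral>\<omega>'. q (\<omega>, \<omega>') * (X \<omega> \<bullet> X \<omega>) \<partial>M \<partial>M)"
    by (subst iid_integral_fst[OF _ abs_mult_le[OF bq_bounds(2) X_inner_bounds(1)]]) simp_all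
  also have "\<dots> = 0"
    using X_mean by (simp add: q)
  finally have 1: "iid.expectation (\<lambda>p. q p * (X (fst p) \<bullet> X (fst p))) = 0" .
  have "iid.expectation (\<lambda>p. q p * (X (snd p) \<bullet> X (snd p))) = (\<integral>\<omega>'. \<integral>\<omega>. q (\<omega>, \<omega>') * (X \<omega>' \<bullet> X \<omega>') \<partial>M \<partial>M)"
    by (subst iid_integral_snd[OF _ abs_mult_le[OF bq_bounds(2) X_inner_bounds(1)]]) simp_all
  also have "\<dots> = 0"
    using X_mean by (simp add: q_def inner_commute[of "X _" "A (X _)"])
  finally have 2: "iid.expectation (\<lambda>p. q p * (X (snd p) \<bullet> X (snd p))) = 0" .
  show "iid.expectation (\<lambda>p. q p * sq p) = 0"
    using sq_split[OF _ bq_bounds(2)] 1 2 by simp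
qed

text \<open>The terms of order 0 and 1 of the exponential in \<open>\<theta>\<close> cancel up to \<open>\<theta>\<^sup>3\<close>, since \<open>\<alpha>\<close> is the
  regression coefficient; the bound on the term of order 2 only uses that \<open>q\<^sup>2\<close> has expectation \<open>DIM('v)\<close>.\<close>

lemma exponential_pair_bound:
  fixes \<theta> :: real
  assumes \<theta>: "0 \<le> \<theta>" "\<theta> \<le> 5 / (4 * n)"
  defines "\<alpha> \<equiv> \<theta> / (1 + \<theta>)"
  shows "iid.expectation (\<lambda>p. exp (\<theta> * q p) * (((1 - \<alpha>)\<^sup>2 + \<alpha>\<^sup>2) * b p - \<alpha> * (1 - \<alpha>) * (sq p - \<tau>)))
    \<le> 2 * \<theta>\<^sup>2 * DIM('v) * \<beta>\<^sup>2"
proof -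
  define c0 where "c0 = (1 - \<alpha>)\<^sup>2 + \<alpha>\<^sup>2"
  define c1 where "c1 = \<alpha> * (1 - \<alpha>)"
  define F where "F p = c0 * b p - c1 * (sq p - \<tau>)" for p
  have dim: "1 \<le> real DIM('v)"
    by (simp add: DIM_ge_Suc0)
  then have n5: "5 \<le> n"
    using dim_le by linarith
  have "5 / (4 * n) \<le> 1"
    using n5 by simp
  then have \<theta>1: "\<theta> \<le> 1"
    using \<theta>(2) by linarith
  have \<alpha>: "0 \<le> \<alpha>" "\<alpha> \<le> 1"
    using \<theta> by (auto simp: \<alpha>_def field_simps)
  \<comment> \<open>\<open>c0 + 2 * c1\<close> is the square of
    \<open>(1 - \<alpha>) + \<alpha>\<close>; this normalisation gives \<open>F\<close> the bound
    \<open>\<beta>\<^sup>2\<close>.\<close>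
  have c01: "0 \<le> c0" "0 \<le> c1" "c0 + 2 * c1 = 1"
    using \<alpha> by (simp_all add: c0_def c1_def) (simp add: power2_eq_square algebra_simps)
  have [measurable]: "F \<in> borel_measurable (M \<Otimes>\<^sub>M M)"
    unfolding F_def by measurable
  have F: "\<bar>F p\<bar> \<le> \<beta>\<^sup>2" for p
  proof -
    have "0 \<le> sq p"
      by (simp add: sq_def)
    then have "\<bar>sq p - \<tau>\<bar> \<le> 2 * \<beta>\<^sup>2"
      using bq_bounds(3)[of p] \<tau>_le \<tau>_nonneg by (simp only: abs_le_iff) linarith
    then have "\<bar>c0 * b p\<bar> + \<bar>c1 * (sq p - \<tau>)\<bar> \<le> c0 * \<beta>\<^sup>2 + c1 * (2 * \<beta>\<^sup>2)"
      unfolding abs_mult using c01 bq_bounds(1)[of p] by (intro add_mono mult_mono) auto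
    also have "\<dots> = (c0 + 2 * c1) * \<beta>\<^sup>2"
      by (simp add: algebra_simps)
    finally show ?thesis
      unfolding F_def c01(3) by simp
  qed
  have \<theta>q: "\<bar>\<theta> * q p\<bar> \<le> 1" for p
  proof -
    have "\<bar>\<theta> * q p\<bar> \<le> 5 / (4 * n) * (\<beta> * c)"
      using \<theta> by (intro abs_mult_le bq_bounds) auto
    also have "\<dots> \<le> 5 / (4 * n) * (n / 5)"
      using n by (intro mult_left_mono \<beta>c) auto
    also have "\<dots> \<le> 1"
      using n by simp
    finally show ?thesis .
  qed
  have int: "integrable (M \<Otimes>\<^sub>M M) F" "integrable (M \<Otimes>\<^sub>M M) (\<lambda>p. q p * F p)"
    "integrable (M \<Otimes>\<^sub>M M) (\<lambda>p. q p * q p)"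
    by (rule iid_integrable[OF _ F] iid_integrable[OF _ abs_mult_le[OF bq_bounds(2) F]]
        iid_integrable[OF _ abs_mult_le[OF bq_bounds(2,2)]]; measurable)+
  have intb: "integrable (M \<Otimes>\<^sub>M M) b" "integrable (M \<Otimes>\<^sub>M M) sq" "integrable (M \<Otimes>\<^sub>M M) q"
    "integrable (M \<Otimes>\<^sub>M M) (\<lambda>p. q p * b p)" "integrable (M \<Otimes>\<^sub>M M) (\<lambda>p. q p * sq p)"
    by (rule iid_integrable[OF _ bq_bounds(1)] iid_integrable[OF _ bq_bounds(2)] iid_integrable[OF _ bq_bounds(3)]
        iid_integrable[OF _ abs_mult_le[OF bq_bounds(2,1)]] iid_integrable[OF _ abs_mult_le[OF bq_bounds(2,3)]]; measurable)+
  have EF: "iid.expectation F = - c1 * \<tau>"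
    unfolding F_def using intb by (simp add: bq_moments iid.P.prob_space algebra_simps)
  have "iid.expectation (\<lambda>p. q p * F p) = iid.expectation (\<lambda>p. c0 * (q p * b p) - c1 * (q p * sq p - q p * \<tau>))"
    by (intro Bochner_Integration.integral_cong refl) (simp add: F_def algebra_simps)
  also have "\<dots> = c0 * \<tau>"
    using intb by (simp add: bq_moments)
  finally have EqF: "iid.expectation (\<lambda>p. q p * F p) = c0 * \<tau>" .
  have "iid.expectation (\<lambda>p. exp (\<theta> * q p) * F p)
      \<le> iid.expectation (\<lambda>p. F p + \<theta> * (q p * F p) + \<theta>\<^sup>2 * \<beta>\<^sup>2 * (q p * q p))"
  proof (rule integral_mono)
    have exp1: "\<bar>exp (\<theta> * q p)\<bar> \<le> exp 1" for p
      using \<theta>q[of p] by simp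
    show "integrable (M \<Otimes>\<^sub>M M) (\<lambda>p. exp (\<theta> * q p) * F p)"
      by (rule iid_integrable[OF _ abs_mult_le[OF exp1 F]]) measurable
    show "exp (\<theta> * q p) * F p \<le> F p + \<theta> * (q p * F p) + \<theta>\<^sup>2 * \<beta>\<^sup>2 * (q p * q p)" for p
    proof -
      define e where "e = exp (\<theta> * q p)"
      have "(e - 1 - \<theta> * q p) * F p \<le> \<bar>(e - 1 - \<theta> * q p) * F p\<bar>"
        by simp
      also have "\<dots> \<le> (\<theta> * q p)\<^sup>2 * \<beta>\<^sup>2"
        unfolding e_def by (rule abs_mult_le[OF exp_quadratic_error[OF \<theta>q] F])
      also have "(\<theta> * q p)\<^sup>2 * \<beta>\<^sup>2 = \<theta>\<^sup>2 * \<beta>\<^sup>2 * (q p * q p)"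
        by (simp add: power2_eq_square)
      also have "(e - 1 - \<theta> * q p) * F p = e * F p - F p - \<theta> * (q p * F p)"
        by (simp add: left_diff_distrib)
      finally show ?thesis
        unfolding e_def by linarith
    qed
  qed (use int in auto)
  also have "\<dots> = (\<theta> * c0 - c1) * \<tau> + \<theta>\<^sup>2 * \<beta>\<^sup>2 * DIM('v)"
    using int by (simp add: EF EqF bq_moments left_diff_distrib)
  \<comment> \<open>One half of the final bound pays for what the cancellation leaves over, the
    other for the quadratic term. The first half is crude: it uses that \<theta> is at most 1,
    \<tau> at most \<open>\<beta>\<^sup>2\<close>, and the dimension at least 1.\<close>
  also have "\<dots> \<le> \<theta>\<^sup>2 * (DIM('v) * \<beta>\<^sup>2) + \<theta>\<^sup>2 * \<beta>\<^sup>2 * DIM('v)"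
  proof (intro add_right_mono mult_mono)
    have "\<theta> * c0 - c1 = \<theta> ^ 3 / (1 + \<theta>)\<^sup>2"
    proof -
      have "1 - \<alpha> = 1 / (1 + \<theta>)"
        using \<theta> by (simp add: \<alpha>_def field_simps)
      then have "c0 = (1 + \<theta>\<^sup>2) / (1 + \<theta>)\<^sup>2" "c1 = \<theta> / (1 + \<theta>)\<^sup>2"
        by (simp_all add: c0_def c1_def \<alpha>_def power_divide add_divide_distrib power2_eq_square)
      then show ?thesis
        by (simp add: diff_divide_distrib[symmetric] power2_eq_square power3_eq_cube algebra_simps)
    qed
    also have "\<dots> \<le> \<theta> ^ 3 / 1"
      using \<theta> by (intro divide_left_mono) auto
    also have "\<dots> \<le> \<theta>\<^sup>2"
      using \<theta> \<theta>1 by (simp add: power2_eq_square power3_eq_cube mult_left_le)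
    finally show "\<theta> * c0 - c1 \<le> \<theta>\<^sup>2" .
    show "\<tau> \<le> DIM('v) * \<beta>\<^sup>2"
      using \<tau>_le dim mult_right_mono[OF dim, of "\<beta>\<^sup>2"] by simp
  qed (use \<tau>_nonneg in auto)
  finally show ?thesis
    by (simp add: F_def c0_def c1_def algebra_simps)
qed

text \<open>The linear exponents add up, and the quadratic form at \<open>x + y\<close> exceeds the
  sum of its values at \<open>x\<close> and \<open>y\<close> by the cross term, which becomes the
  prefactor.\<close>

lemma weight_mult: "weight r x z * weight r y z = exp (r\<^sup>2 / n * (x \<bullet> A y)) * weight r (x + y) z"
proof -
  have "y \<bullet> A x = x \<bullet> A y"
    by (metis A_sym inner_commute)
  then show ?thesis
    using n unfolding weight_def exp_add[symmetric]
    by (simp add: linear_add[OF linear_A] inner_add field_simps power2_eq_square)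
qed

lemma integral_weight_shift:
  fixes h :: "'v \<Rightarrow> real"
  assumes [measurable]: "h \<in> borel_measurable borel"
  shows "(\<integral>z. weight r y z * h z \<partial>\<gamma>) = (\<integral>z. h (z + r *\<^sub>R y) \<partial>\<gamma>)"
proof -
  have "(\<integral>z. h (z + r *\<^sub>R y) \<partial>\<gamma>) = (\<integral>z. h z \<partial>distr \<gamma> borel (\<lambda>z. z + r *\<^sub>R y))"
    by (rule integral_distr[symmetric]) measurable
  also have "\<dots> = (\<integral>z. weight r y z *\<^sub>R h z \<partial>\<gamma>)"
    unfolding shift weight_conv_shift by (rule integral_density) auto
  finally show ?thesis
    by simp
qed

lemma \<gamma>_integrable: "integrable \<gamma> (\<lambda>z. a \<bullet> z)" "integrable \<gamma> (\<lambda>z. z \<bullet> z)"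
proof -
  have le: "x \<le> exp x" for x :: real
    using exp_ge_add_one_self[of x] by linarith
  show "integrable \<gamma> (\<lambda>z. a \<bullet> z)"
  proof (rule Bochner_Integration.integrable_bound[OF integrable_exp_norm[of "norm a"]])
    show "AE z in \<gamma>. norm (a \<bullet> z) \<le> norm (exp (norm a * norm z))"
      using Cauchy_Schwarz_ineq2[of a] le[of "norm a * norm _"] by (auto intro: order.trans)
  qed measurable
  show "integrable \<gamma> (\<lambda>z. z \<bullet> z)"
  proof (rule Bochner_Integration.integrable_bound[OF integrable_exp_norm[of 2]])
    show "AE z in \<gamma>. norm (z \<bullet> z) \<le> norm (exp (2 * norm z))"
    proof (rule AE_I2)
      fix z :: 'v
      have "(norm z)\<^sup>2 \<le> (exp (norm z))\<^sup>2"
        by (intro power_mono le) simp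
      then show "norm (z \<bullet> z) \<le> norm (exp (2 * norm z))"
        by (simp add: power2_norm_eq_inner[symmetric] exp_double)
    qed
  qed measurable
qed

text \<open>\<kappa> is the coefficient of the linear regression of X on Z + r X: the
  cross-covariance is \<open>r\<close> times \<open>S\<close>, the covariance of Z + r X is
  \<open>n + r\<^sup>2\<close> times \<open>S\<close>. By \<open>weight_mult\<close> the weights
  amount to a translation by \<open>r *\<^sub>R (x + y)\<close>, which leaves a quadratic polynomial
  to integrate; \<open>\<kappa> * r = \<alpha>\<close> and
  \<open>\<kappa>\<^sup>2 * n = \<alpha> * (1 - \<alpha>)\<close> express its coefficients through
  \<alpha>.\<close>

lemma gaussian_pair_integral:
  assumes "0 \<le> r"
  defines "\<kappa> \<equiv> r / (n + r\<^sup>2)" and "\<theta> \<equiv> r\<^sup>2 / n"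
  defines "\<alpha> \<equiv> \<theta> / (1 + \<theta>)"
  shows "(\<integral>z. (weight r x z * weight r y z) * ((x - \<kappa> *\<^sub>R z) \<bullet> (y - \<kappa> *\<^sub>R z)) \<partial>\<gamma>)
    = exp (\<theta> * (x \<bullet> A y)) * (((1 - \<alpha>)\<^sup>2 + \<alpha>\<^sup>2) * (x \<bullet> y) - \<alpha> * (1 - \<alpha>) * (x \<bullet> x + y \<bullet> y - \<tau>))"
proof -
  have pos: "0 < n + r\<^sup>2"
    using n by (simp add: add_pos_nonneg)
  have \<alpha>: "\<kappa> * r = \<alpha>" "\<kappa>\<^sup>2 * n = \<alpha> * (1 - \<alpha>)"
  proof -
    have "\<alpha> = r\<^sup>2 / (n + r\<^sup>2)"
      using n pos by (simp add: \<alpha>_def \<theta>_def field_simps)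
    moreover from this have "1 - \<alpha> = n / (n + r\<^sup>2)"
      using pos by (simp add: field_simps)
    ultimately show "\<kappa> * r = \<alpha>" "\<kappa>\<^sup>2 * n = \<alpha> * (1 - \<alpha>)"
      by (simp_all add: \<kappa>_def power2_eq_square)
  qed
  define h where "h z = (x - \<kappa> *\<^sub>R z) \<bullet> (y - \<kappa> *\<^sub>R z)" for z
  define a where "a = x - \<alpha> *\<^sub>R (x + y)"
  define d where "d = y - \<alpha> *\<^sub>R (x + y)"
  have [measurable]: "h \<in> borel_measurable borel"
    unfolding h_def by measurable
  have "(\<integral>z. (weight r x z * weight r y z) * h z \<partial>\<gamma>) = exp (\<theta> * (x \<bullet> A y)) * (\<integral>z. weight r (x + y) z * h z \<partial>\<gamma>)"
    by (simp add: weight_mult \<theta>_def mult.assoc)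
  also have "(\<integral>z. weight r (x + y) z * h z \<partial>\<gamma>) = (\<integral>z. h (z + r *\<^sub>R (x + y)) \<partial>\<gamma>)"
    by (rule integral_weight_shift) measurable
  also have "\<dots> = (\<integral>z. a \<bullet> d - \<kappa> * ((a + d) \<bullet> z) + \<kappa>\<^sup>2 * (z \<bullet> z) \<partial>\<gamma>)"
  proof (rule Bochner_Integration.integral_cong[OF refl])
    fix z
    have "x - \<kappa> *\<^sub>R (z + r *\<^sub>R (x + y)) = a - \<kappa> *\<^sub>R z" "y - \<kappa> *\<^sub>R (z + r *\<^sub>R (x + y)) = d - \<kappa> *\<^sub>R z"
      unfolding a_def d_def \<alpha>(1)[symmetric] by (simp_all add: algebra_simps)
    then have "h (z + r *\<^sub>R (x + y)) = (a - \<kappa> *\<^sub>R z) \<bullet> (d - \<kappa> *\<^sub>R z)"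
      by (simp only: h_def)
    then show "h (z + r *\<^sub>R (x + y)) = a \<bullet> d - \<kappa> * ((a + d) \<bullet> z) + \<kappa>\<^sup>2 * (z \<bullet> z)"
      by (simp add: inner_diff inner_add inner_commute power2_eq_square algebra_simps)
  qed
  also have "\<dots> = a \<bullet> d + \<kappa>\<^sup>2 * (n * \<tau>)"
    using \<gamma>_integrable \<gamma>_trace by (simp add: \<gamma>_mean \<gamma>.prob_space[unfolded space_\<gamma>] power2_norm_eq_inner)
  also have "\<dots> = ((1 - \<alpha>)\<^sup>2 + \<alpha>\<^sup>2) * (x \<bullet> y) - \<alpha> * (1 - \<alpha>) * (x \<bullet> x + y \<bullet> y - \<tau>)"
    unfolding mult.assoc[symmetric] \<alpha>(2)
    by (simp add: a_def d_def inner_diff inner_add inner_commute[of y x] power2_eq_square algebra_simps)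
  finally show ?thesis
    by (simp only: h_def)
qed

sublocale triple: pair_prob_space \<gamma> "M \<Otimes>\<^sub>M M" ..

text \<open>The squared norm of an expectation is the expectation of an inner product over two
  independent copies. After this expansion the Gaussian variable can be integrated out first, in
  closed form.\<close>

lemma residual_second_moment:
  assumes r: "r \<in> {0..R}"
  defines "\<kappa> \<equiv> r / (n + r\<^sup>2)" and "\<theta> \<equiv> r\<^sup>2 / n"
  shows "(\<integral>\<^sup>+z. ennreal ((norm (mass r z *\<^sub>R (drift r z - \<kappa> *\<^sub>R z)))\<^sup>2) \<partial>\<gamma>)
    \<le> ennreal (2 * \<theta>\<^sup>2 * DIM('v) * \<beta>\<^sup>2)"
proof -
  define G where "G z p = (weight r (X (fst p)) z * weight r (X (snd p)) z)
      * ((X (fst p) - \<kappa> *\<^sub>R z) \<bullet> (X (snd p) - \<kappa> *\<^sub>R z))" for z p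
  have \<kappa>: "0 \<le> \<kappa>"
    using r n by (simp add: \<kappa>_def)
  have [measurable]: "case_prod G \<in> borel_measurable (borel \<Otimes>\<^sub>M (M \<Otimes>\<^sub>M M))"
    unfolding G_def by measurable
  define t where "t = 2 * (r * c / n + \<kappa>)"
  have res: "norm (X \<omega> - \<kappa> *\<^sub>R z) \<le> exp (\<beta> + \<kappa> * norm z)" for \<omega> z
  proof -
    have "norm (X \<omega> - \<kappa> *\<^sub>R z) \<le> \<beta> + \<kappa> * norm z"
      using norm_triangle_ineq4[of "X \<omega>" "\<kappa> *\<^sub>R z"] X_bound[of \<omega>] \<kappa> by simp
    also have "\<dots> \<le> exp (\<beta> + \<kappa> * norm z)"
      using exp_ge_add_one_self[of "\<beta> + \<kappa> * norm z"] by linarith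
    finally show ?thesis .
  qed
  \<comment> \<open>The linear factors are absorbed into exponentials, so that the integrand is
    dominated by a multiple of \<open>exp (t * norm z)\<close> uniformly in the pair.\<close>
  have G_bound: "\<bar>G z p\<bar> \<le> exp (2 * \<beta>) * exp (t * norm z)" for z p
  proof -
    have w: "\<bar>weight r (X \<omega>) z\<bar> \<le> exp (r * c / n * norm z)" for \<omega>
      using weight_bound[of r \<omega> z] weight_pos[of r "X \<omega>" z] r by simp
    have "\<bar>(X (fst p) - \<kappa> *\<^sub>R z) \<bullet> (X (snd p) - \<kappa> *\<^sub>R z)\<bar> \<le> exp (\<beta> + \<kappa> * norm z) * exp (\<beta> + \<kappa> * norm z)"
      by (rule order.trans[OF Cauchy_Schwarz_ineq2 mult_mono[OF res res]]) auto
    then have "\<bar>G z p\<bar> \<le> (exp (r * c / n * norm z) * exp (r * c / n * norm z)) * (exp (\<beta> + \<kappa> * norm z) * exp (\<beta> + \<kappa> * norm z))"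
      unfolding G_def by (intro abs_mult_le w)
    also have "\<dots> = exp (2 * \<beta>) * exp (t * norm z)"
      by (simp add: t_def exp_add[symmetric] algebra_simps)
    finally show ?thesis .
  qed
  have int: "integrable (\<gamma> \<Otimes>\<^sub>M (M \<Otimes>\<^sub>M M)) (case_prod G)"
  proof (rule Bochner_Integration.integrable_bound)
    show "integrable (\<gamma> \<Otimes>\<^sub>M (M \<Otimes>\<^sub>M M)) (\<lambda>x. exp (2 * \<beta>) * exp (t * norm (fst x)))"
    proof (intro integrable_mult_right triple.Fubini_integrable)
      show "integrable \<gamma> (\<lambda>x. \<integral>y. norm (exp (t * norm (fst (x, y :: 'a \<times> 'a)))) \<partial>(M \<Otimes>\<^sub>M M))"
        using integrable_exp_norm[of t] by (simp add: iid.P.prob_space)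
    qed auto
    show "AE x in \<gamma> \<Otimes>\<^sub>M (M \<Otimes>\<^sub>M M). norm (case_prod G x) \<le> norm (exp (2 * \<beta>) * exp (t * norm (fst x)))"
      using G_bound by (auto simp: case_prod_unfold)
    show "case_prod G \<in> borel_measurable (\<gamma> \<Otimes>\<^sub>M (M \<Otimes>\<^sub>M M))"
      by measurable
  qed
  have square: "(norm (mass r z *\<^sub>R (drift r z - \<kappa> *\<^sub>R z)))\<^sup>2 = (\<integral>p. G z p \<partial>(M \<Otimes>\<^sub>M M))" for z
  proof -
    define V where "V \<omega> = weight r (X \<omega>) z *\<^sub>R (X \<omega> - \<kappa> *\<^sub>R z)" for \<omega>
    have intV: "integrable M V"
      unfolding V_def by (rule integrable_weight_scaleR[OF _ res]) measurable
    have EV: "expectation V = mass r z *\<^sub>R (drift r z - \<kappa> *\<^sub>R z)"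
      unfolding V_def by (rule drift_residual)
    have GV: "G z (\<omega>, \<omega>') = V \<omega> \<bullet> V \<omega>'" for \<omega> \<omega>'
      by (simp add: G_def V_def mult.assoc)
    have "(\<integral>p. G z p \<partial>(M \<Otimes>\<^sub>M M)) = (\<integral>\<omega>. \<integral>\<omega>'. G z (\<omega>, \<omega>') \<partial>M \<partial>M)"
      by (rule iid_integral_fst[OF _ G_bound]) (unfold G_def, measurable)
    also have "\<dots> = expectation V \<bullet> expectation V"
      unfolding GV using intV by simp
    finally show ?thesis
      unfolding power2_norm_eq_inner EV by (rule sym)
  qed
  have "(\<integral>\<^sup>+z. ennreal ((norm (mass r z *\<^sub>R (drift r z - \<kappa> *\<^sub>R z)))\<^sup>2) \<partial>\<gamma>)
      = (\<integral>\<^sup>+z. ennreal (\<integral>p. G z p \<partial>(M \<Otimes>\<^sub>M M)) \<partial>\<gamma>)"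
    by (simp only: square)
  also have "\<dots> = ennreal (\<integral>z. \<integral>p. G z p \<partial>(M \<Otimes>\<^sub>M M) \<partial>\<gamma>)"
  proof (rule nn_integral_eq_integral)
    show "integrable \<gamma> (\<lambda>z. \<integral>p. G z p \<partial>(M \<Otimes>\<^sub>M M))"
      using triple.integrable_fst'[OF int] by simp
    show "AE z in \<gamma>. 0 \<le> (\<integral>p. G z p \<partial>(M \<Otimes>\<^sub>M M))"
      unfolding square[symmetric] by simp
  qed
  also have "(\<integral>z. \<integral>p. G z p \<partial>(M \<Otimes>\<^sub>M M) \<partial>\<gamma>) = (\<integral>p. \<integral>z. G z p \<partial>\<gamma> \<partial>(M \<Otimes>\<^sub>M M))"
    by (rule triple.Fubini_integral[OF int, symmetric])
  also have "\<dots> = (\<integral>p. exp (\<theta> * q p) * (((1 - \<theta> / (1 + \<theta>))\<^sup>2 + (\<theta> / (1 + \<theta>))\<^sup>2) * b p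
      - \<theta> / (1 + \<theta>) * (1 - \<theta> / (1 + \<theta>)) * (sq p - \<tau>)) \<partial>(M \<Otimes>\<^sub>M M))"
    unfolding G_def \<kappa>_def \<theta>_def q_def b_def sq_def using r
    by (intro Bochner_Integration.integral_cong refl gaussian_pair_integral) simp
  also have "ennreal \<dots> \<le> ennreal (2 * \<theta>\<^sup>2 * DIM('v) * \<beta>\<^sup>2)"
  proof (rule ennreal_leI, rule exponential_pair_bound)
    show "0 \<le> \<theta>"
      using n by (simp add: \<theta>_def)
    have "r\<^sup>2 \<le> R\<^sup>2"
      using r by (intro power_mono) auto
    then have "r\<^sup>2 / n \<le> (5 / 4) / n"
      using R n by (intro divide_right_mono) auto
    then show "\<theta> \<le> 5 / (4 * n)"
      by (simp add: \<theta>_def)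
  qed
  finally show ?thesis .
qed

text \<open>The law of Z + r X has density \<open>mass r\<close> with respect to \<gamma>. Since
  this density is at least 1/2, it may be replaced by twice its square, which cancels the
  denominator in \<open>drift\<close> and leads to \<open>residual_second_moment\<close>.\<close>

lemma velocity_second_moment:
  assumes r: "r \<in> {0..R}"
  defines "\<kappa> \<equiv> r / (n + r\<^sup>2)"
  shows "(\<integral>\<^sup>+p. ennreal ((norm (drift r (fst p + r *\<^sub>R X (snd p)) - \<kappa> *\<^sub>R (fst p + r *\<^sub>R X (snd p))))\<^sup>2) \<partial>(\<gamma> \<Otimes>\<^sub>M M))
    \<le> ennreal (4 * (R\<^sup>2 / n)\<^sup>2 * DIM('v) * \<beta>\<^sup>2)"
proof -
  have [measurable]: "drift r \<in> borel_measurable borel"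
    using field_measurable[OF r, of "\<lambda>x. x" borel] by simp
  have mass_measurable [measurable]: "mass r \<in> borel_measurable borel"
    unfolding mass_def by measurable
  define w where "w z = ennreal ((norm (drift r z - \<kappa> *\<^sub>R z))\<^sup>2)" for z
  have [measurable]: "w \<in> borel_measurable borel"
    unfolding w_def by measurable
  define \<theta> where "\<theta> = r\<^sup>2 / n"
  have rR: "r\<^sup>2 \<le> R\<^sup>2"
    using r by (intro power_mono) auto
  have \<theta>: "0 \<le> \<theta>" "\<theta> \<le> R\<^sup>2 / n"
    using n rR by (auto simp: \<theta>_def divide_right_mono)
  \<comment> \<open>By \<open>R\<^sup>2 \<le> 5 / 4\<close> and \<open>dim_le\<close>, the product
    of \<theta> and the dimension is at most 1/4.\<close>
  have exp2: "exp (\<theta> * DIM('v) / 2) \<le> 2"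
  proof -
    have "R\<^sup>2 / n \<le> (5 / 4) / n"
      using R n by (intro divide_right_mono) auto
    then have "\<theta> * DIM('v) \<le> (5 / 4) / n * (n / 5)"
      using \<theta> n dim_le by (intro mult_mono order.trans[OF \<theta>(2)]) auto
    then have "\<theta> * DIM('v) / 2 \<le> 1 / 2"
      using n by simp
    then have "exp (\<theta> * DIM('v) / 2) \<le> exp (1 / 2)"
      by simp
    also have "exp (1 / 2 :: real) \<le> 2"
      using exp_bound[of "1 / 2"] by (simp add: power2_eq_square)
    finally show ?thesis .
  qed
  have "(\<integral>\<^sup>+p. w (fst p + r *\<^sub>R X (snd p)) \<partial>(\<gamma> \<Otimes>\<^sub>M M))
      = (\<integral>\<^sup>+p. ennreal (weight r (X (snd p)) (fst p)) * w (fst p) \<partial>(\<gamma> \<Otimes>\<^sub>M M))"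
    using nn_integral_joint_shift[of "\<lambda>p. w (fst p)" r] by simp
  also have "\<dots> = (\<integral>\<^sup>+z. \<integral>\<^sup>+\<omega>. ennreal (weight r (X \<omega>) z) * w z \<partial>M \<partial>\<gamma>)"
    by (subst nn_integral_fst[symmetric]) simp_all
  also have "\<dots> = (\<integral>\<^sup>+z. ennreal (mass r z) * w z \<partial>\<gamma>)"
    unfolding mass_def
    by (intro nn_integral_cong, subst nn_integral_multc)
       (auto simp: nn_integral_eq_integral[OF integrable_weight] less_imp_le[OF weight_pos])
  also have "\<dots> \<le> (\<integral>\<^sup>+z. ennreal 2 * ennreal ((norm (mass r z *\<^sub>R (drift r z - \<kappa> *\<^sub>R z)))\<^sup>2) \<partial>\<gamma>)"
  proof (rule nn_integral_mono)
    fix z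
    have "1 = exp (- \<theta> * DIM('v) / 2) * exp (\<theta> * DIM('v) / 2)"
      by (simp add: exp_add[symmetric])
    also have "\<dots> \<le> mass r z * 2"
      using mass_lower_bound[of r z] exp2 mass_pos[of r z] by (intro mult_mono) (auto simp: \<theta>_def)
    finally have "mass r z * 1 \<le> mass r z * (mass r z * 2)"
      using mass_pos[of r z] by (intro mult_left_mono) auto
    then have "mass r z * (norm (drift r z - \<kappa> *\<^sub>R z))\<^sup>2 \<le> mass r z * (mass r z * 2) * (norm (drift r z - \<kappa> *\<^sub>R z))\<^sup>2"
      by (intro mult_right_mono) auto
    also have "\<dots> = 2 * (norm (mass r z *\<^sub>R (drift r z - \<kappa> *\<^sub>R z)))\<^sup>2"
      using mass_pos[of r z] by (simp add: power2_eq_square)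
    finally show "ennreal (mass r z) * w z \<le> ennreal 2 * ennreal ((norm (mass r z *\<^sub>R (drift r z - \<kappa> *\<^sub>R z)))\<^sup>2)"
      using mass_pos[of r z] unfolding w_def by (simp add: ennreal_mult'[symmetric] ennreal_leI del: ennreal_numeral norm_scaleR)
  qed
  also have "\<dots> = ennreal 2 * (\<integral>\<^sup>+z. ennreal ((norm (mass r z *\<^sub>R (drift r z - \<kappa> *\<^sub>R z)))\<^sup>2) \<partial>\<gamma>)"
    by (rule nn_integral_cmult) measurable
  also have "\<dots> \<le> ennreal 2 * ennreal (2 * \<theta>\<^sup>2 * DIM('v) * \<beta>\<^sup>2)"
    unfolding \<kappa>_def \<theta>_def by (intro mult_left_mono residual_second_moment[OF r]) simp
  also have "\<dots> = ennreal (4 * \<theta>\<^sup>2 * DIM('v) * \<beta>\<^sup>2)"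
    by (subst ennreal_mult'[symmetric]) (simp_all add: mult.assoc)
  also have "\<dots> \<le> ennreal (4 * (R\<^sup>2 / n)\<^sup>2 * DIM('v) * \<beta>\<^sup>2)"
    using \<theta> by (intro ennreal_leI mult_right_mono mult_left_mono power_mono) auto
  finally show ?thesis
    by (simp only: w_def)
qed

end

section \<open>The transport map and Gaussian vectors\<close>

text \<open>The derivative of \<open>l\<close> is \<open>- (l x * k x)\<close>, which is how the
  rescaling produces the regression term in the velocity. The first estimate on increments is the
  mean value theorem for \<open>l\<close>; the second applies it once more, to
  \<open>l x * k x\<close>. The constant dominates both \<open>R\<close>, which bounds that product,
  and \<open>1 + R\<^sup>2\<close>, which bounds its derivative.\<close>

lemma inverse_sqrt_taylor:
  fixes n R :: real
  assumes n: "1 \<le> n" and R: "0 \<le> R"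
  defines "l \<equiv> \<lambda>r. 1 / sqrt (1 + r\<^sup>2 / n)" and "k \<equiv> \<lambda>r. r / (n + r\<^sup>2)"
  assumes rs: "0 \<le> r" "r \<le> s" "s \<le> R"
  shows "0 \<le> l r" and "l r \<le> 1"
    and "\<bar>l s - l r\<bar> \<le> (R\<^sup>2 + R + 1) * (s - r)"
    and "\<bar>l s - l r + (s - r) * (l r * k r)\<bar> \<le> (R\<^sup>2 + R + 1) * (s - r)\<^sup>2"
proof -
  have pos: "0 < 1 + x\<^sup>2 / n" "0 < n + x\<^sup>2" for x
    using n by (auto intro: add_pos_nonneg)
  have l01: "0 \<le> l x" "l x \<le> 1" for x
  proof -
    have "1 \<le> sqrt (1 + x\<^sup>2 / n)"
      using n by simp
    then show "0 \<le> l x" "l x \<le> 1"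
      by (simp_all add: l_def divide_le_eq_1)
  qed
  show "0 \<le> l r" "l r \<le> 1"
    by (rule l01)+
  have k: "0 \<le> k x" "k x \<le> R" if "0 \<le> x" "x \<le> R" for x
  proof -
    show "0 \<le> k x"
      using that n by (simp add: k_def)
    have "x \<le> R * (n + x\<^sup>2)"
      using that n mult_mono[of x R 1 "n + x\<^sup>2"] by (simp add: add_increasing2)
    then show "k x \<le> R"
      using pos(2)[of x] by (simp add: k_def field_simps)
  qed
  have l': "(l has_real_derivative - (l x * k x)) (at x)" for x
  proof -
    have "((\<lambda>r. inverse (sqrt (1 + r\<^sup>2 / n))) has_real_derivative
        - (inverse (sqrt (1 + x\<^sup>2 / n)) * (inverse (sqrt (1 + x\<^sup>2 / n)) / 2 * (2 * x / n)) * inverse (sqrt (1 + x\<^sup>2 / n)))) (at x)"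
      using pos(1)[of x] n by (auto intro!: derivative_eq_intros)
    moreover have "inverse (sqrt (1 + x\<^sup>2 / n)) * (inverse (sqrt (1 + x\<^sup>2 / n)) / 2 * (2 * x / n)) * inverse (sqrt (1 + x\<^sup>2 / n))
        = l x * k x"
    proof -
      have "inverse (sqrt (1 + x\<^sup>2 / n)) * inverse (sqrt (1 + x\<^sup>2 / n)) = inverse (1 + x\<^sup>2 / n)"
        using pos(1)[of x] by (simp flip: inverse_mult_distrib real_sqrt_mult)
      moreover have "inverse (1 + x\<^sup>2 / n) * (x / n) = k x"
        using n pos[of x] by (simp add: k_def field_simps)
      moreover have "l x = inverse (sqrt (1 + x\<^sup>2 / n))"
        by (simp add: l_def inverse_eq_divide)
      moreover have "v * (v / 2 * (2 * x / n)) * v = v * (v * v * (x / n))" for v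
        by simp
      ultimately show ?thesis
        by (simp only:)
    qed
    ultimately show ?thesis
      by (simp add: l_def inverse_eq_divide)
  qed
  have k': "(k has_real_derivative (n - x\<^sup>2) / (n + x\<^sup>2)\<^sup>2) (at x)" for x
    unfolding k_def using pos(2)[of x]
    by (auto intro!: derivative_eq_intros simp: power2_eq_square)
  have lk': "((\<lambda>x. l x * k x) has_real_derivative
      (l x * ((n - x\<^sup>2) / (n + x\<^sup>2)\<^sup>2) + - (l x * k x) * k x)) (at x)" for x
    by (rule DERIV_mult'[OF l' k'])
  have lk'_bound: "\<bar>l x * ((n - x\<^sup>2) / (n + x\<^sup>2)\<^sup>2) + - (l x * k x) * k x\<bar> \<le> R\<^sup>2 + R + 1" if x: "0 \<le> x" "x \<le> R" for x
  proof -
    have "\<bar>(n - x\<^sup>2) / (n + x\<^sup>2)\<^sup>2\<bar> \<le> 1"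
    proof -
      have "\<bar>n - x\<^sup>2\<bar> \<le> n + x\<^sup>2"
        using n by (simp add: abs_le_iff)
      also have "\<dots> \<le> (n + x\<^sup>2)\<^sup>2"
        by (rule self_le_power) (use n in \<open>simp_all add: add_increasing2\<close>)
      finally show ?thesis
        using pos(2)[of x] by (simp add: abs_divide)
    qed
    then have "\<bar>l x * ((n - x\<^sup>2) / (n + x\<^sup>2)\<^sup>2)\<bar> \<le> 1 * 1"
      unfolding abs_mult using l01[of x] by (intro mult_mono) auto
    moreover have "\<bar>- (l x * k x) * k x\<bar> \<le> (1 * R) * R"
      unfolding abs_mult abs_minus using l01[of x] k[OF x] R by (intro mult_mono) auto
    ultimately have "\<bar>l x * ((n - x\<^sup>2) / (n + x\<^sup>2)\<^sup>2) + - (l x * k x) * k x\<bar> \<le> 1 * 1 + (1 * R) * R"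
      by (intro order.trans[OF abs_triangle_ineq add_mono])
    then show ?thesis
      using R by (simp add: power2_eq_square)
  qed
  have lk_bound: "\<bar>l x * k x\<bar> \<le> R\<^sup>2 + R + 1" if x: "0 \<le> x" "x \<le> R" for x
  proof -
    have "\<bar>l x * k x\<bar> \<le> 1 * R"
      unfolding abs_mult using l01[of x] k[OF x] by (intro mult_mono) auto
    then show ?thesis
      using zero_le_power2[of R] by linarith
  qed
  obtain \<xi> where \<xi>: "r \<le> \<xi>" "\<xi> \<le> s" "l s - l r = (s - r) * - (l \<xi> * k \<xi>)"
  proof (cases "r = s")
    case False
    then have "r < s"
      using rs by simp
    from MVT2[OF this l'] obtain z where "r < z" "z < s" "l s - l r = (s - r) * - (l z * k z)"
      by blast
    then show ?thesis
      by (intro that[of z]) simp_all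
  qed (use that in auto)
  have \<xi>R: "0 \<le> \<xi>" "\<xi> \<le> R"
    using \<xi> rs by auto
  show "\<bar>l s - l r\<bar> \<le> (R\<^sup>2 + R + 1) * (s - r)"
    unfolding \<xi>(3) abs_mult using lk_bound[OF \<xi>R] rs
    by (simp add: abs_mult mult.commute mult_left_mono)
  obtain \<zeta> where \<zeta>: "r \<le> \<zeta>" "\<zeta> \<le> \<xi>"
    "l \<xi> * k \<xi> - l r * k r = (\<xi> - r) * (l \<zeta> * ((n - \<zeta>\<^sup>2) / (n + \<zeta>\<^sup>2)\<^sup>2) + - (l \<zeta> * k \<zeta>) * k \<zeta>)"
  proof (cases "r = \<xi>")
    case False
    then have "r < \<xi>"
      using \<xi> by simp
    from MVT2[OF this lk'] obtain z where "r < z" "z < \<xi>"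
      "l \<xi> * k \<xi> - l r * k r = (\<xi> - r) * (l z * ((n - z\<^sup>2) / (n + z\<^sup>2)\<^sup>2) + - (l z * k z) * k z)"
      by blast
    then show ?thesis
      by (intro that[of z]) simp_all
  qed (use that in auto)
  have "l s - l r + (s - r) * (l r * k r) = - ((s - r) * (l \<xi> * k \<xi> - l r * k r))"
    by (simp add: \<xi>(3) algebra_simps)
  then have "\<bar>l s - l r + (s - r) * (l r * k r)\<bar> = (s - r) * \<bar>l \<xi> * k \<xi> - l r * k r\<bar>"
    using rs by (simp add: abs_mult)
  also have "\<dots> \<le> (s - r) * ((s - r) * (R\<^sup>2 + R + 1))"
  proof (rule mult_left_mono)
    show "\<bar>l \<xi> * k \<xi> - l r * k r\<bar> \<le> (s - r) * (R\<^sup>2 + R + 1)"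
      unfolding \<zeta>(3) abs_mult using \<zeta> \<xi> rs
      by (intro mult_mono lk'_bound) auto
  qed (use rs in simp)
  finally show "\<bar>l s - l r + (s - r) * (l r * k r)\<bar> \<le> (R\<^sup>2 + R + 1) * (s - r)\<^sup>2"
    by (simp add: power2_eq_square mult.commute mult.left_commute)
qed

context gaussian_smoothing
begin

theorem transport_map:
  assumes Rn: "R\<^sup>2 = n / (n - 1)"
  shows "\<exists>T\<in>borel_measurable borel.
    (\<integral>\<^sup>+z. ennreal ((norm (z - T z))\<^sup>2) \<partial>\<gamma>) \<le> ennreal (25 * DIM('v) * \<beta>\<^sup>2 / n\<^sup>2) \<and>
    distr \<gamma> borel T = distr (\<gamma> \<Otimes>\<^sub>M M) borel (\<lambda>p. (1 / R) *\<^sub>R fst p + X (snd p))"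
proof -
  have dim: "1 \<le> real DIM('v)"
    by (simp add: DIM_ge_Suc0)
  then have n5: "5 \<le> n"
    using dim_le by linarith
  define l where "l r = 1 / sqrt (1 + r\<^sup>2 / n)" for r
  define k where "k r = r / (n + r\<^sup>2)" for r
  have RR: "R \<in> {0..R}"
    using R by simp
  have [measurable]: "flow R \<in> borel_measurable borel"
    using flow_measurable[OF RR, of "\<lambda>x. x" borel] by simp
  define T where "T z = l R *\<^sub>R flow R z" for z
  have T [measurable]: "T \<in> borel_measurable borel"
    unfolding T_def by measurable
  \<comment> \<open>The final time is chosen so that the scaling factor is \<open>1 / R\<close>:
    then the scaled end point of Z + R X is Z / R + X, and Z / R has covariance \<open>n - 1\<close>
    times \<open>S\<close>.\<close>
  have "1 + R\<^sup>2 / n = R\<^sup>2"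
    using n5 unfolding Rn by (simp add: field_simps)
  then have lR: "l R = 1 / R"
    using R by (simp add: l_def)
  have Rpos: "0 < R"
    using R Rn n5 by (cases "R = 0") auto
  define S0 where "S0 = 4 * (R\<^sup>2 / n)\<^sup>2 * DIM('v) * \<beta>\<^sup>2"
  have fst_integral: "(\<integral>\<^sup>+p. f (fst p) \<partial>(\<gamma> \<Otimes>\<^sub>M M)) = (\<integral>\<^sup>+z. f z \<partial>\<gamma>)"
    if [measurable]: "f \<in> borel_measurable borel" for f
    by (subst nn_integral_fst[symmetric]) (simp_all add: emeasure_space_1)
  have "(\<integral>\<^sup>+p. ennreal ((norm (fst p - l R *\<^sub>R flow R (fst p)))\<^sup>2) \<partial>(\<gamma> \<Otimes>\<^sub>M M)) \<le> ennreal (2 * R\<^sup>2 * S0)"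
  proof (rule scaled_flow_cost[where k = k and K = "R\<^sup>2 + R + 1"])
    show "0 \<le> l r \<and> l r \<le> 1" if "r \<in> {0..R}" for r
      using inverse_sqrt_taylor(1,2)[of n R r r] that n5 R(1) by (simp add: l_def)
    show "\<bar>l s - l r\<bar> \<le> (R\<^sup>2 + R + 1) * (s - r)"
      and "\<bar>l s - l r + (s - r) * (l r * k r)\<bar> \<le> (R\<^sup>2 + R + 1) * (s - r)\<^sup>2"
      if "0 \<le> r" "r \<le> s" "s \<le> R" for r s
      using inverse_sqrt_taylor(3,4)[of n R r s] that n5 R(1) by (simp_all add: l_def k_def)
    show "(\<integral>\<^sup>+p. ennreal ((norm (drift r (fst p + r *\<^sub>R X (snd p)) - k r *\<^sub>R (fst p + r *\<^sub>R X (snd p))))\<^sup>2)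
        \<partial>(\<gamma> \<Otimes>\<^sub>M M)) \<le> ennreal S0" if "r \<in> {0..R}" for r
      unfolding k_def S0_def by (rule velocity_second_moment[OF that])
    have "(\<integral>\<^sup>+p. ennreal ((1 + norm (fst p))\<^sup>2) \<partial>(\<gamma> \<Otimes>\<^sub>M M)) = (\<integral>\<^sup>+z. ennreal ((1 + norm z)\<^sup>2) \<partial>\<gamma>)"
      by (rule fst_integral) measurable
    also have "\<dots> \<le> (\<integral>\<^sup>+z. ennreal (exp (2 * norm z)) \<partial>\<gamma>)"
    proof (rule nn_integral_mono, rule ennreal_leI)
      fix z :: 'v
      have "(1 + norm z)\<^sup>2 \<le> (exp (norm z))\<^sup>2"
        by (intro power_mono exp_ge_add_one_self) simp
      then show "(1 + norm z)\<^sup>2 \<le> exp (2 * norm z)"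
        by (simp add: exp_double)
    qed
    also have "\<dots> < \<infinity>"
      using integrable_exp_norm[of 2] by (simp add: nn_integral_eq_integral)
    finally show "(\<integral>\<^sup>+p. ennreal ((1 + norm (fst p))\<^sup>2) \<partial>(\<gamma> \<Otimes>\<^sub>M M)) < \<infinity>" .
  qed (auto simp: l_def S0_def add_nonneg_nonneg R)
  also have "(\<integral>\<^sup>+p. ennreal ((norm (fst p - l R *\<^sub>R flow R (fst p)))\<^sup>2) \<partial>(\<gamma> \<Otimes>\<^sub>M M))
      = (\<integral>\<^sup>+z. ennreal ((norm (z - T z))\<^sup>2) \<partial>\<gamma>)"
    unfolding T_def by (rule fst_integral) measurable
  also have "ennreal (2 * R\<^sup>2 * S0) \<le> ennreal (25 * DIM('v) * \<beta>\<^sup>2 / n\<^sup>2)"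
  proof (rule ennreal_leI)
    have "2 * R\<^sup>2 * S0 = 8 * (R\<^sup>2) ^ 3 * (DIM('v) * \<beta>\<^sup>2 / n\<^sup>2)"
      by (simp add: S0_def power_divide power2_eq_square power3_eq_cube)
    also have "\<dots> \<le> 8 * (5 / 4) ^ 3 * (DIM('v) * \<beta>\<^sup>2 / n\<^sup>2)"
      using R by (intro mult_right_mono mult_left_mono power_mono) auto
    also have "\<dots> \<le> 25 * (DIM('v) * \<beta>\<^sup>2 / n\<^sup>2)"
      by (intro mult_right_mono) (auto simp: power3_eq_cube)
    finally show "2 * R\<^sup>2 * S0 \<le> 25 * DIM('v) * \<beta>\<^sup>2 / n\<^sup>2"
      by simp
  qed
  finally have cost: "(\<integral>\<^sup>+z. ennreal ((norm (z - T z))\<^sup>2) \<partial>\<gamma>) \<le> ennreal (25 * DIM('v) * \<beta>\<^sup>2 / n\<^sup>2)" .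
  \<comment> \<open>The map acts on the Gaussian variable alone; passing to the product space makes
    \<open>flow_distr\<close> applicable.\<close>
  have "distr \<gamma> borel T = distr (distr (\<gamma> \<Otimes>\<^sub>M M) \<gamma> fst) borel T"
    by (simp only: distr_pair_fst)
  also have "\<dots> = distr (distr (\<gamma> \<Otimes>\<^sub>M M) borel (\<lambda>p. flow R (fst p))) borel (\<lambda>x. l R *\<^sub>R x)"
    by (subst (1 2) distr_distr) (auto simp: T_def o_def)
  also have "\<dots> = distr (\<gamma> \<Otimes>\<^sub>M M) borel (\<lambda>p. l R *\<^sub>R (fst p + R *\<^sub>R X (snd p)))"
    unfolding flow_distr[OF RR] by (subst distr_distr) (auto simp: o_def)
  also have "(\<lambda>p. l R *\<^sub>R (fst p + R *\<^sub>R X (snd p))) = (\<lambda>p :: 'v \<times> 'a. (1 / R) *\<^sub>R fst p + X (snd p))"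
    using Rpos by (simp add: lR scaleR_add_right)
  finally show ?thesis
    using cost T by blast
qed

end

section \<open>Symmetric matrices and the smallest eigenvalue\<close>

lemma symmetric_matrix_inner:
  fixes \<Sigma> :: "real ^ 'k ^ 'k"
  assumes "transpose \<Sigma> = \<Sigma>"
  shows "(\<Sigma> *v x) \<bullet> y = x \<bullet> (\<Sigma> *v y)"
  by (metis assms dot_lmul_matrix transpose_matrix_vector)

text \<open>The minimiser of the Rayleigh quotient is an eigenvector, so that the \<open>LEAST\<close> in the definition
  of the smallest eigenvalue is attained.\<close>

lemma smallest_eigenvalue_rayleigh:
  fixes \<Sigma> :: "real ^ 'k ^ 'k"
  assumes sym: "transpose \<Sigma> = \<Sigma>"
  shows "smallest_eigenvalue \<Sigma> * (norm x)\<^sup>2 \<le> x \<bullet> (\<Sigma> *v x)"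
proof -
  define g where "g x = x \<bullet> (\<Sigma> *v x)" for x
  have scale: "g (t *\<^sub>R x) = t\<^sup>2 * g x" for t x
    by (simp add: g_def matrix_vector_mult_scaleR power2_eq_square)
  have cont: "continuous_on (sphere 0 1) g"
    unfolding g_def
    by (intro continuous_intros linear_continuous_on linear_conv_bounded_linear[THEN iffD1] matrix_vector_mul_linear)
  obtain v0 :: "real ^ 'k" where "norm v0 = 1"
    using vector_choose_size[of 1] by auto
  then obtain v where v: "norm v = 1" and min: "\<And>u. norm u = 1 \<Longrightarrow> g v \<le> g u"
    using continuous_attains_inf[OF compact_sphere _ cont] by (auto simp: sphere_def dist_norm)
  have ray: "g v * (norm u)\<^sup>2 \<le> g u" for u
  proof (cases "u = 0")
    case False
    then have "g v \<le> g ((1 / norm u) *\<^sub>R u)"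
      by (intro min) simp
    then show ?thesis
      using False unfolding scale by (simp add: power_divide field_simps)
  qed (simp add: g_def)
  \<comment> \<open>The residual \<open>d\<close> measures how far \<open>v\<close> is from being an
    eigenvector; if it were nonzero, a small step from \<open>v\<close> against \<open>d\<close>
    would lower the Rayleigh quotient.\<close>
  define d where "d = \<Sigma> *v v - g v *\<^sub>R v"
  have "d = 0"
  proof (rule ccontr)
    assume "d \<noteq> 0"
    define D where "D = d \<bullet> d"
    define e where "e = g d - g v * (norm d)\<^sup>2"
    have D: "0 < D"
      using \<open>d \<noteq> 0\<close> by (simp add: D_def)
    have quad: "0 \<le> 2 * t * D + t\<^sup>2 * e" for t
    proof -
      have "g v * (norm (v + t *\<^sub>R d))\<^sup>2 \<le> g (v + t *\<^sub>R d)"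
        by (rule ray)
      moreover have "g (v + t *\<^sub>R d) = g v + 2 * t * (d \<bullet> (\<Sigma> *v v)) + t\<^sup>2 * g d"
        using symmetric_matrix_inner[OF sym, of v d]
        by (simp add: g_def matrix_vector_right_distrib matrix_vector_mult_scaleR inner_add
            power2_eq_square inner_commute algebra_simps)
      moreover have "(norm (v + t *\<^sub>R d))\<^sup>2 = 1 + 2 * t * (d \<bullet> v) + t\<^sup>2 * (norm d)\<^sup>2"
        using v unfolding power2_norm_eq_inner
        by (simp add: inner_add norm_eq_1 inner_commute power2_eq_square algebra_simps)
      moreover have "d \<bullet> (\<Sigma> *v v) = D + g v * (d \<bullet> v)"
        by (simp add: D_def d_def[symmetric] inner_diff_right flip: inner_scaleR_right inner_add_right)
           (simp add: d_def)
      ultimately show ?thesis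
        by (simp add: e_def algebra_simps)
    qed
    \<comment> \<open>With this choice \<open>t\<^sup>2 * (\<bar>e\<bar> + 1) = - t * D\<close>, so
      the quadratic term consumes at most half of the linear term \<open>2 * t * D\<close>.\<close>
    define t where "t = - D / (\<bar>e\<bar> + 1)"
    have t: "t < 0"
      using D by (simp add: t_def)
    have "t\<^sup>2 * e \<le> t\<^sup>2 * \<bar>e\<bar>"
      by (intro mult_left_mono) auto
    also have "\<dots> \<le> t\<^sup>2 * (\<bar>e\<bar> + 1)"
      by (intro mult_left_mono) auto
    also have "\<dots> = - t * D"
      by (simp add: t_def power2_eq_square)
    finally have "2 * t * D + t\<^sup>2 * e \<le> t * D"
      unfolding minus_mult_left[symmetric] mult.assoc by linarith
    also have "\<dots> < 0"
      using t D by (rule mult_neg_pos)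
    finally show False
      using quad[of t] by simp
  qed
  then have "matrix_eigenvalue \<Sigma> (g v)"
    using v unfolding matrix_eigenvalue_def d_def by (intro exI[of _ v]) auto
  moreover have "g v \<le> l" if eig: "matrix_eigenvalue \<Sigma> l" for l
  proof -
    obtain u where u: "u \<noteq> 0" "\<Sigma> *v u = l *\<^sub>R u"
      using eig by (auto simp: matrix_eigenvalue_def)
    have "g v * (norm u)\<^sup>2 \<le> l * (norm u)\<^sup>2"
      using ray[of u] by (simp add: g_def u(2) power2_norm_eq_inner)
    then show ?thesis
      using u(1) by simp
  qed
  ultimately have "smallest_eigenvalue \<Sigma> = g v"
    unfolding smallest_eigenvalue_def by (rule Least_equality)
  then show ?thesis
    using ray[of x] by (simp add: g_def)
qed

section \<open>Gaussian laws, Gaussian vectors and their moments\<close>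

lemma gaussian_law_affine:
  assumes "gaussian_law \<mu>"
  obtains m s where "\<mu> = distr std_gauss borel (\<lambda>x. m + s * x)"
  using assms unfolding gaussian_law_def
proof (elim disjE exE conjE)
  fix m assume "\<mu> = return borel m"
  \<comment> \<open>A point mass is the affine image with slope 0, so degenerate and nondegenerate
    laws share the later moment computations.\<close>
  moreover have "distr (std_gauss :: real measure) borel (\<lambda>x. m + 0 * x) = return borel m"
    by (simp add: std_gauss.distr_const)
  ultimately show ?thesis
    using that by metis
next
  fix m s :: real
  assume s: "0 < s" and \<mu>: "\<mu> = density lborel (\<lambda>x. ennreal (normal_density m s x))"
  have "distributed (std_gauss :: real measure) lborel (\<lambda>x. x) std_normal_density"
    unfolding distributed_def std_gauss_real
    by (auto intro!: distr_id2 simp: distr_id2)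
  then have "distributed (std_gauss :: real measure) lborel (\<lambda>x. m + s * x) (normal_density (m + s * 0) (\<bar>s\<bar> * 1))"
    using s by (intro std_gauss.normal_density_affine) auto
  then have "distr (std_gauss :: real measure) lborel (\<lambda>x. m + s * x) = \<mu>"
    using s by (simp add: \<mu> distributed_distr_eq_density)
  then show ?thesis
    using that[of m s] by (simp cong: distr_cong)
qed

text \<open>Everything is pulled back to \<open>m + s * x\<close> under the standard Gaussian.
  Expressing the exponential moment through the second moment eliminates \<open>s\<close>, and the
  second moment of a linear functional is what the covariance matrix provides.\<close>

lemma (in prob_space) gaussian_law_moments:
  assumes Y [measurable]: "Y \<in> borel_measurable M" and gauss: "gaussian_law (distr M borel Y)"
  shows "integrable M Y" and "integrable M (\<lambda>\<omega>. (Y \<omega>)\<^sup>2)" and "integrable M (\<lambda>\<omega>. exp (Y \<omega>))"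
    and "expectation Y = 0 \<Longrightarrow> expectation (\<lambda>\<omega>. exp (Y \<omega>)) = exp (expectation (\<lambda>\<omega>. (Y \<omega>)\<^sup>2) / 2)"
proof -
  obtain m s where ms: "distr M borel Y = distr std_gauss borel (\<lambda>x. m + s * x)"
    using gauss by (rule gaussian_law_affine)
  have integral: "expectation (\<lambda>\<omega>. h (Y \<omega>)) = (\<integral>x. h (m + s * x) \<partial>std_gauss)"
    and integrable: "integrable M (\<lambda>\<omega>. h (Y \<omega>)) \<longleftrightarrow> integrable std_gauss (\<lambda>x. h (m + s * x))"
    if [measurable]: "h \<in> borel_measurable borel" for h :: "real \<Rightarrow> real"
  proof -
    have "expectation (\<lambda>\<omega>. h (Y \<omega>)) = (\<integral>x. h x \<partial>distr M borel Y)"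
      by (rule integral_distr[symmetric]) measurable
    also have "\<dots> = (\<integral>x. h (m + s * x) \<partial>std_gauss)"
      unfolding ms by (rule integral_distr) measurable
    finally show "expectation (\<lambda>\<omega>. h (Y \<omega>)) = (\<integral>x. h (m + s * x) \<partial>std_gauss)" .
    have "integrable M (\<lambda>\<omega>. h (Y \<omega>)) \<longleftrightarrow> integrable (distr M borel Y) h"
      by (rule integrable_distr_eq[symmetric]) measurable
    also have "\<dots> \<longleftrightarrow> integrable std_gauss (\<lambda>x. h (m + s * x))"
      unfolding ms by (rule integrable_distr_eq) measurable
    finally show "integrable M (\<lambda>\<omega>. h (Y \<omega>)) \<longleftrightarrow> integrable std_gauss (\<lambda>x. h (m + s * x))" .
  qed
  have int: "integrable std_gauss (\<lambda>x :: real. x)" "integrable std_gauss (\<lambda>x :: real. x\<^sup>2)"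
    using integrable_std_normal_distribution_moment[of 1] integrable_std_normal_distribution_moment[of 2]
    by (simp_all add: std_gauss_real)
  have val: "(\<integral>x. x \<partial>std_gauss) = (0 :: real)" "(\<integral>x. x\<^sup>2 \<partial>std_gauss) = (1 :: real)"
    using integral_std_normal_distribution_moment_odd[of 1] std_normal_distribution_even_moments(1)[of 1]
    by (simp_all add: std_gauss_real)
  have prob1: "measure (std_gauss :: real measure) UNIV = 1"
    using std_gauss.prob_space[where 'v = real] by simp
  have exp_eq: "exp (m + s * x) = exp m * exp (s \<bullet> x)" for x
    by (simp only: exp_add inner_real_def)
  have exp_meas: "(exp :: real \<Rightarrow> real) \<in> borel_measurable borel"
    by measurable
  have id_meas: "(\<lambda>x :: real. x) \<in> borel_measurable borel" and sq_meas: "(\<lambda>x :: real. x\<^sup>2) \<in> borel_measurable borel"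
    by measurable
  have sq_eq: "(m + s * x)\<^sup>2 = m\<^sup>2 + (2 * m * s) * x + s\<^sup>2 * x\<^sup>2" for x
    by (simp add: power2_eq_square algebra_simps)
  have const: "integrable (std_gauss :: real measure) (\<lambda>x. a)" for a :: real
    by simp
  show "integrable M Y"
    by (rule integrable[OF id_meas, THEN iffD2])
       (intro Bochner_Integration.integrable_add integrable_mult_right const int)
  show "integrable M (\<lambda>\<omega>. (Y \<omega>)\<^sup>2)"
    unfolding integrable[OF sq_meas] sq_eq
    by (intro Bochner_Integration.integrable_add integrable_mult_right const int)
  show "integrable M (\<lambda>\<omega>. exp (Y \<omega>))"
    unfolding integrable[OF exp_meas] exp_eq
    by (intro integrable_mult_right std_gauss_mgf_integral(1))
  assume "expectation Y = 0"
  moreover have "(\<integral>x. m + s * x \<partial>std_gauss) = m"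
    using int const by (simp add: prob1 val)
  ultimately have m: "m = 0"
    using integral[OF id_meas] by simp
  have "expectation (\<lambda>\<omega>. (Y \<omega>)\<^sup>2) = s\<^sup>2"
    unfolding integral[OF sq_meas] using int val by (simp add: m power_mult_distrib)
  moreover have "expectation (\<lambda>\<omega>. exp (Y \<omega>)) = exp (s\<^sup>2 / 2)"
    unfolding integral[OF exp_meas] exp_eq integral_mult_right_zero std_gauss_mgf_integral(2)
    by (simp add: m)
  ultimately show "expectation (\<lambda>\<omega>. exp (Y \<omega>)) = exp (expectation (\<lambda>\<omega>. (Y \<omega>)\<^sup>2) / 2)"
    by simp
qed

lemma (in prob_space) integrable_euclidean:
  fixes W :: "'a \<Rightarrow> 'v::euclidean_space"
  assumes "\<And>b. integrable M (\<lambda>\<omega>. b \<bullet> W \<omega>)"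
  shows "integrable M W"
proof -
  have "integrable M (\<lambda>\<omega>. \<Sum>b\<in>Basis. (b \<bullet> W \<omega>) *\<^sub>R b)"
    by (intro Bochner_Integration.integrable_sum integrable_scaleR_left assms)
  then show ?thesis
    by (simp only: inner_commute[of _ "W _"] euclidean_representation)
qed

lemma (in prob_space) covariance_bilinear:
  fixes W :: "'a \<Rightarrow> real ^ 'k"
  assumes sq: "\<And>u. integrable M (\<lambda>\<omega>. (u \<bullet> W \<omega>)\<^sup>2)" and mean0: "mean M W = 0"
  shows "integrable M (\<lambda>\<omega>. (a \<bullet> W \<omega>) * (b \<bullet> W \<omega>))"
    and "expectation (\<lambda>\<omega>. (a \<bullet> W \<omega>) * (b \<bullet> W \<omega>)) = a \<bullet> (covariance_matrix M W *v b)"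
proof -
  show int: "integrable M (\<lambda>\<omega>. (a \<bullet> W \<omega>) * (b \<bullet> W \<omega>))" for a b
  proof -
    \<comment> \<open>Polarisation reduces products to squares of linear functionals.\<close>
    have "integrable M (\<lambda>\<omega>. (((a + b) \<bullet> W \<omega>)\<^sup>2 - (a \<bullet> W \<omega>)\<^sup>2 - (b \<bullet> W \<omega>)\<^sup>2) / 2)"
      by (intro integrable_divide Bochner_Integration.integrable_diff sq)
    then show ?thesis
      by (simp add: inner_add_left power2_sum)
  qed
  have int_ij: "integrable M (\<lambda>\<omega>. W \<omega> $ i * W \<omega> $ j)" for i j
    using int[of "axis i 1" "axis j 1"] by (simp add: inner_axis')
  have "expectation (\<lambda>\<omega>. (a \<bullet> W \<omega>) * (b \<bullet> W \<omega>))
      = expectation (\<lambda>\<omega>. \<Sum>i\<in>UNIV. \<Sum>j\<in>UNIV. (a $ i * b $ j) * (W \<omega> $ i * W \<omega> $ j))"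
    by (simp add: inner_vec_def sum_product mult.assoc mult.left_commute)
  also have "\<dots> = (\<Sum>i\<in>UNIV. \<Sum>j\<in>UNIV. (a $ i * b $ j) * covariance_matrix M W $ i $ j)"
    using int_ij by (simp add: Bochner_Integration.integral_sum covariance_matrix_def mean0)
  also have "\<dots> = a \<bullet> (covariance_matrix M W *v b)"
    by (simp add: inner_vec_def matrix_vector_mult_def sum_distrib_left mult.assoc mult.left_commute mult.commute)
  finally show "expectation (\<lambda>\<omega>. (a \<bullet> W \<omega>) * (b \<bullet> W \<omega>)) = a \<bullet> (covariance_matrix M W *v b)" .
qed

lemma transpose_covariance_matrix: "transpose (covariance_matrix M W) = covariance_matrix M W"
  by (simp add: covariance_matrix_def transpose_def vec_eq_iff mult.commute)

lemma (in prob_space) gaussian_vector_moments: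
  fixes W :: "'a \<Rightarrow> real ^ 'k"
  assumes gauss: "gaussian_vector M W" and mean0: "mean M W = 0"
  shows "integrable M (\<lambda>\<omega>. u \<bullet> W \<omega>)" and "integrable M (\<lambda>\<omega>. (u \<bullet> W \<omega>)\<^sup>2)"
    and "expectation (\<lambda>\<omega>. u \<bullet> W \<omega>) = 0"
    and "integrable M (\<lambda>\<omega>. exp (u \<bullet> W \<omega>))"
    and "expectation (\<lambda>\<omega>. exp (u \<bullet> W \<omega>)) = exp (u \<bullet> (covariance_matrix M W *v u) / 2)"
proof -
  have [measurable]: "W \<in> borel_measurable M" and law: "gaussian_law (distr M borel (\<lambda>\<omega>. u \<bullet> W \<omega>))" for u
    using gauss by (auto simp: gaussian_vector_def)
  have meas: "(\<lambda>\<omega>. u \<bullet> W \<omega>) \<in> borel_measurable M" for u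
    by measurable
  note moments = gaussian_law_moments[OF meas law]
  show int: "integrable M (\<lambda>\<omega>. u \<bullet> W \<omega>)" and sq: "integrable M (\<lambda>\<omega>. (u \<bullet> W \<omega>)\<^sup>2)"
    and "integrable M (\<lambda>\<omega>. exp (u \<bullet> W \<omega>))" for u
    by (rule moments)+
  \<comment> \<open>Integrals of non-integrable functions default to 0, so the inner product can be
    moved out of the mean only once \<open>W\<close> itself is known to be integrable.\<close>
  have "expectation (\<lambda>\<omega>. u \<bullet> W \<omega>) = u \<bullet> expectation W"
    using integrable_euclidean[OF int] by simp
  then show E0: "expectation (\<lambda>\<omega>. u \<bullet> W \<omega>) = 0"
    using mean0 by (simp add: mean_def)
  show "expectation (\<lambda>\<omega>. exp (u \<bullet> W \<omega>)) = exp (u \<bullet> (covariance_matrix M W *v u) / 2)"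
    using moments(4)[OF E0] covariance_bilinear(2)[OF sq mean0, of u u] by (simp add: power2_eq_square)
qed

lemma ennreal_sqrt_le:
  assumes "x \<le> ennreal y" "0 \<le> y"
  shows "ennreal_sqrt x \<le> ennreal (sqrt y)"
proof -
  have "x \<noteq> \<top>"
    using assms(1) by (metis ennreal_neq_top top.extremum_uniqueI)
  moreover have "enn2real x \<le> y"
    using assms by (rule enn2real_leI[rotated])
  ultimately show ?thesis
    by (simp add: ennreal_sqrt_def ennreal_leI)
qed

lemma (in prob_space) integrable_exp_inner_bounded:
  fixes X :: "'a \<Rightarrow> 'v::euclidean_space"
  assumes [measurable]: "X \<in> borel_measurable M" and X: "\<And>\<omega>. norm (X \<omega>) \<le> \<beta>"
  shows "integrable M (\<lambda>\<omega>. exp (b \<bullet> X \<omega>))"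
proof (rule integrable_const_bound)
  show "AE \<omega> in M. norm (exp (b \<bullet> X \<omega>)) \<le> exp (norm b * \<beta>)"
  proof (rule AE_I2)
    fix \<omega>
    have "b \<bullet> X \<omega> \<le> norm b * norm (X \<omega>)"
      by (rule norm_cauchy_schwarz)
    also have "\<dots> \<le> norm b * \<beta>"
      using X by (intro mult_left_mono) auto
    finally show "norm (exp (b \<bullet> X \<omega>)) \<le> exp (norm b * \<beta>)"
      by simp
  qed
qed measurable

text \<open>This is the Cameron-Martin formula. Tilting by \<open>v = (1 / N) *\<^sub>R A a\<close>
  moves the exponential moment from \<open>b\<close> to \<open>b + v\<close>; since
  \<open>S v = (1 / N) *\<^sub>R a\<close>, completing the square yields the factor
  \<open>exp (b \<bullet> a)\<close> of the translated law. Uniqueness from exponential moments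
  replaces a computation with Lebesgue densities.\<close>

lemma gaussian_translation_density:
  fixes \<gamma> :: "'v::euclidean_space measure" and S A :: "'v \<Rightarrow> 'v"
  assumes "prob_space \<gamma>" and sets_\<gamma>: "sets \<gamma> = sets borel"
    and linear_S: "linear S" and SA: "\<And>x. S (A x) = x" and S_sym: "\<And>x y. S x \<bullet> y = x \<bullet> S y" and N: "0 < N"
    and \<gamma>_exp: "\<And>u. integrable \<gamma> (\<lambda>z. exp (u \<bullet> z))" "\<And>u. (\<integral>z. exp (u \<bullet> z) \<partial>\<gamma>) = exp (N * (u \<bullet> S u) / 2)"
  shows "distr \<gamma> borel (\<lambda>z. z + a) = density \<gamma> (\<lambda>z. ennreal (exp (A a \<bullet> z / N - a \<bullet> A a / (2 * N))))"
proof -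
  interpret \<gamma>: prob_space \<gamma> by fact
  note [measurable_cong] = sets_\<gamma>
  define k where "k = exp (- (a \<bullet> A a / (2 * N)))"
  define v where "v = (1 / N) *\<^sub>R A a"
  have dens: "exp (A a \<bullet> z / N - a \<bullet> A a / (2 * N)) = k * exp (v \<bullet> z)" for z
    by (simp add: k_def v_def mult_exp_exp)
  have Sv: "S v = (1 / N) *\<^sub>R a"
    by (simp add: v_def linear_scale[OF linear_S] SA)
  have quad: "k * exp (N * ((b + v) \<bullet> S (b + v)) / 2) = exp (b \<bullet> a) * exp (N * (b \<bullet> S b) / 2)" for b
  proof -
    have "v \<bullet> S b = b \<bullet> S v"
      using S_sym[of v b] by (simp add: inner_commute)
    then have "(b + v) \<bullet> S (b + v) = b \<bullet> S b + 2 * (b \<bullet> S v) + v \<bullet> S v"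
      by (simp add: linear_add[OF linear_S] inner_add)
    also have "\<dots> = b \<bullet> S b + 2 * (b \<bullet> a) / N + (a \<bullet> A a) / N\<^sup>2"
      unfolding Sv by (simp add: v_def inner_commute power2_eq_square)
    finally have "N * ((b + v) \<bullet> S (b + v)) / 2 - a \<bullet> A a / (2 * N) = b \<bullet> a + N * (b \<bullet> S b) / 2"
      using N by (simp add: field_simps power2_eq_square)
    then show ?thesis
      unfolding k_def exp_add[symmetric] by (simp add: algebra_simps)
  qed
  let ?D = "density \<gamma> (\<lambda>z. ennreal (exp (A a \<bullet> z / N - a \<bullet> A a / (2 * N))))"
  have D_integrable: "integrable ?D (\<lambda>z. exp (b \<bullet> z))"
    and D_integral: "(\<integral>z. exp (b \<bullet> z) \<partial>?D) = exp (b \<bullet> a) * exp (N * (b \<bullet> S b) / 2)" for b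
  proof -
    have prod: "exp (A a \<bullet> z / N - a \<bullet> A a / (2 * N)) *\<^sub>R exp (b \<bullet> z) = k * exp ((b + v) \<bullet> z)" for z
      by (simp only: dens inner_add_left exp_add real_scaleR_def mult.assoc mult.commute[of "exp (b \<bullet> z)"])
    show "integrable ?D (\<lambda>z. exp (b \<bullet> z))"
      by (subst integrable_density) (simp_all only: prod, simp_all add: \<gamma>_exp)
    have "(\<integral>z. exp (b \<bullet> z) \<partial>?D) = (\<integral>z. k * exp ((b + v) \<bullet> z) \<partial>\<gamma>)"
      by (subst integral_density) (simp_all only: prod, simp_all)
    also have "\<dots> = k * exp (N * ((b + v) \<bullet> S (b + v)) / 2)"
      by (simp only: integral_mult_right_zero \<gamma>_exp)
    finally show "(\<integral>z. exp (b \<bullet> z) \<partial>?D) = exp (b \<bullet> a) * exp (N * (b \<bullet> S b) / 2)"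
      by (simp only: quad)
  qed
  show ?thesis
  proof (rule measure_eqI_mgf)
    show "prob_space (distr \<gamma> borel (\<lambda>z. z + a))"
      by (rule \<gamma>.prob_space_distr) measurable
    show "prob_space ?D"
    proof
      have "emeasure ?D (space ?D) = (\<integral>\<^sup>+z. ennreal (exp (0 \<bullet> z)) \<partial>?D)"
        by simp
      also have "\<dots> = ennreal (\<integral>z. exp (0 \<bullet> z) \<partial>?D)"
        by (rule nn_integral_eq_integral[OF D_integrable]) simp
      also have "\<dots> = 1"
        by (simp only: D_integral) simp
      finally show "emeasure ?D (space ?D) = 1" .
    qed
    fix b
    have eq: "exp (b \<bullet> (z + a)) = exp (b \<bullet> a) * exp (b \<bullet> z)" for z
      by (simp only: inner_add_right exp_add mult.commute)
    show "integrable (distr \<gamma> borel (\<lambda>z. z + a)) (\<lambda>z. exp (b \<bullet> z))"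
      by (subst integrable_distr_eq) (simp_all only: eq, simp_all add: \<gamma>_exp)
    show "(\<integral>z. exp (b \<bullet> z) \<partial>distr \<gamma> borel (\<lambda>z. z + a)) = (\<integral>z. exp (b \<bullet> z) \<partial>?D)"
      unfolding D_integral by (subst integral_distr) (simp_all only: eq, simp_all add: \<gamma>_exp)
    show "integrable ?D (\<lambda>z. exp (b \<bullet> z))"
      by (rule D_integrable)
  qed (simp_all add: sets_\<gamma>)
qed

theorem lemma1p6:
  fixes M :: "'a measure"
    and X :: "'a \<Rightarrow> real ^ 'k"
    and Z :: "real \<Rightarrow> 'a \<Rightarrow> real ^ 'k"
    and \<Sigma> :: "real ^ 'k ^ 'k"
    and \<beta> :: real
    and n :: nat
  assumes "prob_space M"
    and "X \<in> borel_measurable M"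
    and "AE \<omega> in M. norm (X \<omega>) \<le> \<beta>"
    and "mean M X = 0"
    and "covariance_matrix M X = \<Sigma>"
    and "smallest_eigenvalue \<Sigma> > 0"
    and "\<And>t. t \<ge> 0 \<Longrightarrow> gaussian_vector M (Z t)"
    and "\<And>t. t \<ge> 0 \<Longrightarrow> mean M (Z t) = 0"
    and "\<And>t. t \<ge> 0 \<Longrightarrow> covariance_matrix M (Z t) = t *\<^sub>R \<Sigma>"
    and "\<And>t. t \<ge> 0 \<Longrightarrow> prob_space.indep_var M borel (Z t) borel X"
    and "n > 0"
    and "real n \<ge> 5 * \<beta>\<^sup>2 / smallest_eigenvalue \<Sigma>"
  shows "wasserstein2 (distr M borel (Z (real n)))
           (distr M borel (\<lambda>\<omega>. Z (real n - 1) \<omega> + X \<omega>))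
         \<le> ennreal (5 * sqrt (real CARD('k)) * \<beta> / real n)"
proof -
  interpret prob_space M by fact
  note [measurable] = \<open>X \<in> borel_measurable M\<close>
  define N where "N = real n"
  define s where "s = smallest_eigenvalue \<Sigma>"
  define S where "S x = \<Sigma> *v x" for x
  \<comment> \<open>Replacing \<open>X\<close> by 0 where the bound fails makes it hold everywhere,
    as the locale demands; mean, covariance and law stay the same.\<close>
  define X' where "X' \<omega> = (if norm (X \<omega>) \<le> \<beta> then X \<omega> else 0)" for \<omega>
  define \<gamma> where "\<gamma> = distr M borel (Z N)"
  define R where "R = sqrt (N / (N - 1))"
  have s: "0 < s"
    using assms(6) by (simp add: s_def)
  have N: "0 < N" "5 * \<beta>\<^sup>2 / s \<le> N"
    using assms(11,12) by (simp_all add: N_def s_def)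
  have [measurable]: "X' \<in> borel_measurable M"
    unfolding X'_def by measurable
  have XX': "AE \<omega> in M. X' \<omega> = X \<omega>"
    using assms(3) by eventually_elim (simp add: X'_def)
  have "AE \<omega> in M. 0 \<le> \<beta>"
    using assms(3) by eventually_elim (use norm_ge_zero order.trans in blast)
  then have \<beta>: "0 \<le> \<beta>"
    by simp
  have X'_bound: "norm (X' \<omega>) \<le> \<beta>" for \<omega>
    using \<beta> by (simp add: X'_def)
  have intX': "integrable M X'"
    by (rule integrable_const_bound[where B = \<beta>]) (use X'_bound in auto)
  have "(\<integral>\<omega>. X' \<omega> \<partial>M) = (\<integral>\<omega>. X \<omega> \<partial>M)"
    by (rule integral_cong_AE) (use XX' in auto)
  then have mean_X': "mean M X' = 0"
    using assms(4) by (simp add: mean_def)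
  have cov_X': "covariance_matrix M X' = \<Sigma>"
  proof -
    have "expectation (\<lambda>\<omega>. X' \<omega> $ i * X' \<omega> $ j) = expectation (\<lambda>\<omega>. X \<omega> $ i * X \<omega> $ j)" for i j
      unfolding cart_eq_inner_axis by (rule integral_cong_AE) (use XX' in auto)
    then show ?thesis
      unfolding assms(5)[symmetric] by (simp add: covariance_matrix_def mean_X' assms(4))
  qed
  have X'_inner: "\<bar>u \<bullet> X' \<omega>\<bar> \<le> norm u * \<beta>" for u \<omega>
    using Cauchy_Schwarz_ineq2[of u "X' \<omega>"] X'_bound[of \<omega>] by (meson mult_left_mono norm_ge_zero order.trans)
  have X'_sq: "(u \<bullet> X' \<omega>)\<^sup>2 \<le> (norm u * \<beta>)\<^sup>2" for u \<omega>
    using power_mono[OF X'_inner[of u \<omega>], of 2] by simp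
  have X'_sq_int: "integrable M (\<lambda>\<omega>. (u \<bullet> X' \<omega>)\<^sup>2)" for u
    by (rule integrable_const_bound[where B = "(norm u * \<beta>)\<^sup>2"]) (use X'_sq in auto)
  have X'_mean: "expectation (\<lambda>\<omega>. u \<bullet> X' \<omega>) = 0" for u
    using intX' mean_X' by (simp add: mean_def)
  have X'_cov: "expectation (\<lambda>\<omega>. (a \<bullet> X' \<omega>) * (b \<bullet> X' \<omega>)) = a \<bullet> S b" for a b
    using covariance_bilinear(2)[OF X'_sq_int mean_X'] by (simp add: cov_X' S_def)
  have sym: "transpose \<Sigma> = \<Sigma>"
    using transpose_covariance_matrix[of M X] by (simp add: assms(5))
  have coercive: "s * (norm x)\<^sup>2 \<le> x \<bullet> S x" for x
    unfolding s_def S_def by (rule smallest_eigenvalue_rayleigh[OF sym])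
  \<comment> \<open>A vector in the kernel is 0 by coercivity; the inverse matrix supplies
    \<open>A\<close>.\<close>
  have "invertible \<Sigma>"
  proof -
    have "x = 0" if "\<Sigma> *v x = 0" for x
    proof -
      have "s * (norm x)\<^sup>2 \<le> 0"
        using coercive[of x] that by (simp add: S_def)
      then show ?thesis
        using s by (simp add: mult_le_0_iff)
    qed
    then show ?thesis
      using matrix_left_invertible_ker[of \<Sigma>] by (auto simp: invertible_left_inverse)
  qed
  then obtain B where B: "\<Sigma> ** B = mat 1"
    by (auto simp: invertible_def)
  define A where "A x = B *v x" for x
  have SA: "S (A x) = x" for x
    by (simp add: S_def A_def matrix_vector_mul_assoc B)
  have S_sym: "S x \<bullet> y = x \<bullet> S y" for x y
    unfolding S_def by (rule symmetric_matrix_inner[OF sym])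
  have linear: "linear S" "linear A"
    unfolding S_def A_def by (rule matrix_vector_mul_linear)+
  \<comment> \<open>One unit vector already gives \<open>5 * s \<le> N * s\<close>. This has to come
    before the locale is entered, to make sense of \<open>R\<close> and to bound its square by
    5/4.\<close>
  have N5: "5 \<le> N"
  proof -
    obtain e :: "real ^ 'k" where e: "norm e = 1"
      using vector_choose_size[of 1] by auto
    have "s \<le> e \<bullet> S e"
      using coercive[of e] e by simp
    also have "\<dots> = expectation (\<lambda>\<omega>. (e \<bullet> X' \<omega>)\<^sup>2)"
      using X'_cov[of e e] by (simp add: power2_eq_square)
    also have "\<dots> \<le> \<beta>\<^sup>2"
      by (rule integral_le_const[OF X'_sq_int]) (use X'_sq[of e] e in auto)
    finally have "5 * s \<le> 5 * \<beta>\<^sup>2"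
      by simp
    also have "\<dots> \<le> N * s"
      using N s by (simp add: field_simps)
    finally show ?thesis
      using s by simp
  qed
  have R2: "R\<^sup>2 = N / (N - 1)"
    using N5 by (simp add: R_def)
  have Z_meas [measurable]: "Z t \<in> borel_measurable M" if "0 \<le> t" for t
    using assms(7)[OF that] by (simp add: gaussian_vector_def)
  have Z_exp: "integrable M (\<lambda>\<omega>. exp (u \<bullet> Z t \<omega>))"
    "expectation (\<lambda>\<omega>. exp (u \<bullet> Z t \<omega>)) = exp (t * (u \<bullet> S u) / 2)" if "0 \<le> t" for u t
    using gaussian_vector_moments(4,5)[OF assms(7,8)[OF that], of u] assms(9)[OF that]
    by (simp_all add: S_def scaleR_matrix_vector_assoc[symmetric])
  have N0: "0 \<le> N" "0 \<le> N - 1"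
    using N5 by auto
  have ZN [measurable]: "Z N \<in> borel_measurable M"
    by (rule Z_meas[OF N0(1)])
  have mgf: "integrable \<gamma> (\<lambda>z. exp (u \<bullet> z))" "(\<integral>z. exp (u \<bullet> z) \<partial>\<gamma>) = exp (N * (u \<bullet> S u) / 2)" for u
    using Z_exp[OF N0(1), of u] by (simp_all add: \<gamma>_def integrable_distr_eq integral_distr)
  interpret \<gamma>: prob_space \<gamma>
    unfolding \<gamma>_def by (rule prob_space_distr) measurable
  have sets_\<gamma> [measurable_cong, simp]: "sets \<gamma> = sets borel"
    by (simp add: \<gamma>_def)
  have shift: "distr \<gamma> borel (\<lambda>z. z + a)
      = density \<gamma> (\<lambda>z. ennreal (exp (A a \<bullet> z / N - a \<bullet> A a / (2 * N))))" for a
    by (rule gaussian_translation_density[OF \<gamma>.prob_space_axioms sets_\<gamma> linear(1) SA S_sym N(1) mgf])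
  note ZN_moments = gaussian_vector_moments[OF assms(7,8)[OF N0(1)]]
  have \<gamma>_mean: "(\<integral>z. u \<bullet> z \<partial>\<gamma>) = 0" for u
    using ZN_moments(3)[of u] by (simp add: \<gamma>_def integral_distr)
  have \<gamma>_trace: "(\<integral>z. (norm z)\<^sup>2 \<partial>\<gamma>) = N * (\<Sum>b\<in>Basis. b \<bullet> S b)"
  proof -
    have "(\<integral>z. (norm z)\<^sup>2 \<partial>\<gamma>) = expectation (\<lambda>\<omega>. (norm (Z N \<omega>))\<^sup>2)"
      by (simp add: \<gamma>_def integral_distr)
    also have "\<dots> = expectation (\<lambda>\<omega>. \<Sum>b\<in>Basis. (b \<bullet> Z N \<omega>) * (b \<bullet> Z N \<omega>))"
      unfolding power2_norm_eq_inner
      by (intro Bochner_Integration.integral_cong refl, subst euclidean_inner) (simp add: inner_commute)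
    also have "\<dots> = (\<Sum>b\<in>Basis. b \<bullet> ((N *\<^sub>R \<Sigma>) *v b))"
      using covariance_bilinear[OF ZN_moments(2) assms(8)[OF N0(1)]]
      by (subst Bochner_Integration.integral_sum) (simp_all add: assms(9)[OF N0(1)])
    also have "\<dots> = N * (\<Sum>b\<in>Basis. b \<bullet> S b)"
      by (simp add: S_def scaleR_matrix_vector_assoc[symmetric] sum_distrib_left)
    finally show ?thesis .
  qed
  interpret gaussian_smoothing M \<gamma> S A X' \<beta> s N R
  proof (intro gaussian_smoothing.intro gaussian_smoothing_axioms.intro)
    show "0 \<le> R"
      using N5 by (simp add: R_def)
    show "R\<^sup>2 \<le> 5 / 4"
      using N5 unfolding R2 by (simp add: field_simps)
  qed (fact prob_space_axioms \<gamma>.prob_space_axioms linear SA S_sym coercive s X'_bound X'_mean X'_cov N sets_\<gamma> shift \<gamma>_mean \<gamma>_trace mgf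
        \<open>X' \<in> borel_measurable M\<close>)+
  obtain T where T [measurable]: "T \<in> borel_measurable borel"
    and cost: "(\<integral>\<^sup>+z. ennreal ((norm (z - T z))\<^sup>2) \<partial>\<gamma>) \<le> ennreal (25 * DIM(real ^ 'k) * \<beta>\<^sup>2 / N\<^sup>2)"
    and law: "distr \<gamma> borel T = distr (\<gamma> \<Otimes>\<^sub>M M) borel (\<lambda>p. (1 / R) *\<^sub>R fst p + X' (snd p))"
    using transport_map[OF R2] by blast
  \<comment> \<open>Exponential moments identify the two laws: Fubini factorises those of the first,
    independence of \<open>Z (N - 1)\<close> and \<open>X\<close> those of the second.\<close>
  have target: "distr (\<gamma> \<Otimes>\<^sub>M M) borel (\<lambda>p. (1 / R) *\<^sub>R fst p + X' (snd p))
      = distr M borel (\<lambda>\<omega>. Z (N - 1) \<omega> + X \<omega>)"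
  proof (rule measure_eqI_mgf)
    have [measurable]: "Z (N - 1) \<in> borel_measurable M"
      by (rule Z_meas[OF N0(2)])
    show "prob_space (distr (\<gamma> \<Otimes>\<^sub>M M) borel (\<lambda>p. (1 / R) *\<^sub>R fst p + X' (snd p)))"
      by (rule pair.P.prob_space_distr) measurable
    show "prob_space (distr M borel (\<lambda>\<omega>. Z (N - 1) \<omega> + X \<omega>))"
      by (rule prob_space_distr) measurable
    fix b :: "real ^ 'k"
    let ?e = "\<lambda>p. exp (((1 / R) *\<^sub>R b) \<bullet> fst p) * exp (b \<bullet> X' (snd p))"
    have split: "exp (b \<bullet> ((1 / R) *\<^sub>R fst p + X' (snd p))) = ?e p" for p :: "(real ^ 'k) \<times> 'a"
      by (simp only: inner_add_right exp_add inner_scaleR_right inner_scaleR_left)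
    have expX': "integrable M (\<lambda>\<omega>. exp (b \<bullet> X' \<omega>))"
      by (rule integrable_exp_inner_bounded[OF _ X'_bound]) measurable
    have int: "integrable (\<gamma> \<Otimes>\<^sub>M M) ?e"
    proof (rule pair.Fubini_integrable)
      show "integrable \<gamma> (\<lambda>z. \<integral>\<omega>. norm (?e (z, \<omega>)) \<partial>M)"
        using mgf(1)[of "(1 / R) *\<^sub>R b"] by simp
    qed (use expX' in auto)
    show "integrable (distr (\<gamma> \<Otimes>\<^sub>M M) borel (\<lambda>p. (1 / R) *\<^sub>R fst p + X' (snd p))) (\<lambda>z. exp (b \<bullet> z))"
      by (subst integrable_distr_eq) (simp_all only: split int, simp_all)
    have "(\<integral>z. exp (b \<bullet> z) \<partial>distr (\<gamma> \<Otimes>\<^sub>M M) borel (\<lambda>p. (1 / R) *\<^sub>R fst p + X' (snd p)))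
        = (\<integral>p. ?e p \<partial>(\<gamma> \<Otimes>\<^sub>M M))"
      by (subst integral_distr) (simp_all only: split, simp_all)
    also have "\<dots> = (\<integral>z. exp (((1 / R) *\<^sub>R b) \<bullet> z) \<partial>\<gamma>) * expectation (\<lambda>\<omega>. exp (b \<bullet> X' \<omega>))"
      using pair.integral_fst'[OF int] by simp
    \<comment> \<open>Scaling by \<open>1 / R\<close> divides the covariance by
      \<open>R\<^sup>2 = N / (N - 1)\<close>, leaving \<open>N - 1\<close> times \<Sigma>.\<close>
    also have "(\<integral>z. exp (((1 / R) *\<^sub>R b) \<bullet> z) \<partial>\<gamma>) = exp ((N - 1) * (b \<bullet> S b) / 2)"
    proof -
      have "((1 / R) *\<^sub>R b) \<bullet> S ((1 / R) *\<^sub>R b) = (b \<bullet> S b) / R\<^sup>2"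
        by (simp add: linear_scale[OF linear(1)] power2_eq_square)
      then show ?thesis
        unfolding mgf using N5 by (simp add: R2)
    qed
    also have "expectation (\<lambda>\<omega>. exp (b \<bullet> X' \<omega>)) = expectation (\<lambda>\<omega>. exp (b \<bullet> X \<omega>))"
      by (rule integral_cong_AE) (use XX' in auto)
    finally have lhs: "(\<integral>z. exp (b \<bullet> z) \<partial>distr (\<gamma> \<Otimes>\<^sub>M M) borel (\<lambda>p. (1 / R) *\<^sub>R fst p + X' (snd p)))
        = exp ((N - 1) * (b \<bullet> S b) / 2) * expectation (\<lambda>\<omega>. exp (b \<bullet> X \<omega>))" .
    have split2: "exp (b \<bullet> (Z (N - 1) \<omega> + X \<omega>)) = exp (b \<bullet> Z (N - 1) \<omega>) * exp (b \<bullet> X \<omega>)" for \<omega>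
      by (simp only: inner_add_right exp_add)
    have indep: "indep_var borel (\<lambda>\<omega>. exp (b \<bullet> Z (N - 1) \<omega>)) borel (\<lambda>\<omega>. exp (b \<bullet> X \<omega>))"
      using indep_var_compose[OF assms(10)[OF N0(2)], of "\<lambda>z. exp (b \<bullet> z)" borel "\<lambda>z. exp (b \<bullet> z)" borel]
      by (simp add: o_def)
    have expX: "integrable M (\<lambda>\<omega>. exp (b \<bullet> X \<omega>))"
      using expX' by (rule integrable_cong_AE_imp) (use XX' in auto)
    show "integrable (distr M borel (\<lambda>\<omega>. Z (N - 1) \<omega> + X \<omega>)) (\<lambda>z. exp (b \<bullet> z))"
      using indep_var_integrable[OF indep Z_exp(1)[OF N0(2)] expX]
      by (subst integrable_distr_eq) (simp_all add: split2)
    have "(\<integral>z. exp (b \<bullet> z) \<partial>distr M borel (\<lambda>\<omega>. Z (N - 1) \<omega> + X \<omega>))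
        = expectation (\<lambda>\<omega>. exp (b \<bullet> Z (N - 1) \<omega>) * exp (b \<bullet> X \<omega>))"
      by (subst integral_distr) (simp_all only: split2, simp_all)
    also have "\<dots> = expectation (\<lambda>\<omega>. exp (b \<bullet> Z (N - 1) \<omega>)) * expectation (\<lambda>\<omega>. exp (b \<bullet> X \<omega>))"
      by (rule indep_var_lebesgue_integral[OF indep Z_exp(1)[OF N0(2)] expX])
    finally show "(\<integral>z. exp (b \<bullet> z) \<partial>distr (\<gamma> \<Otimes>\<^sub>M M) borel (\<lambda>p. (1 / R) *\<^sub>R fst p + X' (snd p)))
        = (\<integral>z. exp (b \<bullet> z) \<partial>distr M borel (\<lambda>\<omega>. Z (N - 1) \<omega> + X \<omega>))"
      by (simp only: lhs Z_exp(2)[OF N0(2)])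
  qed simp_all
  \<comment> \<open>The coupling is carried by the graph of \<open>T\<close>, so its cost is the
    integral bounded in \<open>cost\<close>.\<close>
  define \<pi> where "\<pi> = distr \<gamma> (borel \<Otimes>\<^sub>M borel) (\<lambda>z. (z, T z))"
  have "\<pi> \<in> couplings \<gamma> (distr M borel (\<lambda>\<omega>. Z (N - 1) \<omega> + X \<omega>))"
  proof -
    have "prob_space \<pi>"
      unfolding \<pi>_def by (rule \<gamma>.prob_space_distr) measurable
    moreover have "distr \<pi> borel fst = \<gamma>"
      unfolding \<pi>_def by (subst distr_distr) (auto simp: o_def intro!: distr_id2)
    moreover have "distr \<pi> borel snd = distr M borel (\<lambda>\<omega>. Z (N - 1) \<omega> + X \<omega>)"
      unfolding \<pi>_def target[symmetric] law[symmetric] by (subst distr_distr) (auto simp: o_def)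
    ultimately show ?thesis
      by (simp add: couplings_def \<pi>_def)
  qed
  then have "(INF \<pi> \<in> couplings \<gamma> (distr M borel (\<lambda>\<omega>. Z (N - 1) \<omega> + X \<omega>)).
      \<integral>\<^sup>+ z. ennreal ((norm (fst z - snd z))\<^sup>2) \<partial>\<pi>) \<le> (\<integral>\<^sup>+ z. ennreal ((norm (fst z - snd z))\<^sup>2) \<partial>\<pi>)"
    by (rule INF_lower)
  also have "\<dots> = (\<integral>\<^sup>+z. ennreal ((norm (z - T z))\<^sup>2) \<partial>\<gamma>)"
    unfolding \<pi>_def by (subst nn_integral_distr) auto
  also note cost
  finally have "wasserstein2 \<gamma> (distr M borel (\<lambda>\<omega>. Z (N - 1) \<omega> + X \<omega>))
      \<le> ennreal (sqrt (25 * DIM(real ^ 'k) * \<beta>\<^sup>2 / N\<^sup>2))"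
    unfolding wasserstein2_def by (rule ennreal_sqrt_le) simp
  also have "sqrt (25 * DIM(real ^ 'k) * \<beta>\<^sup>2 / N\<^sup>2) = 5 * sqrt (real CARD('k)) * \<beta> / N"
    using \<beta> N by (simp add: real_sqrt_mult real_sqrt_divide)
  finally show ?thesis
    by (simp only: \<gamma>_def N_def)
qed

end
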